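(* Let $G=(V,E)$ be a finite simple planar triangulation on vertex set $\{v_1,\dots,v_n\}$ with outer face $\{v_1,v_2,v_3\}$, and let $\boldsymbol\ell=\{\ell_e\}_{e\in E}$ be a feasible vector of edge lengths. Assume that $\sigma_{\boldsymbol\ell}(v)=2\pi$ for every internal vertex $v$. Then there is a drawing of $G$ in the plane such that each edge $e$ is drawn as a straight line segment of length $\ell_e$ and no two edges cross. Furthermore, this drawing is unique up to translations and rotations.
   Context: A planar map is a graph together with a cyclic permutation of the edges incident to each vertex, for which there is a proper drawing in the plane (distinct vertices go to distinct points, edges to continuous curves that do not meet except at shared vertices) in which the clockwise order of the curves at each vertex is the given cyclic permutation. A finite triangulation is a finite connected simple planar map all of whose faces (including the outer one) are bounded by exactly three edges. One face $\{v_1,v_2,v_3\}$ is designated as the outer face; the other faces are inner faces, and a vertex is internal if it is not in $\{v_1,v_2,v_3\}$. Drawings of $G$ are understood to respect the map structure (cyclic orders) and to have $\{v_1,v_2,v_3\}$ as the outer (unbounded) face. A vector $\boldsymbol\ell=\{\ell_e\}_{e\in E}$ of positive reals is feasible if for any face bounded by edges $e_1,e_2,e_3$ the three strict triangle inequalities $\ell_{e_i}+\ell_{e_j}>\ell_{e_k}$, $\{i,j,k\}=\{1,2,3\}$, hold. For a feasible $\boldsymbol\ell$, an inner face $f$ and a vertex $v$ of $f$, let $\alpha_f^{\boldsymbol\ell}(v)\in(0,\pi)$ be the angle at $v$ in the Euclidean triangle whose side lengths are the $\ell$-lengths of the three edges of $f$. Set $\sigma_{\boldsymbol\ell}(v)=\sum_f\alpha_f^{\boldsymbol\ell}(v)$,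 the sum being over the inner faces $f$ containing $v$. *)

theory Defs
  imports
    "HOL-Analysis.Analysis"
    "HOL-Combinatorics.Orbits"
    "Graph_Theory.Graph_Theory"
begin

section \<open>Drawings of simple graphs in the plane\<close>

text \<open>
  A simple graph is a \<^locale>\<open>pair_graph\<close>: each undirected edge appears as two opposite
  arcs \<open>(u, v)\<close> and \<open>(v, u)\<close>. The plane is the type \<^typ>\<open>complex\<close>. A drawing consists of
  the positions \<open>p\<close> of the vertices and, for each arc \<open>(u, v)\<close>, a simple curve \<open>\<gamma> u v\<close> from
  \<open>p u\<close> to \<open>p v\<close>; the two arcs of an edge carry the same curve, traversed in opposite
  directions.
\<close>

definition proper_drawing ::
  "'a pair_pre_digraph \<Rightarrow> ('a \<Rightarrow> complex) \<Rightarrow> ('a \<Rightarrow> 'a \<Rightarrow> real \<Rightarrow> complex) \<Rightarrow> bool" where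
  "proper_drawing G p \<gamma> \<longleftrightarrow>
     inj_on p (pverts G) \<and>
     (\<forall>(u, v) \<in> parcs G.
        arc (\<gamma> u v) \<and> pathstart (\<gamma> u v) = p u \<and> pathfinish (\<gamma> u v) = p v \<and>
        \<gamma> v u = reversepath (\<gamma> u v) \<and>
        path_image (\<gamma> u v) \<inter> p ` pverts G = {p u, p v}) \<and>
     (\<forall>(u, v) \<in> parcs G. \<forall>(x, y) \<in> parcs G. {u, v} \<noteq> {x, y} \<longrightarrow>
        path_image (\<gamma> u v) \<inter> path_image (\<gamma> x y) \<subseteq> p ` ({u, v} \<inter> {x, y}))"

definition neighbours :: "'a pair_pre_digraph \<Rightarrow> 'a \<Rightarrow> 'a set" where
  "neighbours G v = {w. (v, w) \<in> parcs G}"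

text \<open>The first point of the curve \<open>g\<close> at distance \<open>r\<close> from its starting point.\<close>

definition first_hit :: "(real \<Rightarrow> complex) \<Rightarrow> real \<Rightarrow> complex" where
  "first_hit g r = g (Inf {t \<in> {0..1}. dist (g t) (pathstart g) = r})"

text \<open>The angle in \<open>[0, 2\<pi>)\<close> by which \<open>a\<close> has to be turned clockwise to point in the
  direction of \<open>b\<close>.\<close>

definition cw_angle :: "complex \<Rightarrow> complex \<Rightarrow> real" where
  "cw_angle a b = Arg2pi (a / b)"

text \<open>
  As the graph is simple, the edges at \<open>v\<close> correspond to the neighbours of \<open>v\<close>, and
  \<open>rot v\<close> is the permutation of the edges at \<open>v\<close>, in terms of neighbours. The clockwise order
  of the curves at \<open>v\<close> is read off on small circles around \<open>p v\<close>, from the points at which the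
  curves first meet the circle: the first such point found when moving clockwise from that of
  the edge to \<open>x\<close> has to belong to the edge to \<open>rot v x\<close>.
\<close>

definition respects_rotation ::
  "'a pair_pre_digraph \<Rightarrow> ('a \<Rightarrow> 'a \<Rightarrow> 'a) \<Rightarrow> ('a \<Rightarrow> complex) \<Rightarrow>
   ('a \<Rightarrow> 'a \<Rightarrow> real \<Rightarrow> complex) \<Rightarrow> bool" where
  "respects_rotation G rot p \<gamma> \<longleftrightarrow>
     (\<forall>v \<in> pverts G. \<forall>\<^sub>F r in at_right 0.
        let d = (\<lambda>w. first_hit (\<gamma> v w) r - p v) in
        \<forall>x \<in> neighbours G v. \<forall>y \<in> neighbours G v - {x}.
          cw_angle (d x) (d (rot v x)) \<le> cw_angle (d x) (d y))"

definition map_drawing ::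
  "'a pair_pre_digraph \<Rightarrow> ('a \<Rightarrow> 'a \<Rightarrow> 'a) \<Rightarrow> ('a \<Rightarrow> complex) \<Rightarrow>
   ('a \<Rightarrow> 'a \<Rightarrow> real \<Rightarrow> complex) \<Rightarrow> bool" where
  "map_drawing G rot p \<gamma> \<longleftrightarrow> proper_drawing G p \<gamma> \<and> respects_rotation G rot p \<gamma>"


section \<open>Planar maps and triangulations\<close>

definition planar_map :: "'a pair_pre_digraph \<Rightarrow> ('a \<Rightarrow> 'a \<Rightarrow> 'a) \<Rightarrow> bool" where
  "planar_map G rot \<longleftrightarrow>
     (\<forall>v \<in> pverts G. neighbours G v \<noteq> {} \<longrightarrow> cyclic_on (rot v) (neighbours G v)) \<and>
     (\<exists>p \<gamma>. map_drawing G rot p \<gamma>)"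

text \<open>
  The faces of a map are the equivalence classes of arcs under ``\<open>(x, v)\<close> is followed by
  \<open>(v, y)\<close>, where \<open>y\<close> is the clockwise successor of \<open>x\<close> at \<open>v\<close>''. In a drawing, a face in this
  sense consists of the arcs having a given connected component of the complement on their left.
\<close>

definition face_next :: "('a \<Rightarrow> 'a \<Rightarrow> 'a) \<Rightarrow> 'a \<times> 'a \<Rightarrow> 'a \<times> 'a" where
  "face_next rot = (\<lambda>(x, v). (v, rot v x))"

definition map_faces :: "'a pair_pre_digraph \<Rightarrow> ('a \<Rightarrow> 'a \<Rightarrow> 'a) \<Rightarrow> ('a \<times> 'a) set set" where
  "map_faces G rot = orbit (face_next rot) ` parcs G"

definition face_verts :: "('a \<times> 'a) set \<Rightarrow> 'a set" where
  "face_verts f = fst ` f"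

definition face_edges :: "('a \<times> 'a) set \<Rightarrow> 'a set set" where
  "face_edges f = (\<lambda>(u, v). {u, v}) ` f"

text \<open>The number of edges bounding a face is counted with multiplicity, that is, an edge with
  both sides on the face counts twice.\<close>

definition planar_triangulation :: "'a pair_pre_digraph \<Rightarrow> ('a \<Rightarrow> 'a \<Rightarrow> 'a) \<Rightarrow> bool" where
  "planar_triangulation G rot \<longleftrightarrow>
     pair_graph G \<and> Digraph_Component.connected (with_proj G) \<and> planar_map G rot \<and>
     (\<forall>f \<in> map_faces G rot. card f = 3)"


section \<open>Edge lengths and angles\<close>

text \<open>Edge lengths are given as a function on undirected edges \<open>{u, v}\<close>.\<close>

definition feasible ::
  "'a pair_pre_digraph \<Rightarrow> ('a \<Rightarrow> 'a \<Rightarrow> 'a) \<Rightarrow> ('a set \<Rightarrow> real) \<Rightarrow> bool" where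
  "feasible G rot l \<longleftrightarrow>
     (\<forall>(u, v) \<in> parcs G. 0 < l {u, v}) \<and>
     (\<forall>f \<in> map_faces G rot. \<forall>e1 e2 e3. face_edges f = {e1, e2, e3} \<longrightarrow>
        l e1 + l e2 > l e3 \<and> l e1 + l e3 > l e2 \<and> l e2 + l e3 > l e1)"

text \<open>The angle at \<open>B\<close> of the triangle \<open>A B C\<close>.\<close>

definition euclidean_angle :: "complex \<Rightarrow> complex \<Rightarrow> complex \<Rightarrow> real" where
  "euclidean_angle A B C = arccos (((A - B) \<bullet> (C - B)) / (norm (A - B) * norm (C - B)))"

definition face_angle :: "('a set \<Rightarrow> real) \<Rightarrow> ('a \<times> 'a) set \<Rightarrow> 'a \<Rightarrow> real" where
  "face_angle l f v =
     (THE \<theta>. \<exists>x y A B C. f = {(v, x), (x, y), (y, v)} \<and>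
        dist B A = l {v, x} \<and> dist A C = l {x, y} \<and> dist C B = l {y, v} \<and>
        \<theta> = euclidean_angle A B C)"

definition angle_sum ::
  "'a pair_pre_digraph \<Rightarrow> ('a \<Rightarrow> 'a \<Rightarrow> 'a) \<Rightarrow> ('a \<times> 'a) set \<Rightarrow> ('a set \<Rightarrow> real) \<Rightarrow> 'a \<Rightarrow> real" where
  "angle_sum G rot outer l v =
     (\<Sum>f \<in> {f \<in> map_faces G rot - {outer}. v \<in> face_verts f}. face_angle l f v)"


section \<open>Straight-line drawings\<close>

text \<open>
  A face is a cyclically oriented set of arcs, so that requiring it to be the unbounded face
  determines which side of its boundary is unbounded: the points immediately to the left of
  each of its arcs lie in the unbounded component of the complement of the drawing.
\<close>

definition is_unbounded_face ::
  "'a pair_pre_digraph \<Rightarrow> ('a \<Rightarrow> complex) \<Rightarrow> ('a \<times> 'a) set \<Rightarrow> bool" where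
  "is_unbounded_face G p f \<longleftrightarrow>
     (\<forall>(u, v) \<in> f. \<forall>\<^sub>F \<epsilon> in at_right 0.
        midpoint (p u) (p v) + of_real \<epsilon> * \<i> * (p v - p u)
          \<in> outside (\<Union>(x, y) \<in> parcs G. closed_segment (p x) (p y)))"

definition straight_drawing ::
  "'a pair_pre_digraph \<Rightarrow> ('a \<Rightarrow> 'a \<Rightarrow> 'a) \<Rightarrow> ('a \<times> 'a) set \<Rightarrow> ('a set \<Rightarrow> real) \<Rightarrow>
   ('a \<Rightarrow> complex) \<Rightarrow> bool" where
  "straight_drawing G rot outer l p \<longleftrightarrow>
     map_drawing G rot p (\<lambda>u v. linepath (p u) (p v)) \<and>
     is_unbounded_face G p outer \<and>
     (\<forall>(u, v) \<in> parcs G. dist (p u) (p v) = l {u, v})"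

end

(*
  Existence.  A simple graph drawn in the plane has at most 3 |V| - 6 edges: adding an arc whose ends are
  already joined splits a component of the complement (Jordan curve theorem), every arc borders at most two
  components, and every component borders at least three arcs (Janiszewski's theorem).  A triangulation with E
  edges, all of whose faces are combinatorial triangles, thus has Euler characteristic 2, so closed cochains
  are exact: a spanning tree of the faces and a complementary spanning tree of the vertices exhaust the edges.
  Applied to the relative rotations of the Euclidean triangles at the edges, whose sum around an inner vertex
  is a multiple of 2 pi by the angle condition, this aligns the triangles; applied to the resulting side
  vectors, it gives positions of the vertices.  Summing, over all arcs, the angle under which the arc is seen
  from a generic point shows that the inner triangles cover each point at most once, and only points of
  the outer triangle.  As the triangles at an inner edge or inner vertex cover a neighbourhood of it,
  nothing else can meet it.

  Uniqueness.  In a straight drawing the corner angles sum to 2 pi at each vertex, and to pi or 5 pi in each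
  face according to its orientation.  By Euler's formula exactly one face is negatively oriented, namely the
  outer one.  Two drawings are therefore related on each face by a rotation about the origin, up to
  translation, and neighbouring faces share it.
*)

theory Submission
  imports Defs
begin

(* It shadows the topological notion. *)
hide_const (open) Digraph_Component.connected

section \<open>Arcs in the plane: the edge bound for planar graphs\<close>

text \<open>The given drawing consists of arbitrary curves, while faces are orbits of arcs. Matching
  the orbits with the components of the complement is avoided: the curves yield an upper bound on
  the number of edges, which meets the lower bound valid for a connected map of any genus. The
  latter counts two disjoint sets of edges, a spanning tree of the dual and a spanning tree of what
  remains. Equality leaves no edge outside the two trees, and this is the form in which planarity is
  used for exactness. Rotations are closed only up to full turns, so exactness is proved modulo a
  subgroup, in a setting symmetric under duality. For rotations the map is read dually, vertices
  serving as faces; for positions it is read directly. Lengths disappear once the triangles are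
  aligned. That the pieces do not overlap depends on orientations alone, and the sign of the outer
  triangle is itself derived from a winding number count. This count is made at points off all edge
  lines, and is carried to the remaining points by density.\<close>

locale plane_arcs =
  fixes P :: "complex set" and I :: "'e set" and g :: "'e \<Rightarrow> real \<Rightarrow> complex"
  assumes finite_P: "finite P" and finite_I: "finite I"
    and arcs: "e \<in> I \<Longrightarrow> arc (g e)"
    and ends: "e \<in> I \<Longrightarrow> path_image (g e) \<inter> P = {pathstart (g e), pathfinish (g e)}"
    and meet: "e \<in> I \<Longrightarrow> e' \<in> I \<Longrightarrow> e \<noteq> e' \<Longrightarrow> path_image (g e) \<inter> path_image (g e') \<subseteq> P"
    and simple: "e \<in> I \<Longrightarrow> e' \<in> I \<Longrightarrow> e \<noteq> e' \<Longrightarrow>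
      {pathstart (g e), pathfinish (g e)} \<noteq> {pathstart (g e'), pathfinish (g e')}"
begin

definition skel :: "'e set \<Rightarrow> complex set" where
  "skel J = P \<union> (\<Union>e\<in>J. path_image (g e))"

definition open_arc :: "'e \<Rightarrow> complex set" where
  "open_arc e = path_image (g e) - {pathstart (g e), pathfinish (g e)}"

lemma compact_skel: "J \<subseteq> I \<Longrightarrow> compact (skel J)"
  unfolding skel_def
  using finite_P finite_I arcs
  by (intro compact_Un finite_imp_compact compact_UN compact_path_image)
     (auto intro: finite_subset arc_imp_path)

lemma closed_skel: "J \<subseteq> I \<Longrightarrow> closed (skel J)"
  by (simp add: compact_skel compact_imp_closed)

lemma skel_insert: "skel (insert e J) = skel J \<union> path_image (g e)"
  by (auto simp: skel_def)

lemma skel_mono: "J \<subseteq> J' \<Longrightarrow> skel J \<subseteq> skel J'"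
  by (auto simp: skel_def)

lemma arc_Int_skel:
  assumes "e \<in> I" "J \<subseteq> I" "e \<notin> J"
  shows "path_image (g e) \<inter> skel J = {pathstart (g e), pathfinish (g e)}"
proof -
  have "path_image (g e) \<inter> skel J \<subseteq> path_image (g e) \<inter> P"
    using assms meet[of e] by (fastforce simp: skel_def)
  then show ?thesis
    using ends[OF assms(1)] by (auto simp: skel_def)
qed

lemma open_arc_Int_skel:
  assumes "e \<in> I" "J \<subseteq> I" "e \<notin> J"
  shows "open_arc e \<inter> skel J = {}"
  using arc_Int_skel[OF assms] by (auto simp: open_arc_def)

lemma open_arc_nonempty: "e \<in> I \<Longrightarrow> open_arc e \<noteq> {}"
  unfolding open_arc_def using nonempty_simple_path_endless arcs arc_imp_simple_path by blast

lemma connected_open_arc: "e \<in> I \<Longrightarrow> connected (open_arc e)"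
  unfolding open_arc_def by (simp add: arcs arc_imp_simple_path connected_simple_path_endless)

text \<open>The second half \<open>b\<close> is exported because Janiszewski's theorem later needs
  the set in which the curve meets the rest of the skeleton to be connected; that set is exactly
  \<open>b\<close>.\<close>

lemma closing_curve:
  assumes "e \<in> I" "J \<subseteq> I" "e \<notin> J"
    and "path_component (skel J) (pathstart (g e)) (pathfinish (g e))"
  obtains c b where "simple_path c" "pathfinish c = pathstart c"
    "path_image c = path_image (g e) \<union> b" "b \<subseteq> skel J" "connected b"
    "pathstart (g e) \<in> b" "pathfinish (g e) \<in> b"
proof -
  have "pathfinish (g e) \<noteq> pathstart (g e)"
    using arcs[OF assms(1)] arc_distinct_ends by metis
  moreover obtain h where "path h" "path_image h \<subseteq> skel J" "pathstart h = pathfinish (g e)"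
    "pathfinish h = pathstart (g e)"
    using assms(4) path_component_sym unfolding path_component_def by metis
  ultimately obtain b where b: "arc b" "path_image b \<subseteq> skel J" "pathstart b = pathfinish (g e)"
    "pathfinish b = pathstart (g e)"
    using path_contains_arc[of h] by (metis order_trans)
  have "path_image (g e) \<inter> path_image b \<subseteq> {pathstart (g e), pathstart b}"
    using arc_Int_skel[OF assms(1-3)] b by auto
  then have "simple_path (g e +++ b)"
    using b arcs[OF assms(1)] by (intro simple_path_join_loop) auto
  then show ?thesis
    using b pathstart_in_path_image[of b] pathfinish_in_path_image[of b]
    by (intro that[of "g e +++ b" "path_image b"])
      (auto simp: path_image_join intro: connected_path_image arc_imp_path)
qed

text \<open>The closed curve through the new arc has its two sides meeting every neighbourhood of
  a point of that arc, so the component containing the arc falls apart.\<close>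

lemma insert_arc_splits:
  assumes e: "e \<in> I" "J \<subseteq> I" "e \<notin> J"
    and pc: "path_component (skel J) (pathstart (g e)) (pathfinish (g e))"
    and W: "W \<in> components (- skel J)" "open_arc e \<subseteq> W"
  obtains D1 D2 where "D1 \<in> components (- skel (insert e J))" "D2 \<in> components (- skel (insert e J))"
    "D1 \<noteq> D2" "D1 \<subseteq> W" "D2 \<subseteq> W"
proof -
  obtain c b where c: "simple_path c" "pathfinish c = pathstart c"
    "path_image c = path_image (g e) \<union> b" "b \<subseteq> skel J"
    using closing_curve[OF e pc] by metis
  note J = Jordan_inside_outside[OF c(1,2)]
  have oW: "open W"
    using W(1) closed_skel[OF e(2)] by (metis open_Compl open_components)
  obtain z where z: "z \<in> open_arc e" using open_arc_nonempty e by blast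
  have zc: "z \<in> path_image c" using z c(3) by (auto simp: open_arc_def)
  have "z \<in> closure (inside (path_image c))" "z \<in> closure (outside (path_image c))"
    using J zc by (auto simp: frontier_def)
  then have "W \<inter> inside (path_image c) \<noteq> {}" "W \<inter> outside (path_image c) \<noteq> {}"
    using open_Int_closure_eq_empty[OF oW] z W(2) by blast+
  then obtain z1 z2 where z1: "z1 \<in> W" "z1 \<in> inside (path_image c)"
    and z2: "z2 \<in> W" "z2 \<in> outside (path_image c)" by blast
  have Wsub: "W \<subseteq> - skel J" using W(1) in_components_subset by blast
  have cK: "path_image c \<subseteq> skel (insert e J)" using c by (auto simp: skel_insert)
  have io: "inside (path_image c) \<inter> path_image c = {}" "outside (path_image c) \<inter> path_image c = {}"
    by (simp_all add: inside_no_overlap outside_no_overlap)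
  have in1: "z1 \<in> - skel (insert e J)" and in2: "z2 \<in> - skel (insert e J)"
    using z1 z2 Wsub io unfolding c(3) skel_insert by blast+
  define D where "D z = connected_component_set (- skel (insert e J)) z" for z
  have DW: "D z \<subseteq> W" if "z \<in> W" for z
  proof -
    have "D z \<subseteq> - skel J" using connected_component_subset[of "- skel (insert e J)" z] skel_mono[of J "insert e J"]
      by (auto simp: D_def)
    moreover have "connected (D z)" by (simp add: D_def)
    moreover have "W \<inter> D z \<noteq> {} \<or> D z = {}"
      using that connected_component_in unfolding D_def by fastforce
    ultimately show ?thesis using components_maximal[OF W(1)] by blast
  qed
  have "D z1 \<noteq> D z2"
  proof
    assume "D z1 = D z2"
    then have "connected_component (- skel (insert e J)) z1 z2"
      using in2 unfolding D_def by (metis connected_component_eq_eq)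
    then have cc: "connected_component (- path_image c) z1 z2"
      using cK by (meson Compl_anti_mono connected_component_of_subset)
    have "z2 \<in> inside (path_image c)"
      using cc z1(2) by (simp add: inside_same_component)
    then show False using z2 J by blast
  qed
  then show ?thesis
    using that[of "D z1" "D z2"] DW z1 z2 in1 in2 by (auto simp: D_def components_def)
qed

lemma open_arc_in_component:
  assumes e: "e \<in> I" "J \<subseteq> I" "e \<notin> J"
  obtains W where "W \<in> components (- skel J)" "open_arc e \<subseteq> W"
proof -
  have "open_arc e \<subseteq> - skel J" using open_arc_Int_skel[OF e] by blast
  then show ?thesis
    using exists_component_superset[of "open_arc e" "- skel J"] connected_open_arc open_arc_nonempty e that
    by (metis subset_empty)
qed

text \<open>Components that miss the new arc survive, and the one containing it is replaced by two.
  Finite families are used because the finiteness of the set of all components is not yet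
  known.\<close>

lemma insert_arc_components:
  assumes e: "e \<in> I" "J \<subseteq> I" "e \<notin> J"
    and pc: "path_component (skel J) (pathstart (g e)) (pathfinish (g e))"
    and Z: "finite Z" "Z \<subseteq> components (- skel J)"
  obtains Z' where "finite Z'" "Z' \<subseteq> components (- skel (insert e J))" "card Z' \<ge> Suc (card Z)"
proof -
  obtain W where W: "W \<in> components (- skel J)" "open_arc e \<subseteq> W"
    using open_arc_in_component[OF e] .
  obtain D1 D2 where D: "D1 \<in> components (- skel (insert e J))" "D2 \<in> components (- skel (insert e J))"
    "D1 \<noteq> D2" "D1 \<subseteq> W" "D2 \<subseteq> W"
    using insert_arc_splits[OF e pc W] .
  have keep: "C \<in> components (- skel (insert e J))" if C: "C \<in> Z - {W}" for C
  proof -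
    have C1: "C \<in> components (- skel J)" "C \<noteq> W" using C Z by auto
    then have "C \<inter> W = {}" using W components_nonoverlap by metis
    then have sub: "C \<subseteq> - skel (insert e J)"
    proof -
      have "path_image (g e) \<subseteq> W \<union> skel J" using W(2) arc_Int_skel[OF e] unfolding open_arc_def by blast
      then show ?thesis
        using \<open>C \<inter> W = {}\<close> in_components_subset[OF C1(1)] unfolding skel_insert by blast
    qed
    show ?thesis
      using components_intermediate_subset[OF C1(1) sub] skel_mono[of J "insert e J"] by blast
  qed
  have D': "D1 \<noteq> {}" "D2 \<noteq> {}" using D in_components_nonempty by blast+
  have notin: "D1 \<notin> Z - {W}" "D2 \<notin> Z - {W}"
    using D D' Z W components_nonoverlap by (metis Diff_iff Int_absorb2 insertCI subsetD)+
  let ?Z = "insert D1 (insert D2 (Z - {W}))"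
  have "card ?Z = Suc (Suc (card (Z - {W})))"
    using notin D(3) Z(1) by simp
  moreover have "card Z \<le> Suc (card (Z - {W}))"
    using Z(1) by (metis card_Diff1_le card_Suc_Diff1 Diff_empty Diff_insert0 le_SucI order_refl)
  ultimately show ?thesis
    using that[of ?Z] Z D keep by auto
qed

text \<open>Every component bordering the arc lies in the component \<open>W\<close> that contains
  the open arc before its insertion. Inside \<open>W\<close>, the side of the Jordan curve
  determines the component, by Janiszewski's theorem, so \<open>D\<close> can be recovered from one
  bit.\<close>

lemma touching_sides:
  assumes e: "e \<in> I"
    and pc: "path_component (skel (I - {e})) (pathstart (g e)) (pathfinish (g e))"
  shows "finite {D \<in> components (- skel I). closure D \<inter> open_arc e \<noteq> {}}" (is "finite ?T")
    and "card {D \<in> components (- skel I). closure D \<inter> open_arc e \<noteq> {}} \<le> 2"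
proof -
  define J where "J = I - {e}"
  have eJ: "e \<in> I" "J \<subseteq> I" "e \<notin> J" "insert e J = I" using e by (auto simp: J_def)
  obtain W where W: "W \<in> components (- skel J)" "open_arc e \<subseteq> W"
    using open_arc_in_component[OF eJ(1-3)] .
  obtain c b where c: "simple_path c" "pathfinish c = pathstart c"
    "path_image c = path_image (g e) \<union> b" "b \<subseteq> skel J" "connected b"
    "pathstart (g e) \<in> b" "pathfinish (g e) \<in> b"
    using closing_curve[OF eJ(1-3)] pc unfolding J_def by metis
  note Jo = Jordan_inside_outside[OF c(1,2)]
  have KI: "skel I = skel J \<union> path_image c" using c(3,4) eJ(4) by (metis skel_insert sup.absorb1 sup.assoc sup.commute)
  have int: "skel J \<inter> path_image c = b" proof -
    have "skel J \<inter> path_image (g e) \<subseteq> b" using c(6,7) arc_Int_skel[OF eJ(1-3)] by (simp add: Int_commute)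
    then show ?thesis using c(4) unfolding c(3) by blast
  qed
  have oW: "open W"
    using W(1) closed_skel[OF eJ(2)] by (metis open_Compl open_components)
  have inW: "D \<subseteq> W" if D: "D \<in> ?T" for D
  proof -
    have "D \<inter> W \<noteq> {}" using D W(2) open_Int_closure_eq_empty[OF oW, of D] by blast
    moreover have "D \<subseteq> - skel J" using D in_components_subset KI by blast
    moreover have "connected D" using D in_components_connected by blast
    ultimately show ?thesis using components_maximal[OF W(1)] by (simp add: inf_commute)
  qed
  define x where "x D = (SOME z. z \<in> D)" for D :: "complex set"
  have x: "x D \<in> D" if "D \<in> ?T" for D
    using that in_components_nonempty some_in_eq unfolding x_def by blast
  have inj: "inj_on (\<lambda>D. x D \<in> inside (path_image c)) ?T"
  proof (rule inj_onI)
    fix D D' assume D: "D \<in> ?T" "D' \<in> ?T" and eq: "(x D \<in> inside (path_image c)) = (x D' \<in> inside (path_image c))"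
    have nin: "x D \<notin> skel I" "x D' \<notin> skel I" using x[OF D(1)] x[OF D(2)] D in_components_subset by blast+
    then have nc: "x D \<notin> path_image c" "x D' \<notin> path_image c" using KI by auto
    have "connected_component (- path_image c) (x D) (x D')"
    proof (cases "x D \<in> inside (path_image c)")
      case True
      then show ?thesis
        using Jo eq inside_no_overlap[of "path_image c"] unfolding connected_component_def
        by (intro exI[of _ "inside (path_image c)"]) blast
    next
      case False
      then have "x D \<in> outside (path_image c)" "x D' \<in> outside (path_image c)"
        using nc inside_Un_outside[of "path_image c"] eq by blast+
      then show ?thesis
        using Jo outside_no_overlap[of "path_image c"] unfolding connected_component_def
        by (intro exI[of _ "outside (path_image c)"]) blast
    qed
    moreover have "connected_component (- skel J) (x D) (x D')"
      using inW[OF D(1)] inW[OF D(2)] x[OF D(1)] x[OF D(2)] W(1) unfolding connected_component_def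
      by (intro exI[of _ W]) (auto dest: in_components_connected in_components_subset)
    ultimately have cc: "connected_component (- (skel J \<union> path_image c)) (x D) (x D')"
      using Janiszewski[of "skel J" "path_image c"] compact_skel[OF eJ(2)] int c(1,5)
      by (simp add: closed_simple_path_image)
    then have "D \<inter> connected_component_set (- skel I) (x D) \<noteq> {}" "D' \<inter> connected_component_set (- skel I) (x D) \<noteq> {}"
      using x[OF D(1)] x[OF D(2)] nin KI by auto
    moreover have "connected_component_set (- skel I) (x D) \<in> components (- skel I)"
      using nin by (auto simp: components_def)
    ultimately show "D = D'" using D components_nonoverlap by (metis (mono_tags, lifting) mem_Collect_eq)
  qed
  show "finite ?T" using inj by (rule inj_on_finite[of _ _ UNIV]) auto
  have "card ?T \<le> card (UNIV :: bool set)" using inj by (intro card_inj_on_le) auto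
  then show "card ?T \<le> 2" by simp
qed

text \<open>Two arcs with different pairs of ends share at most one point, so their intersection is
  connected and Janiszewski's theorem applies. Deleting the finitely many remaining points of
  \<open>P\<close> does not disconnect an open set.\<close>

lemma few_arcs_not_separating:
  assumes "J \<subseteq> I" "card J \<le> 2"
  shows "connected (- skel J)"
proof -
  have fin: "finite J" using assms finite_I finite_subset by blast
  have conn1: "connected (- path_image (g e))" if "e \<in> J" for e
    using that assms arcs connected_arc_complement[of "g e"] by (auto simp: DIM_complex)
  have "connected (- (\<Union>e\<in>J. path_image (g e)))"
  proof -
    consider "J = {}" | e where "J = {e}" | e e' where "J = {e, e'}" "e \<noteq> e'"
    proof -
      have "card J = 0 \<or> card J = 1 \<or> card J = 2" using assms(2) by linarith
      then show ?thesis using that fin by (metis card_0_eq card_1_singletonE card_2_iff)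
    qed
    then show ?thesis
    proof cases
      case 3
      have eI: "e \<in> I" "e' \<in> I" using 3 assms by auto
      have "path_image (g e) \<inter> path_image (g e') \<subseteq> {pathstart (g e), pathfinish (g e)} \<inter> {pathstart (g e'), pathfinish (g e')}"
        using meet[OF eI 3(2)] ends[OF eI(1)] ends[OF eI(2)] by blast
      moreover have "\<exists>z. {pathstart (g e), pathfinish (g e)} \<inter> {pathstart (g e'), pathfinish (g e')} \<subseteq> {z}"
        using simple[OF eI 3(2)] by (rule_tac ccontr) (smt (verit) Int_iff insert_commute insert_iff singletonD subsetI)
      ultimately obtain z where "path_image (g e) \<inter> path_image (g e') \<subseteq> {z}" by blast
      then have "connected (path_image (g e) \<inter> path_image (g e'))"
        by (metis connected_empty connected_sing subset_singletonD)
      then show ?thesis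
        using Janiszewski_connected[of "path_image (g e)" "path_image (g e')"] conn1 3 arcs eI
        by (simp add: compact_arc_image closed_arc_image)
    qed (use conn1 in auto)
  qed
  moreover have "closed (\<Union>e\<in>J. path_image (g e))"
    using fin assms arcs by (intro closed_UN) (auto intro: closed_arc_image)
  ultimately have "connected (- (\<Union>e\<in>J. path_image (g e)) - P)"
    using finite_P by (intro connected_open_delete_finite open_Compl) auto
  moreover have "- (\<Union>e\<in>J. path_image (g e)) - P = - skel J" by (auto simp: skel_def)
  ultimately show ?thesis by simp
qed

text \<open>A component bordering at most two arcs is open and closed in the complement of these
  arcs, which is connected, so it fills that complement. But a third arc runs through it.\<close>

lemma component_touches_three:
  assumes "card I \<ge> 3" and D: "D \<in> components (- skel I)"
  shows "card {e \<in> I. closure D \<inter> open_arc e \<noteq> {}} \<ge> 3"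
proof (rule ccontr)
  define J where "J = {e \<in> I. closure D \<inter> open_arc e \<noteq> {}}"
  assume "\<not> card {e \<in> I. closure D \<inter> open_arc e \<noteq> {}} \<ge> 3"
  then have cJ: "card J \<le> 2" and JI: "J \<subseteq> I" by (auto simp: J_def)
  have conn: "connected (- skel J)" using few_arcs_not_separating[OF JI cJ] .
  have DI: "D \<subseteq> - skel I" "D \<noteq> {}" using D in_components_subset in_components_nonempty by blast+
  have oD: "open D" using D closed_skel[of I] by (metis open_Compl open_components order_refl)
  have cl: "closure D \<inter> - skel J \<subseteq> D"
  proof
    fix z assume z: "z \<in> closure D \<inter> - skel J"
    have "z \<notin> skel I"
    proof
      assume "z \<in> skel I"
      then obtain e where e: "e \<in> I" "z \<in> path_image (g e)" "z \<notin> P" using z by (auto simp: skel_def)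
      then have "z \<in> open_arc e" using ends[of e] by (auto simp: open_arc_def)
      then have "e \<in> J" using z e by (auto simp: J_def)
      then show False using z e by (auto simp: skel_def)
    qed
    moreover obtain c where "closed c" "D = - skel I \<inter> c"
      using closedin_component[OF D] by (auto simp: closedin_closed)
    moreover from this have "closure D \<subseteq> c" by (simp add: closure_minimal)
    ultimately show "z \<in> D" using z by blast
  qed
  have "D = - skel J"
  proof -
    have sub: "D \<subseteq> - skel J" using DI skel_mono[OF JI] by blast
    have "openin (top_of_set (- skel J)) D" using oD sub by (simp add: openin_open_eq open_subset)
    moreover have "closedin (top_of_set (- skel J)) D"
      using cl sub closure_subset[of D] by (auto simp: closedin_closed intro!: exI[of _ "closure D"])
    ultimately show ?thesis using conn DI(2) by (auto simp: connected_clopen)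
  qed
  moreover obtain e where e: "e \<in> I" "e \<notin> J"
  proof -
    have "\<not> I \<subseteq> J" using assms(1) cJ JI by (metis card_mono finite_I finite_subset le_trans not_less_eq_eq numeral_2_eq_2 numeral_3_eq_3)
    then show ?thesis using that by blast
  qed
  moreover obtain z where "z \<in> open_arc e" using open_arc_nonempty[OF e(1)] by blast
  moreover have "z \<in> skel I" using e \<open>z \<in> open_arc e\<close> by (auto simp: skel_def open_arc_def)
  ultimately show False using open_arc_Int_skel[OF e(1) JI e(2)] DI by blast
qed

text \<open>\<open>T\<close> is a spanning tree and \<open>cyc\<close> says that no arc is a bridge.
  Starting from one component for \<open>T\<close>, each further arc adds at least one, which gives
  at least \<open>card I - card P + 2\<close> components. Counting incidences of components and arcs
  bounds three times their number by \<open>2 * card I\<close>.\<close>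

theorem card_arcs_bound:
  assumes "card I \<ge> 3"
    and T: "T \<subseteq> I" "Suc (card T) = card P" "\<And>x y. x \<in> P \<Longrightarrow> y \<in> P \<Longrightarrow> path_component (skel T) x y"
    and cyc: "\<And>e. e \<in> I \<Longrightarrow> path_component (skel (I - {e})) (pathstart (g e)) (pathfinish (g e))"
  shows "card I + 6 \<le> 3 * card P"
proof -
  have endP: "pathstart (g e) \<in> P" "pathfinish (g e) \<in> P" if "e \<in> I" for e
    using ends[OF that] by auto
  have many: "\<exists>Z. finite Z \<and> Z \<subseteq> components (- skel (T \<union> J)) \<and> card Z \<ge> Suc (card J)"
    if "finite J" "J \<subseteq> I - T" for J
    using that
  proof (induction J)
    case empty
    have "bounded (skel T)" using compact_skel[OF T(1)] compact_imp_bounded by blast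
    then have "- skel T \<noteq> {}" using not_bounded_UNIV by (metis boolean_algebra.compl_zero double_compl)
    then obtain D where "D \<in> components (- skel T)" using components_eq_empty by blast
    then show ?case by (intro exI[of _ "{D}"]) auto
  next
    case (insert e J)
    then obtain Z where Z: "finite Z" "Z \<subseteq> components (- skel (T \<union> J))" "card Z \<ge> Suc (card J)" by auto
    have e: "e \<in> I" "T \<union> J \<subseteq> I" "e \<notin> T \<union> J" using insert T by auto
    have "path_component (skel (T \<union> J)) (pathstart (g e)) (pathfinish (g e))"
      using T(3) endP[OF e(1)] skel_mono[of T "T \<union> J"] by (meson path_component_of_subset sup_ge1)
    from insert_arc_components[OF e this Z(1,2)] obtain Z'
      where "finite Z'" "Z' \<subseteq> components (- skel (insert e (T \<union> J)))" "card Z' \<ge> Suc (card Z)" by metis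
    then show ?case using Z(3) insert by (intro exI[of _ Z']) auto
  qed
  let ?C = "components (- skel I)" and ?t = "\<lambda>D e. closure D \<inter> open_arc e \<noteq> {}"
  have fine: "finite {D \<in> ?C. ?t D e}" "card {D \<in> ?C. ?t D e} \<le> 2" if "e \<in> I" for e
    using touching_sides[OF that cyc[OF that]] by auto
  have "?C \<subseteq> (\<Union>e\<in>I. {D \<in> ?C. ?t D e})"
  proof
    fix D assume "D \<in> ?C"
    with component_touches_three[OF assms(1) this] have "{e \<in> I. ?t D e} \<noteq> {}" by (metis card.empty not_numeral_le_zero)
    with \<open>D \<in> ?C\<close> show "D \<in> (\<Union>e\<in>I. {D \<in> ?C. ?t D e})" by blast
  qed
  then have finC: "finite ?C" using fine finite_I by (meson finite_UN finite_subset)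
  have "3 * card ?C \<le> (\<Sum>D\<in>?C. card {e \<in> I. ?t D e})"
    using sum_mono[of ?C "\<lambda>_. 3" "\<lambda>D. card {e \<in> I. ?t D e}"] component_touches_three[OF assms(1)]
    by (simp add: mult.commute)
  also have "\<dots> = (\<Sum>e\<in>I. card {D \<in> ?C. ?t D e})"
    using sum_multicount_gen[of I ?C "\<lambda>e D. ?t D e" "\<lambda>D. card {e \<in> I. ?t D e}"] finite_I finC
    by simp
  also have "\<dots> \<le> 2 * card I"
    using sum_mono[of I "\<lambda>e. card {D \<in> ?C. ?t D e}" "\<lambda>_. 2"] fine by (simp add: mult.commute)
  finally have 1: "3 * card ?C \<le> 2 * card I" .
  obtain Z where "Z \<subseteq> components (- skel (T \<union> (I - T)))" "card Z \<ge> Suc (card (I - T))"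
    using many[of "I - T"] finite_I by auto
  then have "Suc (card (I - T)) \<le> card ?C"
    using T(1) finC card_mono[of ?C Z] by (simp add: Un_absorb1) 
  moreover have "card I = card (I - T) + card T"
    using T(1) finite_I by (metis card_Diff_subset card_mono finite_subset le_add_diff_inverse2)
  ultimately show ?thesis using 1 T(2) by linarith
qed

end

section \<open>Combinatorial maps on a sphere\<close>

text \<open>Kept abstract because the same darts carry two graphs, a map and its dual:
  \<open>s\<close> is the origin of a dart in one and its face in the other.\<close>

locale dart_graph =
  fixes A :: "'d set" and inv :: "'d \<Rightarrow> 'd" and X :: "'n set" and s :: "'d \<Rightarrow> 'n"
  assumes finite_darts: "finite A" and finite_nodes: "finite X"
    and inv_in: "a \<in> A \<Longrightarrow> inv a \<in> A" and inv_inv: "a \<in> A \<Longrightarrow> inv (inv a) = a"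
    and node_in: "a \<in> A \<Longrightarrow> s a \<in> X"
begin

definition adj :: "('n \<times> 'n) set" where
  "adj = {(s a, s (inv a)) | a. a \<in> A}"

text \<open>The dart \<open>par y\<close> leads from \<open>y\<close> towards the root. The rank
  \<open>d\<close> excludes cycles and serves both recursion away from the root and induction from
  the leaves.\<close>

definition rooted_tree :: "'n \<Rightarrow> ('n \<Rightarrow> nat) \<Rightarrow> ('n \<Rightarrow> 'd) \<Rightarrow> bool" where
  "rooted_tree r d par \<longleftrightarrow>
     r \<in> X \<and> (\<forall>y \<in> X - {r}. par y \<in> A \<and> s (par y) = y \<and> d (s (inv (par y))) < d y)"

definition tree_darts :: "'n \<Rightarrow> ('n \<Rightarrow> 'd) \<Rightarrow> 'd set" where
  "tree_darts r par = par ` (X - {r}) \<union> inv ` par ` (X - {r})"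

lemma sym_adj: "sym adj"
  unfolding adj_def
proof (rule symI, clarsimp)
  fix a assume "a \<in> A"
  then show "\<exists>b. s (inv a) = s b \<and> s a = s (inv b) \<and> b \<in> A"
    by (intro exI[of _ "inv a"]) (simp add: inv_in inv_inv)
qed

lemma rooted_tree_exists:
  assumes r: "r \<in> X" and conn: "\<And>x. x \<in> X \<Longrightarrow> (r, x) \<in> adj\<^sup>*"
  obtains d par where "rooted_tree r d par"
proof -
  define d where "d x = (LEAST n. (r, x) \<in> adj ^^ n)" for x
  have step: "\<exists>a\<in>A. s a = y \<and> d (s (inv a)) < d y" if y: "y \<in> X - {r}" for y
  proof -
    obtain n where "(r, y) \<in> adj ^^ n" using conn y rtrancl_imp_relpow by fast
    then have dy: "(r, y) \<in> adj ^^ d y" unfolding d_def by (rule LeastI)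
    then obtain m where m: "d y = Suc m" using y by (cases "d y") auto
    then obtain x where x: "(r, x) \<in> adj ^^ m" "(x, y) \<in> adj" using dy by auto
    have "d x \<le> m" unfolding d_def using x(1) by (rule Least_le)
    moreover obtain a where "a \<in> A" "s a = y" "s (inv a) = x"
      using symD[OF sym_adj x(2)] unfolding adj_def by blast
    ultimately show ?thesis using m by auto
  qed
  define par where "par y = (SOME a. a \<in> A \<and> s a = y \<and> d (s (inv a)) < d y)" for y
  have "par y \<in> A \<and> s (par y) = y \<and> d (s (inv (par y))) < d y" if "y \<in> X - {r}" for y
    unfolding par_def by (rule someI_ex) (use step[OF that] in blast)
  then show ?thesis using r by (intro that[of d par]) (auto simp: rooted_tree_def)
qed

lemma tree_darts_subset: "rooted_tree r d par \<Longrightarrow> tree_darts r par \<subseteq> A"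
  using inv_in by (auto simp: rooted_tree_def tree_darts_def)

lemma tree_darts_inv:
  "rooted_tree r d par \<Longrightarrow> a \<in> tree_darts r par \<Longrightarrow> inv a \<in> tree_darts r par"
  unfolding tree_darts_def rooted_tree_def using inv_inv by force

lemma card_tree_darts:
  assumes T: "rooted_tree r d par"
  shows "card (tree_darts r par) + 2 = 2 * card X"
proof -
  let ?Y = "X - {r}"
  have inj: "inj_on par ?Y" using T unfolding rooted_tree_def by (metis inj_onI)
  have "inj_on inv (par ` ?Y)"
    using T inv_inv unfolding rooted_tree_def by (intro inj_on_inverseI[of _ inv]) blast
  then have c: "card (inv ` par ` ?Y) = card (par ` ?Y)" "card (par ` ?Y) = card ?Y"
    using inj by (simp_all add: card_image)
  have "par ` ?Y \<inter> inv ` par ` ?Y = {}"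
  proof (rule ccontr)
    assume "par ` ?Y \<inter> inv ` par ` ?Y \<noteq> {}"
    then obtain x y where xy: "x \<in> ?Y" "y \<in> ?Y" "par x = inv (par y)" by auto
    then have "d (s (par x)) < d (s (par y))" "d (s (par y)) < d (s (par x))"
      using T inv_inv unfolding rooted_tree_def by metis+
    then show False by simp
  qed
  then have "card (tree_darts r par) = 2 * card ?Y"
    unfolding tree_darts_def using finite_nodes c by (subst card_Un_disjoint) auto
  moreover have "Suc (card ?Y) = card X"
    using T finite_nodes unfolding rooted_tree_def by (meson card_Suc_Diff1)
  ultimately show ?thesis by linarith
qed

text \<open>A tree has no cycles that could obstruct integration: \<open>c\<close> is defined by
  recursion on the rank, with the arbitrary value 0 at the root.\<close>

lemma tree_potential:
  fixes D :: "'d \<Rightarrow> 'g::ab_group_add"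
  assumes T: "rooted_tree r d par"
  obtains c where "\<And>y. y \<in> X - {r} \<Longrightarrow> c (s (inv (par y))) - c y = D (par y)"
proof -
  define F where "F = (\<lambda>(c :: 'n \<Rightarrow> 'g) y. if y \<in> X - {r} then c (s (inv (par y))) - D (par y) else 0)"
  define c where "c = wfrec (Wellfounded.measure d) F"
  have "c (s (inv (par y))) - c y = D (par y)" if y: "y \<in> X - {r}" for y
  proof -
    have "c y = F (cut c (Wellfounded.measure d) y) y" unfolding c_def by (rule wfrec) simp
    also have "\<dots> = c (s (inv (par y))) - D (par y)"
      using y T by (auto simp: F_def cut_apply rooted_tree_def)
    finally show ?thesis by simp
  qed
  then show ?thesis by (rule that)
qed

text \<open>Strips leaves off the tree, deepest nodes first. At a node \<open>y\<close>, any dart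
  other than \<open>par y\<close> is off the tree or leads to a child, which has larger rank and has
  been treated already.\<close>

lemma leaf_induct:
  assumes T: "rooted_tree r d par"
    and sym: "\<And>a. a \<in> A \<Longrightarrow> P a \<Longrightarrow> P (inv a)"
    and off: "\<And>a. a \<in> A - tree_darts r par \<Longrightarrow> P a"
    and leaf: "\<And>y. y \<in> X - {r} \<Longrightarrow> (\<And>b. b \<in> A \<Longrightarrow> s b = y \<Longrightarrow> b \<noteq> par y \<Longrightarrow> P b) \<Longrightarrow> P (par y)"
    and a: "a \<in> A"
  shows "P a"
proof -
  define m where "m = Max (d ` X)"
  have "P (par y)" if "y \<in> X - {r}" for y
    using that
  proof (induction "m - d y" arbitrary: y rule: less_induct)
    case less
    show ?case
    proof (rule leaf[OF less.prems])
      fix b assume b: "b \<in> A" "s b = y" "b \<noteq> par y"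
      show "P b"
      proof (cases "b \<in> tree_darts r par")
        case True
        then obtain x where x: "x \<in> X - {r}" "b = par x \<or> b = inv (par x)" by (auto simp: tree_darts_def)
        then have bx: "b = inv (par x)" using b T unfolding rooted_tree_def by metis
        then have "d y < d x" using b x T unfolding rooted_tree_def by auto
        moreover have "d x \<le> m" unfolding m_def using x finite_nodes by (intro Max_ge) auto
        ultimately have "P (par x)" using less.hyps[of x] x by simp
        then show ?thesis using bx sym x T unfolding rooted_tree_def by auto
      qed (use off b in auto)
    qed
  qed
  then show ?thesis
    using off[of a] a sym T unfolding tree_darts_def rooted_tree_def by blast
qed

end

text \<open>Walk once around the cycle from \<open>\<phi> a\<close> until \<open>a\<close> is
  reached. Every step taken starts at an element other than \<open>a\<close>, so it stays in
  \<open>R\<close>.\<close>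

lemma orbit_reaches_exit:
  assumes orb: "\<And>b. b \<in> Y \<Longrightarrow> a \<in> orbit \<phi> b" and cl: "\<And>b. b \<in> Y \<Longrightarrow> \<phi> b \<in> Y" and a: "a \<in> Y"
    and step: "\<And>b. b \<in> Y \<Longrightarrow> b \<noteq> a \<Longrightarrow> (b, \<phi> b) \<in> R" and "trans R" "refl R"
  shows "(\<phi> a, a) \<in> R"
proof (rule ccontr)
  assume no: "(\<phi> a, a) \<notin> R"
  have "b \<in> Y \<and> (\<phi> a, b) \<in> R \<and> b \<noteq> a" if "b \<in> orbit \<phi> (\<phi> a)" for b
    using that
  proof induction
    case base
    have "\<phi> a \<noteq> a" using no \<open>refl R\<close> by (auto simp: refl_on_def)
    then have "(\<phi> a, \<phi> (\<phi> a)) \<in> R" using step cl a by blast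
    then show ?case using no cl a by auto
  next
    case (step b)
    then have "(\<phi> a, \<phi> b) \<in> R" using assms(4)[of b] \<open>trans R\<close> by (meson transD)
    then show ?case using no step cl by auto
  qed
  then show False using orb[of "\<phi> a"] cl a by blast
qed

text \<open>The permutation \<open>\<phi>\<close> runs along the boundary of a face, each dart
  ending at the node where the next one begins. Nothing refers to an order around nodes, so that the
  dual map is an instance as well.\<close>

locale dart_map =
  N: dart_graph A inv X s + F: dart_graph A inv Y f
  for A :: "'d set" and inv :: "'d \<Rightarrow> 'd" and X :: "'n set" and s :: "'d \<Rightarrow> 'n"
    and Y :: "'m set" and f :: "'d \<Rightarrow> 'm" +
  fixes \<phi> :: "'d \<Rightarrow> 'd"
  assumes next_in: "a \<in> A \<Longrightarrow> \<phi> a \<in> A" and inj_next: "inj_on \<phi> A"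
    and face_next: "a \<in> A \<Longrightarrow> f (\<phi> a) = f a"
    and face_orbit: "a \<in> A \<Longrightarrow> b \<in> A \<Longrightarrow> f a = f b \<Longrightarrow> b \<in> orbit \<phi> a"
    and node_next: "a \<in> A \<Longrightarrow> s (\<phi> a) = s (inv a)"
    and conn_nodes: "x \<in> X \<Longrightarrow> y \<in> X \<Longrightarrow> (x, y) \<in> N.adj\<^sup>*"
    and conn_faces: "x' \<in> Y \<Longrightarrow> y' \<in> Y \<Longrightarrow> (x', y') \<in> F.adj\<^sup>*"
    and nodes_nonempty: "X \<noteq> {}"
begin

text \<open>The complement of a spanning tree of the faces connects all nodes: going around a leaf of
  the tree leads from one end of its tree edge to the other.\<close>

lemma cotree:
  assumes T: "F.rooted_tree r d par"
  defines "A' \<equiv> A - F.tree_darts r par"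
  shows "dart_graph A' inv X s"
    and "\<And>x y. x \<in> X \<Longrightarrow> y \<in> X \<Longrightarrow> (x, y) \<in> (dart_graph.adj A' inv s)\<^sup>*"
proof -
  have "inv a \<notin> F.tree_darts r par" if "a \<in> A'" for a
    using that F.tree_darts_inv[OF T, of "inv a"] F.inv_inv unfolding A'_def by auto
  then show dg: "dart_graph A' inv X s"
    using N.finite_darts N.finite_nodes N.inv_in N.inv_inv N.node_in
    by unfold_locales (auto simp: A'_def)
  interpret C: dart_graph A' inv X s by (rule dg)
  have symC: "sym (C.adj\<^sup>*)" using C.sym_adj by (rule sym_rtrancl)
  have P: "(s a, s (inv a)) \<in> C.adj\<^sup>*" if "a \<in> A" for a
  proof (rule F.leaf_induct[OF T _ _ _ that, where P = "\<lambda>a. (s a, s (inv a)) \<in> C.adj\<^sup>*"])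
    fix a assume "a \<in> A" "(s a, s (inv a)) \<in> C.adj\<^sup>*"
    then show "(s (inv a), s (inv (inv a))) \<in> C.adj\<^sup>*"
      using symC N.inv_inv by (auto dest: symD)
  next
    fix a assume "a \<in> A - F.tree_darts r par"
    then show "(s a, s (inv a)) \<in> C.adj\<^sup>*" unfolding C.adj_def by (intro r_into_rtrancl) (use A'_def in blast)
  next
    fix y assume y: "y \<in> Y - {r}"
      and IH: "\<And>b. b \<in> A \<Longrightarrow> f b = y \<Longrightarrow> b \<noteq> par y \<Longrightarrow> (s b, s (inv b)) \<in> C.adj\<^sup>*"
    have a: "par y \<in> A" "f (par y) = y" using T y by (auto simp: F.rooted_tree_def)
    let ?R = "{(a, b). (s a, s b) \<in> C.adj\<^sup>*}"
    have "(\<phi> (par y), par y) \<in> ?R"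
    proof (rule orbit_reaches_exit[of "{b \<in> A. f b = y}"])
      show "\<And>b. b \<in> {b \<in> A. f b = y} \<Longrightarrow> b \<noteq> par y \<Longrightarrow> (b, \<phi> b) \<in> ?R"
        using IH node_next by simp
      show "\<And>b. b \<in> {b \<in> A. f b = y} \<Longrightarrow> par y \<in> orbit \<phi> b"
        using a face_orbit by simp
    qed (use a next_in face_next in \<open>auto simp: trans_def refl_on_def intro: rtrancl_trans\<close>)
    then show "(s (par y), s (inv (par y))) \<in> C.adj\<^sup>*"
      using node_next[OF a(1)] symC by (auto dest: symD)
  qed
  have "N.adj \<subseteq> C.adj\<^sup>*" unfolding N.adj_def using P by auto
  then show "\<And>x y. x \<in> X \<Longrightarrow> y \<in> X \<Longrightarrow> (x, y) \<in> C.adj\<^sup>*"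
    using conn_nodes by (meson rtrancl_subset_rtrancl subsetD)
qed

text \<open>The Euler characteristic of a connected surface is at most 2: a spanning tree of the
  faces and a spanning tree of the remaining darts are disjoint, with
  \<open>2 * (card Y - 1)\<close> and \<open>2 * (card X - 1)\<close> darts.\<close>

lemma euler_le:
  assumes "Y \<noteq> {}"
  shows "2 * (card X + card Y) \<le> card A + 4"
proof -
  obtain r d par where T: "F.rooted_tree r d par"
    using F.rooted_tree_exists conn_faces assms by (metis all_not_in_conv)
  interpret C: dart_graph "A - F.tree_darts r par" inv X s by (rule cotree[OF T])
  obtain q d' par' where T': "C.rooted_tree q d' par'"
    using C.rooted_tree_exists cotree(2)[OF T] nodes_nonempty by (metis all_not_in_conv)
  have "card (C.tree_darts q par') \<le> card (A - F.tree_darts r par)"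
    using C.tree_darts_subset[OF T'] C.finite_darts by (rule card_mono[rotated])
  moreover have "card (A - F.tree_darts r par) + card (F.tree_darts r par) = card A"
    using F.tree_darts_subset[OF T] F.finite_darts
    by (metis card_Diff_subset card_mono finite_subset le_add_diff_inverse2)
  ultimately show ?thesis
    using F.card_tree_darts[OF T] C.card_tree_darts[OF T'] by (simp add: algebra_simps)
qed

text \<open>Euler's relation makes the two trees exhaust the darts. The potential integrates
  \<open>D\<close> along the tree of nodes; the darts of the face tree follow leaf by leaf, each
  being the last open dart of its face. The root face \<open>r\<close> is never a leaf to be closed.
  The subgroup \<open>H\<close> admits angles, which are determined only up to full turns.\<close>

theorem closed_imp_exact:
  fixes D :: "'d \<Rightarrow> 'g::ab_group_add" and H :: "'g set"
  assumes euler: "card A + 4 \<le> 2 * (card X + card Y)"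
    and H: "0 \<in> H" "\<And>x y. x \<in> H \<Longrightarrow> y \<in> H \<Longrightarrow> x + y \<in> H" "\<And>x. x \<in> H \<Longrightarrow> - x \<in> H"
    and anti: "\<And>a. a \<in> A \<Longrightarrow> D (inv a) + D a \<in> H"
    and r: "r \<in> Y" and closed: "\<And>y. y \<in> Y - {r} \<Longrightarrow> (\<Sum>a\<in>{a \<in> A. f a = y}. D a) \<in> H"
  obtains p where "\<And>a. a \<in> A \<Longrightarrow> D a - (p (s (inv a)) - p (s a)) \<in> H"
proof -
  obtain d par where T: "F.rooted_tree r d par"
    using F.rooted_tree_exists conn_faces r by metis
  define A' where "A' = A - F.tree_darts r par"
  interpret C: dart_graph A' inv X s unfolding A'_def by (rule cotree[OF T])
  obtain q d' par' where T': "C.rooted_tree q d' par'"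
    using C.rooted_tree_exists cotree(2)[OF T] nodes_nonempty unfolding A'_def by (metis all_not_in_conv)
  have "card A' + card (F.tree_darts r par) = card A"
    unfolding A'_def using F.tree_darts_subset[OF T] F.finite_darts
    by (metis card_Diff_subset card_mono finite_subset le_add_diff_inverse2)
  then have "card A' \<le> card (C.tree_darts q par')"
    using F.card_tree_darts[OF T] C.card_tree_darts[OF T'] euler by (simp add: algebra_simps)
  then have A': "C.tree_darts q par' = A'"
    using C.tree_darts_subset[OF T'] C.finite_darts by (metis card_seteq)
  obtain p where p: "\<And>y. y \<in> X - {q} \<Longrightarrow> p (s (inv (par' y))) - p y = D (par' y)"
    using C.tree_potential[OF T'] by metis
  define E where "E a = D a - (p (s (inv a)) - p (s a))" for a
  have sumH: "sum g S \<in> H" if "\<And>x. x \<in> S \<Longrightarrow> g x \<in> H" for g :: "'d \<Rightarrow> 'g" and S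
    using that by (induction S rule: infinite_finite_induct) (use H in auto)
  have sym: "E (inv a) \<in> H" if "a \<in> A" "E a \<in> H" for a
  proof -
    have "E (inv a) = (D (inv a) + D a) + - E a"
      using F.inv_inv[OF that(1)] by (simp add: E_def algebra_simps)
    then show ?thesis using H that anti by metis
  qed
  have "E a \<in> H" if "a \<in> A" for a
  proof (rule F.leaf_induct[OF T _ _ _ that, where P = "\<lambda>a. E a \<in> H"])
    fix a assume "a \<in> A - F.tree_darts r par"
    then have "a \<in> C.tree_darts q par'" using A' A'_def by simp
    then obtain y where y: "y \<in> X - {q}" "a = par' y \<or> a = inv (par' y)"
      by (auto simp: C.tree_darts_def)
    have py: "par' y \<in> A" "s (par' y) = y" using T' y unfolding C.rooted_tree_def by (auto simp: A'_def)
    have "E (par' y) = 0" using p[OF y(1)] py by (simp add: E_def)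
    then show "E a \<in> H" using y sym[OF py(1)] H by auto
  next
    fix y assume y: "y \<in> Y - {r}" and IH: "\<And>b. b \<in> A \<Longrightarrow> f b = y \<Longrightarrow> b \<noteq> par y \<Longrightarrow> E b \<in> H"
    let ?S = "{a \<in> A. f a = y}"
    have a: "par y \<in> ?S" using T y by (auto simp: F.rooted_tree_def)
    have fin: "finite ?S" using F.finite_darts by simp
    have inj: "inj_on \<phi> ?S" using inj_next by (rule inj_on_subset) auto
    then have "\<phi> ` ?S = ?S"
      using fin next_in face_next by (intro endo_inj_surj) auto
    \<comment> \<open>Going around a face the potential differences telescope, because
      \<open>\<phi>\<close> permutes its darts and the end of each is the origin of the
      next.\<close>
    then have "(\<Sum>a\<in>?S. p (s (inv a))) = (\<Sum>a\<in>?S. p (s a))"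
      using sum.reindex[OF inj, of "\<lambda>a. p (s a)"] node_next by simp
    then have "(\<Sum>a\<in>?S. E a) = (\<Sum>a\<in>?S. D a)" by (simp add: E_def sum_subtractf)
    then have "E (par y) = (\<Sum>a\<in>?S. D a) + - (\<Sum>a\<in>?S - {par y}. E a)"
      using sum.remove[OF fin a, of E] by (simp add: algebra_simps)
    moreover have "(\<Sum>a\<in>?S - {par y}. E a) \<in> H" using IH by (intro sumH) auto
    ultimately show "E (par y) \<in> H" using H(2)[OF closed[OF y] H(3)] by simp
  qed (rule sym)
  then show ?thesis using that unfolding E_def by blast
qed

end

section \<open>Oriented triangles\<close>

text \<open>Twice the signed area of the triangle, positive for counterclockwise triples.\<close>

definition orient :: "complex \<Rightarrow> complex \<Rightarrow> complex \<Rightarrow> real" where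
  "orient a b c = (Re b - Re a) * (Im c - Im a) - (Im b - Im a) * (Re c - Re a)"

lemma orient_rotate: "orient b c a = orient a b c" and orient_swap: "orient b a c = - orient a b c"
  and orient_sum: "orient a b z + orient b c z + orient c a z = orient a b c"
  and orient_self [simp]: "orient a a c = 0" "orient a b a = 0" "orient a b b = 0"
  by (simp_all add: orient_def algebra_simps)

lemma orient_eq_Im: "orient a b c = Im (cnj (b - a) * (c - a))"
  by (simp add: orient_def algebra_simps)

lemma orient_affine: "orient a b (x + of_real t * (y - x)) = (1 - t) * orient a b x + t * orient a b y"
  by (simp add: orient_def algebra_simps)

lemma continuous_orient [continuous_intros]: "continuous_on S (orient a b)"
  unfolding orient_def by (intro continuous_intros)

text \<open>An intersection of half-planes, intended for counterclockwise triples; for clockwise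
  ones it is empty, by \<open>orient_sum\<close>.\<close>

definition triangle :: "complex \<Rightarrow> complex \<Rightarrow> complex \<Rightarrow> complex set" where
  "triangle a b c = {z. 0 \<le> orient a b z \<and> 0 \<le> orient b c z \<and> 0 \<le> orient c a z}"

definition open_triangle :: "complex \<Rightarrow> complex \<Rightarrow> complex \<Rightarrow> complex set" where
  "open_triangle a b c = {z. 0 < orient a b z \<and> 0 < orient b c z \<and> 0 < orient c a z}"

lemma open_triangle_subset: "open_triangle a b c \<subseteq> triangle a b c"
  by (auto simp: triangle_def open_triangle_def)

lemma open_open_triangle: "open (open_triangle a b c)"
  unfolding open_triangle_def by (intro open_Collect_conj open_Collect_less continuous_intros)

lemma closed_triangle: "closed (triangle a b c)"
  unfolding triangle_def by (intro closed_Collect_conj closed_Collect_le continuous_intros)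

lemma convex_triangle: "convex (triangle a b c)"
proof (rule convexI)
  fix x y :: complex and u v :: real
  assume xy: "x \<in> triangle a b c" "y \<in> triangle a b c" and uv: "0 \<le> u" "0 \<le> v" "u + v = 1"
  have "orient p q (u *\<^sub>R x + v *\<^sub>R y) = u * orient p q x + v * orient p q y" for p q
  proof -
    have u: "u = 1 - v" using uv by simp
    show ?thesis unfolding u by (simp add: orient_def algebra_simps)
  qed
  then show "u *\<^sub>R x + v *\<^sub>R y \<in> triangle a b c"
    using xy uv by (simp add: triangle_def)
qed

lemma vertices_in_triangle:
  assumes "0 \<le> orient a b c"
  shows "a \<in> triangle a b c" "b \<in> triangle a b c" "c \<in> triangle a b c"
  using assms by (simp_all add: triangle_def orient_rotate orient_rotate[of c a b])

lemma segment_in_triangle: "x \<in> triangle a b c \<Longrightarrow> y \<in> triangle a b c \<Longrightarrow> closed_segment x y \<subseteq> triangle a b c"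
  by (rule closed_segment_subset[OF _ _ convex_triangle])

lemma barycentric:
  "of_real (orient a b c) * z = of_real (orient b c z) * a + of_real (orient c a z) * b + of_real (orient a b z) * c"
  by (simp add: complex_eq_iff orient_def algebra_simps)

lemma bounded_triangle:
  assumes "0 < orient a b c"
  shows "bounded (triangle a b c)"
proof -
  have "norm z \<le> norm a + norm b + norm c" if z: "z \<in> triangle a b c" for z
  proof -
    let ?D = "orient a b c"
    have nn: "0 \<le> orient a b z" "0 \<le> orient b c z" "0 \<le> orient c a z" using z by (auto simp: triangle_def)
    have le: "orient a b z \<le> ?D" "orient b c z \<le> ?D" "orient c a z \<le> ?D" using nn orient_sum[of a b z c] by linarith+
    have "?D * norm z = norm (of_real ?D * z)" using assms by (simp add: norm_mult)
    moreover have "norm (of_real ?D * z)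
      \<le> norm (of_real (orient b c z) * a) + norm (of_real (orient c a z) * b) + norm (of_real (orient a b z) * c)"
      unfolding barycentric[of a b c z]
      using norm_triangle_ineq[of "of_real (orient b c z) * a + of_real (orient c a z) * b" "of_real (orient a b z) * c"]
        norm_triangle_ineq[of "of_real (orient b c z) * a" "of_real (orient c a z) * b"] by linarith
    moreover have "norm (of_real r * w) \<le> ?D * norm w" if "0 \<le> r" "r \<le> ?D" for r and w :: complex
      using that by (simp add: norm_mult mult_right_mono)
    note this[OF nn(1) le(1), of c] this[OF nn(2) le(2), of a] this[OF nn(3) le(3), of b]
    ultimately have "?D * norm z \<le> ?D * (norm a + norm b + norm c)" unfolding distrib_left by linarith
    then show ?thesis using assms mult_le_cancel_left_pos by blast
  qed
  then show ?thesis by (auto intro: boundedI)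
qed

text \<open>A small move towards the centroid, which is strictly inside, makes all three
  orientations positive.\<close>

lemma open_triangle_dense:
  assumes D: "0 < orient a b c" and z: "z \<in> triangle a b c" "z \<in> U" "open U"
  obtains w where "w \<in> U" "w \<in> open_triangle a b c"
proof -
  define m where "m = (a + b + c) / 3"
  have m: "orient a b m = orient a b c / 3" "orient b c m = orient a b c / 3" "orient c a m = orient a b c / 3"
    by (simp_all add: m_def orient_def field_simps)
  have "((\<lambda>t. z + of_real t * (m - z)) \<longlongrightarrow> z + of_real 0 * (m - z)) (at_right 0)"
    by (intro tendsto_intros)
  then have "\<forall>\<^sub>F t in at_right 0. z + of_real t * (m - z) \<in> U"
    using z by (intro topological_tendstoD) auto
  moreover have "\<forall>\<^sub>F t::real in at_right 0. t \<in> {0<..<1}"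
    by (rule eventually_at_right_real) simp
  ultimately have "\<forall>\<^sub>F t in at_right 0. z + of_real t * (m - z) \<in> U \<and> t \<in> {0<..<1}"
    by (rule eventually_conj)
  then obtain t :: real where t: "z + of_real t * (m - z) \<in> U" "0 < t" "t < 1"
    using eventually_happens'[OF trivial_limit_at_right_real] by (metis (mono_tags, lifting) greaterThanLessThan_iff)
  have "z + of_real t * (m - z) \<in> open_triangle a b c"
    using z(1) t D by (auto simp: open_triangle_def triangle_def orient_affine m intro!: add_nonneg_pos)
  then show ?thesis using t that by blast
qed

lemma generic_point:
  assumes "finite S" "\<And>u v. (u, v) \<in> S \<Longrightarrow> u \<noteq> v" and U: "open U" "U \<noteq> {}"
  obtains z where "z \<in> U" "\<And>u v. (u, v) \<in> S \<Longrightarrow> orient u v z \<noteq> 0"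
proof -
  have "negligible {z. orient u v z = 0}" if "(u, v) \<in> S" for u v
  proof -
    have "{z. orient u v z = 0} = {z. (\<i> * (v - u)) \<bullet> z = (\<i> * (v - u)) \<bullet> u}"
      by (auto simp: orient_def inner_complex_def algebra_simps)
    then show ?thesis using assms(2)[OF that] by (simp add: negligible_hyperplane)
  qed
  then have "negligible (\<Union>(u, v)\<in>S. {z. orient u v z = 0})"
    using assms(1) by (intro negligible_Union) auto
  then have "\<not> U \<subseteq> (\<Union>(u, v)\<in>S. {z. orient u v z = 0})"
    using U by (metis negligible_subset open_not_negligible)
  then show ?thesis using that by blast
qed

text \<open>The signed angle under which the segment from \<open>u\<close> to \<open>v\<close> is
  seen from \<open>z\<close>. Summed along a closed polygon it is 2 pi times the winding number
  around \<open>z\<close>.\<close>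

definition view :: "complex \<Rightarrow> complex \<Rightarrow> complex \<Rightarrow> real" where
  "view z u v = Arg ((v - z) / (u - z))"

lemma Im_divide_eq: "Im (a / b) = Im (cnj b * a) / (norm b)\<^sup>2"
  by (simp only: Im_divide cmod_power2) (simp add: algebra_simps)

lemma orient_view: "Im ((v - z) / (u - z)) = orient u v z / (norm (u - z))\<^sup>2"
  unfolding Im_divide_eq by (simp add: orient_def algebra_simps)

lemma view_sign:
  assumes "orient u v z \<noteq> 0"
  shows "u \<noteq> z" "v \<noteq> z" "0 < orient u v z \<Longrightarrow> view z u v \<in> {0<..<pi}"
    "orient u v z < 0 \<Longrightarrow> view z u v \<in> {-pi<..<0}"
proof -
  show uz: "u \<noteq> z" and vz: "v \<noteq> z" using assms by auto
  have n: "0 < (norm (u - z))\<^sup>2" using uz by simp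
  show "view z u v \<in> {0<..<pi}" if "0 < orient u v z"
  proof -
    have "0 < Im ((v - z) / (u - z))" unfolding orient_view using that n by simp
    then show ?thesis unfolding view_def using Arg_lt_pi by auto
  qed
  show "view z u v \<in> {-pi<..<0}" if "orient u v z < 0"
  proof -
    have "Im ((v - z) / (u - z)) < 0" unfolding orient_view using that n by (simp add: divide_neg_pos)
    then show ?thesis unfolding view_def using Arg_neg_iff mpi_less_Arg by auto
  qed
qed

text \<open>Off the line through the segment, \<open>Arg\<close> avoids its branch value pi, at
  which it is not odd.\<close>

lemma view_antisym:
  assumes "orient u v z \<noteq> 0"
  shows "view z v u = - view z u v"
proof -
  have "(v - z) / (u - z) \<notin> \<real>"
    using assms view_sign(1)[OF assms] orient_view[of v z u] by (auto simp: complex_is_Real_iff)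
  then have "Arg (inverse ((v - z) / (u - z))) = - Arg ((v - z) / (u - z))"
    by (simp only: Arg_inverse if_False)
  then show ?thesis by (simp add: view_def)
qed

text \<open>Angle identities below are checked modulo 2 pi by means of \<open>cis\<close>; this
  lemma then removes the ambiguity once the error is less than a full turn.\<close>

lemma cis_eq_1_imp:
  assumes "cis x = 1" "- (2 * pi) < x" "x < 2 * pi"
  shows "x = 0"
proof -
  have "cos x = 1" using arg_cong[OF assms(1), of Re] by simp
  then obtain n :: int where n: "x = 2 * pi * n"
    using cos_one_2pi_int[of x] by (auto simp: mult.commute)
  have "2 * pi * (- 1) < 2 * pi * real_of_int n" "2 * pi * real_of_int n < 2 * pi * 1"
    using assms n by simp_all
  then have "- 1 < real_of_int n" "real_of_int n < 1"
    using mult_less_cancel_left_pos[of "2 * pi" "-1" "real_of_int n"]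
      mult_less_cancel_left_pos[of "2 * pi" "real_of_int n" 1] pi_gt_zero by auto
  then have "n = 0" by linarith
  then show ?thesis using n by simp
qed


text \<open>Modulo 2 pi the sum vanishes. Inside, all three angles lie between 0 and pi, which
  leaves 2 pi. Outside, one angle is negative and, as the orientations have a positive sum, another
  is positive; this keeps the sum strictly between -2 pi and 2 pi.\<close>

lemma view_triangle:
  assumes D: "0 < orient a b c" and z: "orient a b z \<noteq> 0" "orient b c z \<noteq> 0" "orient c a z \<noteq> 0"
  shows "view z a b + view z b c + view z c a = (if z \<in> open_triangle a b c then 2 * pi else 0)"
proof -
  let ?s = "view z a b + view z b c + view z c a"
  note v = view_sign[OF z(1)] view_sign[OF z(2)] view_sign[OF z(3)]
  have "cis ?s = cis (view z a b) * cis (view z b c) * cis (view z c a)"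
    by (simp add: cis_mult)
  also have "\<dots> = 1"
    using v(1,2,5,6,9,10) by (simp add: view_def cis_Arg sgn_divide sgn_zero_iff)
  finally have cis: "cis ?s = 1" .
  have sum: "orient a b z + orient b c z + orient c a z > 0" using D by (simp add: orient_sum)
  show ?thesis
  proof (cases "z \<in> open_triangle a b c")
    case True
    then have "cis (?s - 2 * pi) = 1" "?s > 0" "?s < 3 * pi"
      using v cis by (auto simp: open_triangle_def cis_divide[symmetric])
    then have "?s - 2 * pi = 0" by (intro cis_eq_1_imp) auto
    then show ?thesis using True by simp
  next
    case False
    then have "orient a b z < 0 \<or> orient b c z < 0 \<or> orient c a z < 0"
      using z by (auto simp: open_triangle_def)
    moreover have "view z u w \<in> {-pi<..<pi}" if "orient u w z \<noteq> 0" for u w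
      using view_sign[OF that] that pi_gt_zero by (cases "orient u w z > 0") auto
    note b = this[OF z(1)] this[OF z(2)] this[OF z(3)]
    moreover have "0 < orient a b z \<or> 0 < orient b c z \<or> 0 < orient c a z" using sum by linarith
    ultimately have "?s < 2 * pi" "?s > - (2 * pi)"
      using v(3,4,7,8,11,12) b by auto
    then have "?s = 0" using cis by (intro cis_eq_1_imp) auto
    then show ?thesis using False by simp
  qed
qed

section \<open>Clockwise angles and orientation\<close>

lemma cw_angle_pos_iff:
  assumes "a \<noteq> 0" "b \<noteq> 0"
  shows "cw_angle a b \<in> {0<..<pi} \<longleftrightarrow> 0 < Im (cnj b * a)"
    and "cw_angle a b \<in> {pi<..<2*pi} \<longleftrightarrow> Im (cnj b * a) < 0"
proof -
  have I: "Im (a / b) = Im (cnj b * a) / (norm b)\<^sup>2" by (rule Im_divide_eq)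
  have n: "0 < (norm b)\<^sup>2" using assms by simp
  have 1: "0 < Im (a / b) \<longleftrightarrow> 0 < Im (cnj b * a)" unfolding I using n by (simp add: zero_less_divide_iff)
  have 2: "Im (a / b) < 0 \<longleftrightarrow> Im (cnj b * a) < 0" unfolding I using n by (simp add: divide_less_0_iff)
  have ab: "a / b \<noteq> 0" using assms by simp
  have e: "a / b = of_real (norm (a / b)) * cis (cw_angle a b)"
    unfolding cw_angle_def cis_conv_exp using Arg2pi_eq by (metis mult.commute)
  have Im: "Im (a / b) = norm (a / b) * sin (cw_angle a b)"
    by (subst e) simp
  have nab: "norm (a / b) > 0" using ab by simp
  have r: "0 \<le> cw_angle a b" "cw_angle a b < 2 * pi"
    using Arg2pi by (auto simp: cw_angle_def)
  have s1: "cw_angle a b \<in> {0<..<pi} \<longleftrightarrow> 0 < sin (cw_angle a b)"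
    using r sin_gt_zero sin_le_zero[of "cw_angle a b"] by (smt (verit) greaterThanLessThan_iff sin_zero)
  have s2: "cw_angle a b \<in> {pi<..<2*pi} \<longleftrightarrow> sin (cw_angle a b) < 0"
    using r sin_ge_zero[of "cw_angle a b"] sin_lt_zero[of "cw_angle a b"] by (smt (verit) greaterThanLessThan_iff sin_pi)
  show "cw_angle a b \<in> {0<..<pi} \<longleftrightarrow> 0 < Im (cnj b * a)"
    unfolding s1 1[symmetric] Im using nab by (simp add: zero_less_mult_iff)
  show "cw_angle a b \<in> {pi<..<2*pi} \<longleftrightarrow> Im (cnj b * a) < 0"
    unfolding s2 2[symmetric] Im using nab by (simp add: mult_less_0_iff)
qed

lemma cis_cw_angle: "a \<noteq> 0 \<Longrightarrow> b \<noteq> 0 \<Longrightarrow> cis (cw_angle a b) = sgn a / sgn b"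
proof -
  assume "a \<noteq> 0" "b \<noteq> 0"
  then have n: "norm (a / b) \<noteq> 0" by simp
  have "a / b = of_real (norm (a / b)) * cis (cw_angle a b)"
    unfolding cw_angle_def cis_conv_exp by (rule Arg2pi_eq)
  then have "cis (cw_angle a b) = (a / b) / of_real (norm (a / b))"
    using n by (metis nonzero_mult_div_cancel_left of_real_eq_0_iff)
  then show "cis (cw_angle a b) = sgn a / sgn b"
    by (metis sgn_divide sgn_eq)
qed

lemma cw_angle_range: "0 \<le> cw_angle a b" "cw_angle a b < 2 * pi"
  using Arg2pi by (auto simp: cw_angle_def)

lemma orient_corner: "Im (cnj (y - v) * (x - v)) = orient x v y"
  by (simp add: orient_def algebra_simps)

lemma orient_distinct: "orient a b c \<noteq> 0 \<Longrightarrow> a \<noteq> b \<and> b \<noteq> c \<and> a \<noteq> c"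
  by auto

text \<open>In a negatively oriented triangle the clockwise angle at each corner is reflex, namely 2
  pi minus the interior angle, so the sum is 6 pi - pi.\<close>

lemma corner_angle_sum:
  assumes "orient x v y \<noteq> 0"
  shows "cw_angle (x - v) (y - v) + cw_angle (v - y) (x - y) + cw_angle (y - x) (v - x) =
    (if 0 < orient x v y then pi else 5 * pi)" (is "?s = _")
proof -
  have d: "x \<noteq> v" "v \<noteq> y" "x \<noteq> y" using assms orient_distinct by auto
  have sg: "sgn (v - x) = - sgn (x - v)" "sgn (y - v) = - sgn (v - y)" "sgn (x - y) = - sgn (y - x)"
    by (metis minus_diff_eq sgn_minus)+
  have "cis ?s = cis (cw_angle (x - v) (y - v)) * cis (cw_angle (v - y) (x - y)) * cis (cw_angle (y - x) (v - x))"
    by (simp add: cis_mult)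
  also have "\<dots> = - 1"
    using d by (simp add: cis_cw_angle sg sgn_zero_iff divide_simps)
  finally have cis: "cis ?s = -1" .
  have c: "orient v y x = orient x v y" "orient y x v = orient x v y" by (simp_all add: orient_def algebra_simps)
  show ?thesis
  proof (cases "0 < orient x v y")
    case True
    then have "cw_angle (x - v) (y - v) \<in> {0<..<pi}" "cw_angle (v - y) (x - y) \<in> {0<..<pi}"
      "cw_angle (y - x) (v - x) \<in> {0<..<pi}"
      using d c by (auto simp only: cw_angle_pos_iff orient_corner right_minus_eq not_False_eq_True)
    moreover have "cis (?s - pi) = 1" using cis by (simp add: cis_divide[symmetric])
    ultimately have "?s - pi = 0" by (intro cis_eq_1_imp) auto
    then show ?thesis using True by simp
  next
    case False
    then have "orient x v y < 0" using assms by simp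
    then have "cw_angle (x - v) (y - v) \<in> {pi<..<2*pi}" "cw_angle (v - y) (x - y) \<in> {pi<..<2*pi}"
      "cw_angle (y - x) (v - x) \<in> {pi<..<2*pi}"
      using d c by (auto simp only: cw_angle_pos_iff orient_corner right_minus_eq not_False_eq_True)
    moreover have "cis (?s - 5 * pi) = 1"
    proof -
      have "cis (5 * pi) = -1" by (simp add: complex_eq_iff cos_npi_numeral sin_npi_numeral)
      then show ?thesis using cis by (simp add: cis_divide[symmetric])
    qed
    ultimately have "?s - 5 * pi = 0" by (intro cis_eq_1_imp) auto
    then show ?thesis using False by simp
  qed
qed

section \<open>Triangles determined by their side lengths\<close>

lemma law_of_cosines:
  fixes A B C :: complex
  shows "2 * ((A - B) \<bullet> (C - B)) = (dist A B)\<^sup>2 + (dist C B)\<^sup>2 - (dist A C)\<^sup>2"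
  unfolding dist_norm cmod_power2
  by (simp add: inner_complex_def power2_eq_square algebra_simps)

text \<open>Heron's formula; since \<open>orient\<close> is twice the area, the left side is 16
  times the squared area. It shows both that lengths fix \<open>orient\<close> up to sign and that
  strict triangle inequalities exclude degeneracy.\<close>

lemma heron:
  "4 * (orient A B C)\<^sup>2 = (dist A B + dist B C + dist A C) * (dist A B + dist B C - dist A C)
     * (dist A B + dist A C - dist B C) * (dist B C + dist A C - dist A B)"
proof -
  have "4 * (orient A B C)\<^sup>2 = 4 * (dist A B)\<^sup>2 * (dist B C)\<^sup>2 - ((dist A B)\<^sup>2 + (dist B C)\<^sup>2 - (dist A C)\<^sup>2)\<^sup>2"
  proof -
    have "4 * (b * c - a * d)\<^sup>2 = 4 * (a\<^sup>2 + b\<^sup>2) * (c\<^sup>2 + d\<^sup>2) - (2 * (a * c + b * d))\<^sup>2"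
      for a b c d :: real by (simp add: power2_eq_square algebra_simps)
    moreover have "orient A B C = Im (A - B) * Re (C - B) - Re (A - B) * Im (C - B)"
      by (simp add: orient_def algebra_simps)
    ultimately have "4 * (orient A B C)\<^sup>2 = 4 * (norm (A - B))\<^sup>2 * (norm (C - B))\<^sup>2 - (2 * ((A - B) \<bullet> (C - B)))\<^sup>2"
      unfolding cmod_power2 inner_complex_def by metis
    then show ?thesis unfolding law_of_cosines by (simp add: dist_norm norm_minus_commute)
  qed
  also have "\<dots> = (dist A B + dist B C + dist A C) * (dist A B + dist B C - dist A C)
     * (dist A B + dist A C - dist B C) * (dist B C + dist A C - dist A B)"
  proof -
    have "4 * x\<^sup>2 * y\<^sup>2 - (x\<^sup>2 + y\<^sup>2 - z\<^sup>2)\<^sup>2 = (x + y + z) * (x + y - z) * (x + z - y) * (y + z - x)"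
      for x y z :: real by (simp add: power2_eq_square algebra_simps)
    then show ?thesis .
  qed
  finally show ?thesis .
qed

lemma triangle_exists:
  fixes a b c :: real
  assumes "0 < a" "0 < b" "0 < c" "a + b > c" "b + c > a" "c + a > b"
  obtains A B C where "dist A B = a" "dist B C = b" "dist C A = c" "0 < orient A B C"
proof -
  \<comment> \<open>The abscissa of the third vertex when the side of length \<open>a\<close> lies
    on the real axis, by the law of cosines. The triangle inequalities say that its absolute value
    is below \<open>c\<close>.\<close>
  define x where "x = (a\<^sup>2 + c\<^sup>2 - b\<^sup>2) / (2 * a)"
  have "(c - x) * (2 * a) = (b - (a - c)) * (b + (a - c))"
    using assms by (simp add: x_def field_simps power2_eq_square)
  moreover have "0 < (b - (a - c)) * (b + (a - c))" using assms by (intro mult_pos_pos) auto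
  ultimately have 1: "0 < c - x" using assms zero_less_mult_pos2[of "c - x" "2 * a"] by simp
  have "(c + x) * (2 * a) = (a + c - b) * (a + c + b)"
    using assms by (simp add: x_def field_simps power2_eq_square)
  moreover have "0 < (a + c - b) * (a + c + b)" using assms by (intro mult_pos_pos) auto
  ultimately have 2: "0 < c + x" using assms zero_less_mult_pos2[of "c + x" "2 * a"] by simp
  define y where "y = sqrt (c\<^sup>2 - x\<^sup>2)"
  have pos: "0 < c\<^sup>2 - x\<^sup>2" using mult_pos_pos[OF 1 2] by (simp add: power2_eq_square algebra_simps)
  then have y: "0 < y" "y\<^sup>2 = c\<^sup>2 - x\<^sup>2" by (simp_all add: y_def)
  show ?thesis
  proof (rule that[of 0 "of_real a" "Complex x y"])
    show "dist 0 (complex_of_real a) = a" using assms by simp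
    have "2 * a * x = a\<^sup>2 + c\<^sup>2 - b\<^sup>2" using assms by (simp add: x_def)
    then have "(a - x)\<^sup>2 + y\<^sup>2 = b\<^sup>2" unfolding y by (simp add: power2_eq_square algebra_simps)
    then show "dist (complex_of_real a) (Complex x y) = b"
      using assms by (simp add: dist_norm cmod_def)
    show "dist (Complex x y) 0 = c" using y assms by (simp add: dist_norm cmod_def)
    show "0 < orient 0 (complex_of_real a) (Complex x y)" using assms y by (simp add: orient_def)
  qed
qed

text \<open>The product \<open>cnj (p2 - p1) * (p3 - p2)\<close> has the orientation as imaginary
  part and an inner product, up to sign, as real part, so it is fixed by the lengths and the sign.
  The equal quotients are the common rotation carrying two sides of one triangle to those of the
  other.\<close>

lemma congruent_triangles:
  assumes p: "orient p1 p2 p3 \<noteq> 0" and sgn: "sgn (orient p1 p2 p3) = sgn (orient q1 q2 q3)"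
    and d: "dist p1 p2 = dist q1 q2" "dist p2 p3 = dist q2 q3" "dist p3 p1 = dist q3 q1"
  shows "(q2 - q1) / (p2 - p1) = (q3 - q2) / (p3 - p2)"
proof -
  have orient: "orient p1 p2 p3 = orient q1 q2 q3"
  proof -
    have "(orient p1 p2 p3)\<^sup>2 = (orient q1 q2 q3)\<^sup>2"
      using heron[of p1 p2 p3] heron[of q1 q2 q3] d by (simp add: dist_commute)
    then have "\<bar>orient p1 p2 p3\<bar> = \<bar>orient q1 q2 q3\<bar>" by (simp add: power2_eq_iff abs_eq_iff)
    then show ?thesis using sgn by (metis abs_mult_sgn mult.commute)
  qed
  have inner: "(p1 - p2) \<bullet> (p3 - p2) = (q1 - q2) \<bullet> (q3 - q2)"
    using law_of_cosines[of p1 p2 p3] law_of_cosines[of q1 q2 q3] d by (simp add: dist_commute)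
  have "cnj (p2 - p1) * (p3 - p2) = cnj (q2 - q1) * (q3 - q2)"
    using orient inner by (simp add: complex_eq_iff orient_def inner_complex_def algebra_simps)
  moreover have "cnj (p2 - p1) * (p2 - p1) = cnj (q2 - q1) * (q2 - q1)"
    using d(1) by (metis complex_norm_square dist_norm norm_minus_commute mult.commute)
  ultimately have "(cnj (p2 - p1) * cnj (q2 - q1)) * ((q2 - q1) * (p3 - p2)) =
    (cnj (p2 - p1) * cnj (q2 - q1)) * ((q3 - q2) * (p2 - p1))"
    by (metis mult.assoc mult.commute)
  moreover have n: "p2 - p1 \<noteq> 0" "p3 - p2 \<noteq> 0" "q2 - q1 \<noteq> 0" using p orient by auto
  ultimately have "(q2 - q1) * (p3 - p2) = (q3 - q2) * (p2 - p1)"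
    by (metis complex_cnj_zero_iff mult_left_cancel mult_eq_0_iff)
  then show ?thesis using n by (simp add: frac_eq_eq)
qed

lemma euclidean_angle_eq_cw:
  assumes "0 < orient x v y"
  shows "euclidean_angle x v y = cw_angle (x - v) (y - v)"
proof -
  have d: "x - v \<noteq> 0" "y - v \<noteq> 0" using assms by auto
  have r: "cw_angle (x - v) (y - v) \<in> {0<..<pi}"
    using cw_angle_pos_iff(1)[OF d] assms by (simp only: orient_corner)
  have "cos (cw_angle (x - v) (y - v)) = Re (sgn (x - v) / sgn (y - v))"
    using cis_cw_angle[OF d] by (metis cis.sel(1))
  also have "\<dots> = ((x - v) \<bullet> (y - v)) / (norm (x - v) * norm (y - v))"
  proof -
    have "sgn (x - v) / sgn (y - v) = sgn (x - v) * cnj (sgn (y - v))"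
      using complex_div_cnj[of "sgn (x - v)" "sgn (y - v)"] d by (simp add: norm_sgn)
    also have "\<dots> = ((x - v) * cnj (y - v)) / of_real (norm (x - v) * norm (y - v))"
      by (simp add: sgn_eq)
    finally show ?thesis
      by (simp only: Re_divide_of_real) (simp add: inner_complex_def algebra_simps)
  qed
  finally have "euclidean_angle x v y = arccos (cos (cw_angle (x - v) (y - v)))"
    unfolding euclidean_angle_def by simp
  then show ?thesis using r by (simp add: arccos_cos)
qed

lemma euclidean_angle_cong:
  assumes "dist A B = dist A' B'" "dist A C = dist A' C'" "dist C B = dist C' B'"
  shows "euclidean_angle A B C = euclidean_angle A' B' C'"
proof -
  have "(A - B) \<bullet> (C - B) = (A' - B') \<bullet> (C' - B')"
    using law_of_cosines[of A B C] law_of_cosines[of A' B' C'] assms by simp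
  then show ?thesis using assms by (simp add: euclidean_angle_def dist_norm)
qed

section \<open>Combinatorics of a planar triangulation\<close>

lemma proper_drawing_iff:
  "proper_drawing G p \<gamma> \<longleftrightarrow> inj_on p (pverts G) \<and>
     (\<forall>u v. (u, v) \<in> parcs G \<longrightarrow>
        arc (\<gamma> u v) \<and> pathstart (\<gamma> u v) = p u \<and> pathfinish (\<gamma> u v) = p v \<and>
        \<gamma> v u = reversepath (\<gamma> u v) \<and> path_image (\<gamma> u v) \<inter> p ` pverts G = {p u, p v}) \<and>
     (\<forall>u v x y. (u, v) \<in> parcs G \<longrightarrow> (x, y) \<in> parcs G \<longrightarrow> {u, v} \<noteq> {x, y} \<longrightarrow>
        path_image (\<gamma> u v) \<inter> path_image (\<gamma> x y) \<subseteq> p ` ({u, v} \<inter> {x, y}))"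
  unfolding proper_drawing_def Ball_def split_paired_All case_prod_conv by blast

text \<open>Without arcs there are no orbits and the condition on faces would hold vacuously; the
  existence of an outer face excludes this.\<close>

locale triangulation =
  fixes G :: "'a pair_pre_digraph" and rot :: "'a \<Rightarrow> 'a \<Rightarrow> 'a"
  assumes triangulation: "planar_triangulation G rot"
    and arcs_nonempty: "parcs G \<noteq> {}"
begin

lemma pair_graph: "pair_graph G"
  using triangulation by (simp add: planar_triangulation_def)

abbreviation "V \<equiv> pverts G"
abbreviation "A \<equiv> parcs G"
abbreviation "face \<equiv> orbit (face_next rot)"

text \<open>The boundary traversal of the dual map, whose faces are the vertices.\<close>

definition vertex_next :: "'a \<times> 'a \<Rightarrow> 'a \<times> 'a" where
  "vertex_next = (\<lambda>(v, x). (v, rot v x))"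

lemma arc_sym: "(u, v) \<in> A \<Longrightarrow> (v, u) \<in> A"
proof -
  interpret pair_graph G by (rule pair_graph)
  show "(u, v) \<in> A \<Longrightarrow> (v, u) \<in> A" using pair_sym_arcs by (auto simp: symmetric_def dest: symD)
qed

lemma arc_neq: "(u, v) \<in> A \<Longrightarrow> u \<noteq> v"
proof -
  interpret pair_graph G by (rule pair_graph)
  show "(u, v) \<in> A \<Longrightarrow> u \<noteq> v" using pair_no_loops by force
qed

lemma arc_verts: "(u, v) \<in> A \<Longrightarrow> u \<in> V" "(u, v) \<in> A \<Longrightarrow> v \<in> V"
proof -
  interpret pair_graph G by (rule pair_graph)
  show "(u, v) \<in> A \<Longrightarrow> u \<in> V" "(u, v) \<in> A \<Longrightarrow> v \<in> V" using wellformed' by blast+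
qed

lemma finite_V: "finite V" and finite_A: "finite A"
proof -
  interpret pair_graph G by (rule pair_graph)
  show "finite V" "finite A" by (rule pair_finite_verts pair_finite_arcs)+
qed

lemma rot_cyclic: "(v, x) \<in> A \<Longrightarrow> cyclic_on (rot v) (neighbours G v)"
  using triangulation arc_verts unfolding planar_triangulation_def planar_map_def
  by (auto simp: neighbours_def)

lemma neighbours_orbit: "(v, x) \<in> A \<Longrightarrow> neighbours G v = orbit (rot v) x"
  using rot_cyclic[of v x] by (auto simp: cyclic_on_alldef neighbours_def)

lemma rot_arc: "(v, x) \<in> A \<Longrightarrow> (v, rot v x) \<in> A"
  using cyclic_on_inI[OF rot_cyclic] by (auto simp: neighbours_def)

lemma rot_image: "rot v ` neighbours G v = neighbours G v"
proof (cases "neighbours G v = {}")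
  case False
  then obtain x where x: "(v, x) \<in> A" by (auto simp: neighbours_def)
  have "y \<in> rot v ` neighbours G v" if "y \<in> neighbours G v" for y
  proof -
    have "y \<in> orbit (rot v) x" using that neighbours_orbit[OF x] by simp
    then show ?thesis
      using neighbours_orbit[OF x] x by (cases rule: orbit.cases) (auto simp: neighbours_def)
  qed
  then show ?thesis using rot_arc by (auto simp: neighbours_def)
qed simp

lemma finite_neighbours: "finite (neighbours G v)"
  by (rule finite_subset[of _ "snd ` A"]) (use finite_A in \<open>force simp: neighbours_def\<close>)+

lemma rot_inj: "inj_on (rot v) (neighbours G v)"
  using rot_image finite_neighbours by (simp add: eq_card_imp_inj_on)

lemma face_next_simp [simp]: "face_next rot (x, v) = (v, rot v x)"
  by (simp add: face_next_def)

lemma face_next_arc: "a \<in> A \<Longrightarrow> face_next rot a \<in> A"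
  by (cases a) (auto intro: rot_arc arc_sym)

lemma face_next_inj: "inj_on (face_next rot) A"
proof (rule inj_onI)
  fix a b assume ab: "a \<in> A" "b \<in> A" "face_next rot a = face_next rot b"
  obtain x v y w where [simp]: "a = (x, v)" "b = (y, w)" by (cases a, cases b)
  show "a = b" using ab inj_onD[OF rot_inj, of v x y] arc_sym by (auto simp: neighbours_def)
qed

text \<open>An \<open>orbit\<close> starts at the successor of its base point, so even the
  membership of \<open>(x, v)\<close> has to be proved. Following three arcs, an immediate return
  \<open>y = v\<close> would shrink the orbit to two arcs. The fourth arc must then be one of the
  three, and injectivity of the rotation leaves only the first of them and identifies
  \<open>y\<close> with \<open>x\<close>.\<close>

lemma face_triangle:
  assumes "(x, v) \<in> A"
  defines "w \<equiv> rot v x"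
  shows "face (x, v) = {(x, v), (v, w), (w, x)}" "rot w v = x" "rot x w = v"
    "(v, w) \<in> A" "(w, x) \<in> A" "w \<noteq> x"
proof -
  have vw: "(v, w) \<in> A" using assms face_next_arc[of "(x, v)"] by simp
  define y where "y = rot w v"
  have wy: "(w, y) \<in> A" using vw face_next_arc[of "(v, w)"] by (simp add: y_def)
  define z where "z = rot y w"
  have yz: "(y, z) \<in> A" using wy face_next_arc[of "(w, y)"] by (simp add: z_def)
  have step: "face_next rot (x, v) = (v, w)" "face_next rot (v, w) = (w, y)" "face_next rot (w, y) = (y, z)"
    by (simp_all add: w_def y_def z_def)
  have ne: "x \<noteq> v" "v \<noteq> w" "w \<noteq> y" "y \<noteq> z"
    using assms vw wy yz arc_neq by blast+
  have "face (x, v) \<in> map_faces G rot" using assms by (auto simp: map_faces_def)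
  then have c: "card (face (x, v)) = 3" using triangulation by (auto simp: planar_triangulation_def)
  then have fin: "finite (face (x, v))" by (metis card.infinite zero_neq_numeral)
  have in1: "(v, w) \<in> face (x, v)" using orbit.base[of "face_next rot" "(x, v)"] step by simp
  have in2: "(w, y) \<in> face (x, v)" using orbit.step[OF in1] step by simp
  have in3: "(y, z) \<in> face (x, v)" using orbit.step[OF in2] step by simp
  have sub: "face (x, v) \<subseteq> S" if "(v, w) \<in> S" "\<And>a. a \<in> S \<Longrightarrow> face_next rot a \<in> S" for S
  proof
    fix b assume "b \<in> face (x, v)" then show "b \<in> S"
      by induction (use that step in auto)
  qed
  have "y \<noteq> v"
  proof
    assume y: "y = v"
    have "(v, z) = (v, w)"
    proof -
      have "(w, v) \<noteq> (v, w)" using ne by auto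
      show ?thesis
      proof (rule ccontr)
        assume z: "(v, z) \<noteq> (v, w)"
        have "face (x, v) = {(v, w), (w, v), (v, z)}"
          using in1 in2 in3 y c z ne fin
          by (intro card_subset_eq[symmetric]) auto
        moreover have "face_next rot (v, z) \<in> face (x, v)" using orbit.step[OF in3] y by simp
        ultimately have "face_next rot (v, z) \<in> {(v, w), (w, v), (v, z)}" by simp
        then have "z = v \<or> z = w" by (auto simp: face_next_def)
        then show False using z yz arc_neq y by auto
      qed
    qed
    then have "face (x, v) \<subseteq> {(v, w), (w, v)}"
      using step y by (intro sub) auto
    then have "card (face (x, v)) \<le> card {(v, w), (w, v)}" by (intro card_mono) auto
    moreover have "card {(v, w), (w, v)} = 2" using ne by simp
    ultimately show False using c by simp
  qed
  then have eq: "face (x, v) = {(v, w), (w, y), (y, z)}"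
    using in1 in2 in3 c ne fin by (intro card_subset_eq[symmetric]) auto
  have mem: "(z, rot z y) \<in> {(v, w), (w, y), (y, z)}"
    using orbit.step[OF in3] unfolding eq by (simp add: face_next_def)
  have "z \<noteq> w"
  proof
    assume z: "z = w"
    have "rot w y = rot w v" using mem ne z by (auto simp: y_def)
    then show False
      using inj_onD[OF rot_inj, of w y v] wy vw arc_sym \<open>y \<noteq> v\<close> by (auto simp: neighbours_def)
  qed
  then have z: "z = v" using mem ne by auto
  then have "rot v y = w" using mem ne \<open>y \<noteq> v\<close> by auto
  then have yx: "y = x"
    using inj_onD[OF rot_inj, of v y x] assms(1) yz z arc_sym
    unfolding w_def neighbours_def by blast
  then show "face (x, v) = {(x, v), (v, w), (w, x)}" "rot w v = x" "rot x w = v"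
    "(v, w) \<in> A" "(w, x) \<in> A" "w \<noteq> x"
  proof -
    show "face (x, v) = {(x, v), (v, w), (w, x)}" unfolding eq using yx z by auto
    show "rot w v = x" using yx by (simp add: y_def)
    show "rot x w = v" using yx z by (simp add: z_def)
    show "(v, w) \<in> A" "(w, x) \<in> A" using vw wy yx by auto
    show "w \<noteq> x" using ne yx by auto
  qed
qed

lemma face_self: "a \<in> A \<Longrightarrow> a \<in> face a"
  using face_triangle(1) by (cases a) auto

lemma face_eq: "a \<in> A \<Longrightarrow> b \<in> face a \<Longrightarrow> face b = face a"
  using face_self[of a]
  by (metis cyclic_on_alldef cyclic_on_def)

lemma face_subset: "a \<in> A \<Longrightarrow> face a \<subseteq> A"
  using face_triangle by (cases a) auto

lemma face_in_faces: "a \<in> A \<Longrightarrow> face a \<in> map_faces G rot"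
  by (simp add: map_faces_def)

lemma mem_face: "f \<in> map_faces G rot \<Longrightarrow> a \<in> f \<Longrightarrow> a \<in> A \<and> face a = f"
  using face_eq face_subset unfolding map_faces_def by blast

lemma finite_faces: "finite (map_faces G rot)"
  by (simp add: map_faces_def finite_A)

lemma sum_over_faces:
  fixes k :: "'a \<times> 'a \<Rightarrow> 'b::comm_monoid_add"
  shows "(\<Sum>a\<in>A. k a) = (\<Sum>f\<in>map_faces G rot. \<Sum>a\<in>f. k a)"
proof -
  have "A = \<Union>(map_faces G rot)" using face_self face_subset by (fastforce simp: map_faces_def)
  moreover have "(\<Sum>a\<in>\<Union>(map_faces G rot). k a) = (\<Sum>f\<in>map_faces G rot. \<Sum>a\<in>f. k a)"
  proof (subst sum.Union_disjoint, intro ballI)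
    show "finite f" if "f \<in> map_faces G rot" for f
      using that finite_A face_subset unfolding map_faces_def by (metis finite_subset imageE)
    show "\<forall>f\<in>map_faces G rot. \<forall>g\<in>map_faces G rot. f \<noteq> g \<longrightarrow> f \<inter> g = {}"
      using mem_face by blast
  qed simp
  ultimately show ?thesis by simp
qed

lemma card_arcs_faces: "card A = 3 * card (map_faces G rot)"
proof -
  have "card A = (\<Sum>f\<in>map_faces G rot. card f)"
    using sum_over_faces[of "\<lambda>_. 1::nat"] by simp
  also have "\<dots> = (\<Sum>f\<in>map_faces G rot. 3)"
    using triangulation by (intro sum.cong) (auto simp: planar_triangulation_def)
  finally show ?thesis by simp
qed

lemma swap_notin_face:
  assumes f: "f \<in> map_faces G rot" and uv: "(u, v) \<in> f"
  shows "(v, u) \<notin> f"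
proof
  assume vu: "(v, u) \<in> f"
  have a: "(u, v) \<in> A" "face (u, v) = f" using mem_face[OF f uv] by auto
  have "(v, u) \<in> face (u, v)" using vu a by simp
  then show False
    using arc_neq[OF a(1)] arc_neq[OF face_triangle(4)[OF a(1)]] face_triangle(6)[OF a(1)]
    unfolding face_triangle(1)[OF a(1)] by auto
qed

lemma face_rot:
  assumes "(x, v) \<in> A"
  shows "face (v, rot v x) = face (x, v)" "face (rot v x, x) = face (x, v)"
proof -
  have "(v, rot v x) \<in> face (x, v)" "(rot v x, x) \<in> face (x, v)"
    unfolding face_triangle(1)[OF assms] by simp_all
  then show "face (v, rot v x) = face (x, v)" "face (rot v x, x) = face (x, v)"
    using face_eq[OF assms] by blast+
qed

lemma connected_arcs: "u \<in> V \<Longrightarrow> v \<in> V \<Longrightarrow> (u, v) \<in> A\<^sup>*"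
proof -
  assume uv: "u \<in> V" "v \<in> V"
  have "Digraph_Component.connected (with_proj G)"
    using triangulation by (simp add: planar_triangulation_def)
  then have "u \<rightarrow>\<^sup>*\<^bsub>with_proj (mk_symmetric (with_proj G))\<^esub> v"
    using uv by (auto simp: Digraph_Component.connected_def strongly_connected_def)
  then have "(u, v) \<in> (parcs (mk_symmetric (with_proj G)))\<^sup>*"
    using reachable_rtranclI by fastforce
  moreover have "parcs (mk_symmetric (with_proj G)) \<subseteq> A"
    using arc_sym by (auto simp: parcs_mk_symmetric)
  ultimately show ?thesis using rtrancl_mono by blast
qed

lemma vertex_has_arc: assumes "v \<in> V" obtains x where "(v, x) \<in> A"
proof -
  obtain a b where ab: "(a, b) \<in> A" using arcs_nonempty by auto
  then have "(v, a) \<in> A\<^sup>*" "(v, b) \<in> A\<^sup>*" "a \<noteq> b"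
    using assms connected_arcs arc_verts arc_neq by auto
  then show ?thesis using that by (metis converse_rtranclE)
qed

section \<open>The map and its dual, and Euler's formula\<close>

lemma dart_graph_vertices: "dart_graph A prod.swap V fst"
  using finite_A finite_V arc_sym arc_verts by unfold_locales auto

lemma dart_graph_faces: "dart_graph A prod.swap (map_faces G rot) face"
  using finite_A finite_faces arc_sym face_in_faces by unfold_locales auto

lemma adj_vertices: "dart_graph.adj A prod.swap fst = A"
  unfolding dart_graph.adj_def[OF dart_graph_vertices] by force

text \<open>Turning around a vertex crosses its edges one at a time, which connects all faces at
  that vertex. Faces at the two ends of an edge are linked by crossing that edge.\<close>

lemma faces_connected:
  assumes "f \<in> map_faces G rot" "g \<in> map_faces G rot"
  shows "(f, g) \<in> (dart_graph.adj A prod.swap face)\<^sup>*"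
proof -
  interpret F: dart_graph A prod.swap "map_faces G rot" face by (rule dart_graph_faces)
  let ?R = "F.adj\<^sup>*"
  have sym: "sym ?R" using F.sym_adj by (rule sym_rtrancl)
  have flip: "(face (v, x), face (x, v)) \<in> ?R" if "(v, x) \<in> A" for v x
    using that unfolding F.adj_def by force
  have vertex_next: "(face (v, x), face (v, y)) \<in> ?R" if x: "(v, x) \<in> A" and y: "(v, y) \<in> A" for v x y
  proof -
    have "y \<in> orbit (rot v) x" using x y neighbours_orbit by (auto simp: neighbours_def)
    then have "(face (v, x), face (v, y)) \<in> ?R \<and> (v, y) \<in> A"
    proof induction
      case base
      have "face (x, v) = face (v, rot v x)"
        using face_rot(1)[OF arc_sym[OF x]] by simp
      then show ?case using flip[OF x] rot_arc[OF x] by simp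
    next
      case (step y)
      then have y: "(v, y) \<in> A" by simp
      have "face (y, v) = face (v, rot v y)"
        using face_rot(1)[OF arc_sym[OF y]] by simp
      then show ?case using step flip[OF y] rot_arc[OF y] by (auto intro: rtrancl_trans)
    qed
    then show ?thesis ..
  qed
  have "(face (u, x), face (v, y)) \<in> ?R" if "(u, v) \<in> A\<^sup>*" "(u, x) \<in> A" "(v, y) \<in> A" for u v x y
    using that(1,3)
  proof (induction arbitrary: y)
    case base
    then show ?case using vertex_next that(2) by blast
  next
    case (step v w)
    have "(face (u, x), face (v, w)) \<in> ?R" using step by blast
    moreover have "(face (v, w), face (w, v)) \<in> ?R" using flip step by blast
    moreover have "(face (w, v), face (w, y)) \<in> ?R" using vertex_next step arc_sym by blast
    ultimately show ?case by (meson rtrancl_trans)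
  qed
  then show ?thesis
    using assms connected_arcs arc_verts unfolding map_faces_def by (auto; metis)
qed

lemma dart_map_primal:
  "dart_map A prod.swap V fst (map_faces G rot) face (face_next rot)"
proof -
  interpret N: dart_graph A prod.swap V fst by (rule dart_graph_vertices)
  interpret F: dart_graph A prod.swap "map_faces G rot" face by (rule dart_graph_faces)
  show ?thesis
  proof unfold_locales
    show "V \<noteq> {}" using arcs_nonempty arc_verts by fastforce
    show "\<And>x y. x \<in> V \<Longrightarrow> y \<in> V \<Longrightarrow> (x, y) \<in> N.adj\<^sup>*"
      using connected_arcs adj_vertices by simp
    show "\<And>a. a \<in> A \<Longrightarrow> face (face_next rot a) = face a"
      by (rule face_eq) (auto intro: orbit.base)
    show "\<And>a b. a \<in> A \<Longrightarrow> b \<in> A \<Longrightarrow> face a = face b \<Longrightarrow> b \<in> face a"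
      using face_self by auto
    show "\<And>a. a \<in> A \<Longrightarrow> fst (face_next rot a) = fst (prod.swap a)"
      by (auto simp: face_next_def)
  qed (use face_next_arc face_next_inj faces_connected in auto)
qed

text \<open>With faces as nodes, \<open>closed_imp_exact\<close> turns conditions around vertices
  into an assignment of values to faces.\<close>

lemma dart_map_dual:
  "dart_map A prod.swap (map_faces G rot) face V fst vertex_next"
proof -
  interpret N: dart_graph A prod.swap V fst by (rule dart_graph_vertices)
  interpret F: dart_graph A prod.swap "map_faces G rot" face by (rule dart_graph_faces)
  show ?thesis
  proof unfold_locales
    show "map_faces G rot \<noteq> {}" using arcs_nonempty by (auto simp: map_faces_def)
    show "\<And>x y. x \<in> V \<Longrightarrow> y \<in> V \<Longrightarrow> (x, y) \<in> N.adj\<^sup>*"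
      using connected_arcs adj_vertices by simp
    show "\<And>a. a \<in> A \<Longrightarrow> vertex_next a \<in> A" "\<And>a. a \<in> A \<Longrightarrow> fst (vertex_next a) = fst a"
      using rot_arc by (auto simp: vertex_next_def)
    show "inj_on vertex_next A"
      using inj_onD[OF rot_inj] by (auto simp: inj_on_def vertex_next_def neighbours_def)
    show "face (vertex_next a) = face (prod.swap a)" if "a \<in> A" for a
    proof -
      obtain v x where [simp]: "a = (v, x)" by (cases a)
      have "(x, v) \<in> A" using that arc_sym by simp
      then show ?thesis using face_rot(1) by (simp add: vertex_next_def)
    qed
    show "b \<in> orbit vertex_next a" if ab: "a \<in> A" "b \<in> A" "fst a = fst b" for a b
    proof -
      obtain v x where [simp]: "a = (v, x)" by (cases a)
      obtain y where [simp]: "b = (v, y)" using ab(3) by (cases b) auto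
      have "y \<in> orbit (rot v) x" using ab neighbours_orbit by (auto simp: neighbours_def)
      have sp: "vertex_next (v, x) = (v, rot v x)" for x by (simp add: vertex_next_def)
      from \<open>y \<in> orbit (rot v) x\<close> have "(v, y) \<in> orbit vertex_next (v, x)"
      proof induction
        case base
        show ?case using orbit.base[of vertex_next "(v, x)"] sp by simp
      next
        case (step y)
        show ?case using orbit.step[OF step.IH] sp by simp
      qed
      then show ?thesis by simp
    qed
  qed (use faces_connected in auto)
qed

text \<open>Each undirected edge counts as two arcs, so this is the bound
  \<open>3 * card V - 6\<close> doubled.\<close>

theorem edge_bound: "card A + 12 \<le> 6 * card V"
proof -
  obtain p \<gamma> where "map_drawing G rot p \<gamma>"
    using triangulation by (auto simp: planar_triangulation_def planar_map_def)
  then have pd: "proper_drawing G p \<gamma>" by (simp add: map_drawing_def)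
  have inj: "inj_on p V" using pd by (simp add: proper_drawing_def)
  have curve: "arc (\<gamma> u v)" "pathstart (\<gamma> u v) = p u" "pathfinish (\<gamma> u v) = p v"
    "path_image (\<gamma> v u) = path_image (\<gamma> u v)" "path_image (\<gamma> u v) \<inter> p ` V = {p u, p v}"
    if "(u, v) \<in> A" for u v
  proof -
    have "arc (\<gamma> u v) \<and> pathstart (\<gamma> u v) = p u \<and> pathfinish (\<gamma> u v) = p v \<and>
        \<gamma> v u = reversepath (\<gamma> u v) \<and> path_image (\<gamma> u v) \<inter> p ` V = {p u, p v}"
      using pd that unfolding proper_drawing_iff by blast
    then show "arc (\<gamma> u v)" "pathstart (\<gamma> u v) = p u" "pathfinish (\<gamma> u v) = p v"
      "path_image (\<gamma> v u) = path_image (\<gamma> u v)" "path_image (\<gamma> u v) \<inter> p ` V = {p u, p v}"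
      by simp_all
  qed
  have cross: "path_image (\<gamma> u v) \<inter> path_image (\<gamma> x y) \<subseteq> p ` ({u, v} \<inter> {x, y})"
    if "(u, v) \<in> A" "(x, y) \<in> A" "{u, v} \<noteq> {x, y}" for u v x y
    using pd that unfolding proper_drawing_iff by blast
  define edge where "edge = (\<lambda>(u, v). {u, v} :: 'a set)"
  define I where "I = edge ` A"
  \<comment> \<open>One direction is chosen for each edge, as both directions have the same image
    and \<open>plane_arcs\<close> requires distinct arcs to meet only at points of
    \<open>P\<close>.\<close>
  define rep where "rep e = (SOME a. a \<in> A \<and> edge a = e)" for e
  define g where "g e = case_prod \<gamma> (rep e)" for e
  have rep: "rep e \<in> A" "edge (rep e) = e" if "e \<in> I" for e
    using that someI_ex[of "\<lambda>a. a \<in> A \<and> edge a = e"] unfolding I_def rep_def by auto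
  have rep_cases: "\<exists>u v. e = {u, v} \<and> (u, v) \<in> A \<and> g e = \<gamma> u v" if "e \<in> I" for e
    using rep[OF that] unfolding g_def edge_def by (cases "rep e") auto
  interpret plane_arcs "p ` V" I g
  proof
    show "finite (p ` V)" "finite I" using finite_V finite_A by (auto simp: I_def)
    show "arc (g e)" if "e \<in> I" for e
      using rep_cases[OF that] curve(1) by metis
    show "path_image (g e) \<inter> p ` V = {pathstart (g e), pathfinish (g e)}" if "e \<in> I" for e
      using rep_cases[OF that] curve(2,3,5) by metis
    fix e e' assume e: "e \<in> I" "e' \<in> I" "e \<noteq> e'"
    obtain u v where uv: "e = {u, v}" "(u, v) \<in> A" "g e = \<gamma> u v" using rep_cases[OF e(1)] by blast
    obtain x y where xy: "e' = {x, y}" "(x, y) \<in> A" "g e' = \<gamma> x y" using rep_cases[OF e(2)] by blast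
    have ne: "{u, v} \<noteq> {x, y}" using e(3) uv(1) xy(1) by simp
    have V: "{u, v} \<subseteq> V" "{x, y} \<subseteq> V" using arc_verts[OF uv(2)] arc_verts[OF xy(2)] by simp_all
    show "path_image (g e) \<inter> path_image (g e') \<subseteq> p ` V"
      using cross[OF uv(2) xy(2) ne] V unfolding uv(3) xy(3) by blast
    have "p ` {u, v} \<noteq> p ` {x, y}"
      using inj_on_image_eq_iff[OF inj V] ne by simp
    then show "{pathstart (g e), pathfinish (g e)} \<noteq> {pathstart (g e'), pathfinish (g e')}"
      unfolding uv(3) xy(3) curve(2)[OF uv(2)] curve(3)[OF uv(2)] curve(2)[OF xy(2)] curve(3)[OF xy(2)]
      by simp
  qed
  have join: "path_component (skel J) (p u) (p v)" if "(u, v) \<in> A" "{u, v} \<in> J" "J \<subseteq> I" for u v J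
  proof -
    have e: "{u, v} \<in> I" using that(2,3) by blast
    obtain x y where xy: "{u, v} = {x, y}" "(x, y) \<in> A" "g {u, v} = \<gamma> x y" using rep_cases[OF e] by blast
    then have "path_image (\<gamma> u v) = path_image (g {u, v})"
      using curve(4)[OF xy(2)] unfolding doubleton_eq_iff by metis
    then have "path_image (\<gamma> u v) \<subseteq> skel J" using that(2) unfolding skel_def by blast
    then show ?thesis
      using curve(1-3)[OF that(1)] arc_imp_path unfolding path_component_def by blast
  qed
  have cardI: "card A = 2 * card I"
  proof -
    have "card A = (\<Sum>e\<in>I. card {a \<in> A. edge a = e})"
      using sum.image_gen[OF finite_A, of "\<lambda>_. 1::nat" edge] by (simp add: I_def)
    also have "\<dots> = (\<Sum>e\<in>I. 2)"
    proof (rule sum.cong[OF refl])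
      fix e assume "e \<in> I"
      then obtain u v where uv: "e = {u, v}" "(u, v) \<in> A" using rep_cases by blast
      have "{a \<in> A. edge a = e} = {(u, v), (v, u)}"
        using uv arc_sym by (auto simp: edge_def doubleton_eq_iff)
      then show "card {a \<in> A. edge a = e} = 2" using arc_neq[OF uv(2)] by auto
    qed
    finally show ?thesis by simp
  qed
  interpret N: dart_graph A prod.swap V fst by (rule dart_graph_vertices)
  obtain r where r: "r \<in> V" using arcs_nonempty arc_verts by fastforce
  obtain d par where T: "N.rooted_tree r d par"
    using N.rooted_tree_exists[OF r] connected_arcs[OF r] adj_vertices by metis
  define t where "t y = edge (par y)" for y
  define E where "E = t ` (V - {r})"
  have par: "par y \<in> A" "fst (par y) = y" "d (snd (par y)) < d y" if "y \<in> V - {r}" for y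
    using T that unfolding N.rooted_tree_def by auto
  have parE: "par y = (y, snd (par y))" if "y \<in> V - {r}" for y using par(2)[OF that] by (metis prod.collapse)
  have EI: "E \<subseteq> I" using par by (auto simp: E_def I_def t_def)
  have "inj_on t (V - {r})"
  proof (rule inj_onI)
    fix x y assume xy: "x \<in> V - {r}" "y \<in> V - {r}" "t x = t y"
    then have "{x, snd (par x)} = {y, snd (par y)}"
      unfolding t_def edge_def using parE by (metis case_prod_conv)
    then show "x = y" using par(3)[OF xy(1)] par(3)[OF xy(2)] by (auto simp: doubleton_eq_iff)
  qed
  then have cardE: "Suc (card E) = card (p ` V)"
    unfolding E_def using card_Suc_Diff1[OF finite_V r] card_image[OF inj] by (metis card_image)
  have to_root: "path_component (skel E) (p r) (p y)" if "y \<in> V" for y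
    using that
  proof (induction "d y" arbitrary: y rule: less_induct)
    case less
    show ?case
    proof (cases "y = r")
      case True
      have "p r \<in> skel E" using r unfolding skel_def by blast
      then show ?thesis using True by (simp add: path_component_refl)
    next
      case False
      then have y: "y \<in> V - {r}" using less.prems by blast
      define x where "x = snd (par y)"
      have yx: "par y = (y, x)" "(y, x) \<in> A" using parE[OF y] par(1)[OF y] unfolding x_def by metis+
      have "t y = {y, x}" unfolding t_def edge_def yx(1) by simp
      then have "{y, x} \<in> E" using y unfolding E_def by (metis imageI)
      then have "{x, y} \<in> E" by (simp add: insert_commute)
      then have "path_component (skel E) (p x) (p y)" using join[OF arc_sym[OF yx(2)]] EI by blast
      moreover have "path_component (skel E) (p r) (p x)"
        using less.hyps par(3)[OF y] arc_verts(2)[OF yx(2)] unfolding x_def by blast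
      ultimately show ?thesis by (meson path_component_trans)
    qed
  qed
  have three: "card I \<ge> 3"
  proof -
    have "card (map_faces G rot) > 0"
      using arcs_nonempty finite_faces by (auto simp: card_gt_0_iff map_faces_def)
    \<comment> \<open>A single face would contain an edge in both directions. Two faces already have
      six arcs, hence three edges.\<close>
    have "card (map_faces G rot) \<noteq> 1"
    proof
      assume "card (map_faces G rot) = 1"
      then obtain f where f: "map_faces G rot = {f}" by (auto simp: card_1_singleton_iff)
      obtain x v where xv: "(x, v) \<in> A" using arcs_nonempty by auto
      have "face (x, v) = face (v, x)" using f face_in_faces[OF xv] face_in_faces[OF arc_sym[OF xv]] by auto
      then have "(v, x) \<in> face (x, v)" using face_self arc_sym[OF xv] by metis
      then show False using swap_notin_face[OF face_in_faces[OF xv] face_self[OF xv]] by blast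
    qed
    then have "card (map_faces G rot) \<ge> 2" using \<open>card (map_faces G rot) > 0\<close> by presburger
    then show ?thesis using cardI card_arcs_faces by linarith
  qed
  have "card I + 6 \<le> 3 * card (p ` V)"
  proof (rule card_arcs_bound[OF three EI cardE])
    show "path_component (skel E) x y" if "x \<in> p ` V" "y \<in> p ` V" for x y
    proof -
      obtain u v where "x = p u" "y = p v" "u \<in> V" "v \<in> V" using \<open>x \<in> p ` V\<close> \<open>y \<in> p ` V\<close> by blast
      then show ?thesis using path_component_trans[OF path_component_sym[OF to_root] to_root] by blast
    qed
    show "path_component (skel (I - {e})) (pathstart (g e)) (pathfinish (g e))" if "e \<in> I" for e
    proof -
      obtain u v where uv: "e = {u, v}" "(u, v) \<in> A" "g e = \<gamma> u v" using rep_cases[OF \<open>e \<in> I\<close>] by blast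
      \<comment> \<open>The other two sides of a triangular face bypass the edge.\<close>
      define w where "w = rot v u"
      note t = face_triangle[OF uv(2), folded w_def]
      have sub: "I - {e} \<subseteq> I" by blast
      have inI: "{w, u} \<in> I" "{v, w} \<in> I"
        using imageI[OF t(4), of edge] imageI[OF t(5), of edge] unfolding I_def edge_def by simp_all
      have "{w, u} \<noteq> {u, v}" "{v, w} \<noteq> {u, v}" using t(6) arc_neq[OF t(4)] arc_neq[OF t(5)] by (auto simp: doubleton_eq_iff)
      then have "path_component (skel (I - {e})) (p w) (p u)" "path_component (skel (I - {e})) (p v) (p w)"
        using join[OF t(5) _ sub] join[OF t(4) _ sub] inI uv(1) by blast+
      then have "path_component (skel (I - {e})) (p u) (p v)"
        using path_component_trans path_component_sym by blast
      then show ?thesis unfolding uv(3) curve(2)[OF uv(2)] curve(3)[OF uv(2)] .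
    qed
  qed
  then show ?thesis using cardI card_image[OF inj] by linarith
qed

text \<open>As arcs are three times as many as faces, \<open>euler_le\<close> becomes
  \<open>2 * card V \<le> card (map_faces G rot) + 4\<close>, and \<open>edge_bound\<close> is the
  opposite inequality.\<close>

corollary euler: "card (map_faces G rot) + 4 = 2 * card V" "card A + 4 = 2 * (card V + card (map_faces G rot))"
proof -
  have "2 * (card V + card (map_faces G rot)) \<le> card A + 4"
    using dart_map.euler_le[OF dart_map_primal] arcs_nonempty by (auto simp: map_faces_def)
  then show "card (map_faces G rot) + 4 = 2 * card V" "card A + 4 = 2 * (card V + card (map_faces G rot))"
    using edge_bound card_arcs_faces by presburger+
qed

end

section \<open>The developing map\<close>

lemma euclidean_angle_commute: "euclidean_angle A B C = euclidean_angle C B A"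
  by (simp add: euclidean_angle_def inner_commute mult.commute)

lemma cis_sum: "finite S \<Longrightarrow> cis (sum f S) = (\<Prod>x\<in>S. cis (f x))"
  by (induction S rule: finite_induct) (simp_all flip: cis_mult)

lemma orient_congruence:
  assumes "b' - a' = c * (b - a)" "d' - b' = c * (d - b)" "norm c = 1"
  shows "orient a' b' d' = orient a b d"
proof -
  have "d' - a' = (d' - b') + (b' - a')" by simp
  also have "\<dots> = c * (d - a)" unfolding assms by (simp add: algebra_simps)
  finally have "orient a' b' d' = Im ((cnj c * c) * (cnj (b - a) * (d - a)))"
    unfolding orient_eq_Im assms by (simp add: mult_ac)
  also have "cnj c * c = 1" using assms(3) by (metis complex_norm_square mult.commute of_real_1 one_power2)
  finally show ?thesis by (simp add: orient_eq_Im)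
qed

locale metric_triangulation = triangulation G rot
  for G :: "'a pair_pre_digraph" and rot :: "'a \<Rightarrow> 'a \<Rightarrow> 'a" +
  fixes outer :: "('a \<times> 'a) set" and l :: "'a set \<Rightarrow> real"
  assumes outer: "outer \<in> map_faces G rot"
    and feasible: "feasible G rot l"
begin

lemma length_pos: "(u, v) \<in> A \<Longrightarrow> 0 < l {u, v}"
  using feasible by (auto simp: feasible_def)

lemma triangle_ineq:
  assumes "(x, v) \<in> A"
  shows "l {x, v} + l {v, rot v x} > l {rot v x, x}"
    "l {x, v} + l {rot v x, x} > l {v, rot v x}"
    "l {v, rot v x} + l {rot v x, x} > l {x, v}"
proof -
  have "face_edges (face (x, v)) = {{x, v}, {v, rot v x}, {rot v x, x}}"
    unfolding face_triangle(1)[OF assms] by (simp add: face_edges_def)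
  then have "l {x, v} + l {v, rot v x} > l {rot v x, x} \<and> l {x, v} + l {rot v x, x} > l {v, rot v x} \<and>
    l {v, rot v x} + l {rot v x, x} > l {x, v}"
    using feasible face_in_faces[OF assms] unfolding feasible_def by blast
  then show "l {x, v} + l {v, rot v x} > l {rot v x, x}"
    "l {x, v} + l {rot v x, x} > l {v, rot v x}"
    "l {v, rot v x} + l {rot v x, x} > l {x, v}" by simp_all
qed

lemma face_model:
  assumes "f \<in> map_faces G rot"
  shows "\<exists>m :: 'a \<Rightarrow> complex. \<forall>(u, v) \<in> f. dist (m u) (m v) = l {u, v} \<and> 0 < orient (m u) (m v) (m (rot v u))"
proof -
  obtain x v where xv: "(x, v) \<in> A" "f = face (x, v)" using assms by (auto simp: map_faces_def)
  define w where "w = rot v x"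
  note t = face_triangle[OF xv(1), folded w_def] and i = triangle_ineq[OF xv(1), folded w_def]
  have ne: "x \<noteq> v" "v \<noteq> w" "w \<noteq> x" using arc_neq xv(1) t(4,5) by blast+
  obtain a b c where abc: "dist a b = l {x, v}" "dist b c = l {v, w}" "dist c a = l {w, x}" "0 < orient a b c"
    using triangle_exists[of "l {x, v}" "l {v, w}" "l {w, x}"] i length_pos[OF xv(1)] length_pos[OF t(4)]
      length_pos[OF t(5)] by (metis add.commute)
  define m where "m = (\<lambda>_. c)(x := a, v := b)"
  have m: "m x = a" "m v = b" "m w = c" using ne by (auto simp: m_def)
  have "orient b c a = orient a b c" "orient c a b = orient a b c" by (simp_all add: orient_def algebra_simps)
  then show ?thesis
    using abc m t(2,3) unfolding xv(2) t(1) w_def[symmetric]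
    by (intro exI[of _ m]) (simp add: w_def[symmetric])
qed

text \<open>A counterclockwise Euclidean copy of the face, fixed once for every face, the outer one
  included. Its values matter at the vertices of the face only.\<close>

definition model :: "('a \<times> 'a) set \<Rightarrow> 'a \<Rightarrow> complex" where
  "model f = (SOME m. \<forall>(u, v) \<in> f. dist (m u) (m v) = l {u, v} \<and> 0 < orient (m u) (m v) (m (rot v u)))"

lemma model:
  assumes "(u, v) \<in> A"
  shows "dist (model (face (u, v)) u) (model (face (u, v)) v) = l {u, v}"
    "0 < orient (model (face (u, v)) u) (model (face (u, v)) v) (model (face (u, v)) (rot v u))"
proof -
  have "\<forall>(u, v) \<in> face (u, v). dist (model (face (u, v)) u) (model (face (u, v)) v) = l {u, v}
    \<and> 0 < orient (model (face (u, v)) u) (model (face (u, v)) v) (model (face (u, v)) (rot v u))"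
    using someI_ex[OF face_model[OF face_in_faces[OF assms]]] face_eq[OF assms]
    unfolding model_def[symmetric] by auto
  then show "dist (model (face (u, v)) u) (model (face (u, v)) v) = l {u, v}"
    "0 < orient (model (face (u, v)) u) (model (face (u, v)) v) (model (face (u, v)) (rot v u))"
    using face_self[OF assms] by auto
qed

text \<open>Measured in the copy of the arc's own face. The two directions of an edge belong to
  different copies, so they need not be opposite vectors.\<close>

definition side :: "'a \<times> 'a \<Rightarrow> complex" where
  "side a = model (face a) (snd a) - model (face a) (fst a)"

lemma norm_side: "(u, v) \<in> A \<Longrightarrow> norm (side (u, v)) = l {u, v}"
  using model(1) by (simp add: side_def dist_norm norm_minus_commute)

lemma side_nonzero: "a \<in> A \<Longrightarrow> side a \<noteq> 0"
  using norm_side length_pos by (cases a) force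

lemma side_sum:
  assumes "(x, v) \<in> A"
  shows "side (x, v) + side (v, rot v x) + side (rot v x, x) = 0"
  using face_rot[OF assms] by (simp add: side_def)

text \<open>The description is definite: the cyclic orientation of the face forces the two other
  vertices, and the lengths determine the angle. The minus sign turns the incoming side into a
  vector leaving \<open>v\<close>.\<close>

lemma face_angle_eq:
  assumes "(x, v) \<in> A"
  shows "face_angle l (face (x, v)) v = cw_angle (- side (x, v)) (side (v, rot v x))"
proof -
  define w where "w = rot v x"
  note t = face_triangle[OF assms, folded w_def]
  define m where "m = model (face (x, v))"
  have ne: "x \<noteq> v" "v \<noteq> w" "w \<noteq> x" using arc_neq assms t(4,5) by blast+
  have f2: "face (v, w) = face (x, v)" "face (w, x) = face (x, v)"
    using face_rot[OF assms] by (simp_all add: w_def)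
  have d: "dist (m x) (m v) = l {x, v}" "dist (m v) (m w) = l {v, w}" "dist (m w) (m x) = l {w, x}"
    using model(1)[OF assms] model(1)[OF t(4)] model(1)[OF t(5)] by (simp_all add: f2 m_def)
  have "face_angle l (face (x, v)) v = euclidean_angle (m w) (m v) (m x)"
    unfolding face_angle_def
  proof (rule the_equality)
    show "\<exists>xa y A B C. face (x, v) = {(v, xa), (xa, y), (y, v)} \<and> dist B A = l {v, xa} \<and>
      dist A C = l {xa, y} \<and> dist C B = l {y, v} \<and> euclidean_angle (m w) (m v) (m x) = euclidean_angle A B C"
      using d by (intro exI[of _ w] exI[of _ x] exI[of _ "m w"] exI[of _ "m v"] exI[of _ "m x"])
        (auto simp: t(1))
  next
    fix \<theta> assume "\<exists>xa y A B C. face (x, v) = {(v, xa), (xa, y), (y, v)} \<and> dist B A = l {v, xa} \<and>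
      dist A C = l {xa, y} \<and> dist C B = l {y, v} \<and> \<theta> = euclidean_angle A B C"
    then obtain y z A B C where h: "face (x, v) = {(v, y), (y, z), (z, v)}" "dist B A = l {v, y}"
      "dist A C = l {y, z}" "dist C B = l {z, v}" "\<theta> = euclidean_angle A B C" by blast
    have "(v, y) \<in> {(x, v), (v, w), (w, x)}" using h(1) unfolding t(1) by blast
    then have y: "y = w" using ne by auto
    have "(z, v) \<in> {(x, v), (v, w), (w, x)}" using h(1) unfolding t(1) by blast
    then have z: "z = x" using ne by auto
    show "\<theta> = euclidean_angle (m w) (m v) (m x)"
      unfolding h(5) using h(2-4) d by (intro euclidean_angle_cong) (simp_all add: y z dist_commute)
  qed
  also have "\<dots> = cw_angle (m x - m v) (m w - m v)"
    using model(2)[OF assms, folded m_def w_def] by (metis euclidean_angle_commute euclidean_angle_eq_cw)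
  finally show ?thesis using f2 by (simp add: side_def m_def w_def)
qed

text \<open>A face at \<open>v\<close> contains exactly one arc entering \<open>v\<close>, which
  turns the sum over faces into one over neighbours; away from the outer face no summand is
  lost.\<close>

lemma angle_sum_eq:
  assumes v: "v \<in> V" and "v \<notin> face_verts outer"
  shows "angle_sum G rot outer l v = (\<Sum>x\<in>neighbours G v. cw_angle (- side (x, v)) (side (v, rot v x)))"
proof -
  let ?F = "{f \<in> map_faces G rot - {outer}. v \<in> face_verts f}"
  have "bij_betw (\<lambda>x. face (x, v)) (neighbours G v) ?F"
  proof (rule bij_betw_imageI)
    show "inj_on (\<lambda>x. face (x, v)) (neighbours G v)"
    proof (rule inj_onI)
      fix x y assume xy: "x \<in> neighbours G v" "y \<in> neighbours G v" "face (x, v) = face (y, v)"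
      then have a: "(x, v) \<in> A" "(y, v) \<in> A" using arc_sym by (auto simp: neighbours_def)
      have "(y, v) \<in> face (x, v)" using face_self[OF a(2)] xy(3) by simp
      then show "x = y"
        using arc_neq[OF a(1)] arc_neq[OF face_triangle(4)[OF a(1)]] unfolding face_triangle(1)[OF a(1)] by auto
    qed
    show "(\<lambda>x. face (x, v)) ` neighbours G v = ?F"
    proof (intro equalityI subsetI)
      fix f assume "f \<in> (\<lambda>x. face (x, v)) ` neighbours G v"
      then obtain x where x: "(x, v) \<in> A" "f = face (x, v)" using arc_sym by (auto simp: neighbours_def)
      have "v \<in> face_verts f" unfolding x(2) face_triangle(1)[OF x(1)] by (simp add: face_verts_def)
      then show "f \<in> ?F" using assms(2) face_in_faces[OF x(1)] x(2) by auto
    next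
      fix f assume f: "f \<in> ?F"
      then obtain d where "d \<in> f" "fst d = v" unfolding face_verts_def by blast
      then obtain w where w: "(v, w) \<in> f" by (cases d) auto
      then have vw: "(v, w) \<in> A" "face (v, w) = f" using f mem_face by auto
      define y where "y = rot w v"
      have "(y, v) \<in> f" "(y, v) \<in> A"
        using face_triangle(1,5)[OF vw(1)] unfolding vw(2) by (auto simp: y_def)
      moreover from this have "face (y, v) = f" using f mem_face by blast
      ultimately show "f \<in> (\<lambda>x. face (x, v)) ` neighbours G v"
        using arc_sym by (auto simp: neighbours_def)
    qed
  qed
  then have "angle_sum G rot outer l v = (\<Sum>x\<in>neighbours G v. face_angle l (face (x, v)) v)"
    unfolding angle_sum_def by (rule sum.reindex_bij_betw[symmetric])
  also have "\<dots> = (\<Sum>x\<in>neighbours G v. cw_angle (- side (x, v)) (side (v, rot v x)))"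
    using arc_sym by (intro sum.cong) (auto simp: neighbours_def intro!: face_angle_eq)
  finally show ?thesis .
qed

text \<open>The rotation of the copy of the face across \<open>a\<close> that makes its side
  parallel to the same edge in the copy of the face of \<open>a\<close>.\<close>

definition turn :: "'a \<times> 'a \<Rightarrow> real" where
  "turn a = Arg (- side a / side (prod.swap a))"

lemma cis_turn:
  assumes "(u, v) \<in> A"
  shows "cis (turn (u, v)) * side (v, u) = - side (u, v)"
proof -
  have n: "side (u, v) \<noteq> 0" "side (v, u) \<noteq> 0" using side_nonzero assms arc_sym by blast+
  have "norm (side (v, u)) = norm (side (u, v))"
    using norm_side[OF assms] norm_side[OF arc_sym[OF assms]] by (simp add: insert_commute)
  then have "cis (turn (u, v)) = - side (u, v) / side (v, u)"
    using n by (simp add: turn_def cis_Arg sgn_eq norm_divide)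
  then show ?thesis using n by simp
qed

lemma turn_antisym:
  assumes "(u, v) \<in> A"
  shows "cis (turn (v, u) + turn (u, v)) = 1"
proof -
  have n: "side (u, v) \<noteq> 0" using side_nonzero assms by blast
  have "cis (turn (v, u) + turn (u, v)) * side (u, v) = cis (turn (u, v)) * (cis (turn (v, u)) * side (u, v))"
    by (simp add: mult_ac flip: cis_mult)
  also have "\<dots> = side (u, v)" using cis_turn[OF assms] cis_turn[OF arc_sym[OF assms]] by simp
  finally show ?thesis using n by simp
qed

lemma darts_at: "{a \<in> A. fst a = v} = Pair v ` neighbours G v"
  by (auto simp: neighbours_def)

text \<open>Comparing the two triangles at each edge around \<open>v\<close> multiplies up to the rotation by the
  total angle at \<open>v\<close>.\<close>

lemma turn_sum:
  assumes v: "v \<in> V" and "angle_sum G rot outer l v = 2 * pi" and "v \<notin> face_verts outer"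
  shows "cis (\<Sum>a\<in>{a \<in> A. fst a = v}. turn a) = 1"
proof -
  let ?N = "neighbours G v"
  have arcs: "(v, x) \<in> A" "(x, v) \<in> A" if "x \<in> ?N" for x using that arc_sym by (auto simp: neighbours_def)
  have "cis (\<Sum>a\<in>{a \<in> A. fst a = v}. turn a) = (\<Prod>x\<in>?N. cis (turn (v, x)))"
    unfolding darts_at by (simp add: sum.reindex inj_on_def cis_sum finite_neighbours)
  also have "\<dots> = (\<Prod>x\<in>?N. sgn (side (v, x)) / sgn (- side (x, v)))"
  proof (rule prod.cong[OF refl])
    fix x assume x: "x \<in> ?N"
    have "cis (turn (v, x)) = sgn (- side (v, x) / side (x, v))"
      using side_nonzero arcs[OF x] by (simp add: turn_def cis_Arg)
    then show "cis (turn (v, x)) = sgn (side (v, x)) / sgn (- side (x, v))"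
      by (metis divide_minus_left divide_minus_right sgn_divide)
  qed
  also have "\<dots> = (\<Prod>x\<in>?N. sgn (side (v, x))) / (\<Prod>x\<in>?N. sgn (- side (x, v)))"
    by (rule prod_dividef)
  \<comment> \<open>Shifting the index by the rotation regroups comparisons across an edge into
    comparisons of two sides of one triangle.\<close>
  also have "(\<Prod>x\<in>?N. sgn (side (v, x))) = (\<Prod>x\<in>?N. sgn (side (v, rot v x)))"
    using prod.reindex[OF rot_inj[of v], of "\<lambda>x. sgn (side (v, x))"] by (simp add: rot_image)
  also have "(\<Prod>x\<in>?N. sgn (side (v, rot v x))) / (\<Prod>x\<in>?N. sgn (- side (x, v))) =
      (\<Prod>x\<in>?N. sgn (side (v, rot v x)) / sgn (- side (x, v)))"
    by (rule prod_dividef[symmetric])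
  also have "\<dots> = (\<Prod>x\<in>?N. inverse (cis (cw_angle (- side (x, v)) (side (v, rot v x)))))"
  proof (rule prod.cong[OF refl])
    fix x assume x: "x \<in> ?N"
    have "cis (cw_angle (- side (x, v)) (side (v, rot v x))) = sgn (- side (x, v)) / sgn (side (v, rot v x))"
      using side_nonzero arcs[OF x] rot_arc by (intro cis_cw_angle) auto
    then show "sgn (side (v, rot v x)) / sgn (- side (x, v)) =
      inverse (cis (cw_angle (- side (x, v)) (side (v, rot v x))))" by simp
  qed
  also have "\<dots> = inverse (cis (angle_sum G rot outer l v))"
    unfolding angle_sum_eq[OF v assms(3)] cis_sum[OF finite_neighbours]
    by (rule prod_inversef[unfolded o_def])
  also have "\<dots> = 1" using assms(2) by simp
  finally show ?thesis .
qed

lemma outer_triangle: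
  obtains a b c where "outer = {(a, b), (b, c), (c, a)}" "(a, b) \<in> A" "(b, c) \<in> A" "(c, a) \<in> A"
    "rot b a = c" "rot c b = a" "rot a c = b" "a \<noteq> b" "b \<noteq> c" "c \<noteq> a"
    "face_verts outer = {a, b, c}"
proof -
  obtain a b where ab: "(a, b) \<in> A" "outer = face (a, b)" using outer by (auto simp: map_faces_def)
  define c where "c = rot b a"
  note t = face_triangle[OF ab(1), folded c_def]
  show ?thesis
  proof (rule that[of a b c])
    show "outer = {(a, b), (b, c), (c, a)}" using ab t by simp
    then show "face_verts outer = {a, b, c}" by (auto simp: face_verts_def)
    show "a \<noteq> b" "b \<noteq> c" "c \<noteq> a" using arc_neq ab(1) t(4,5) by blast+
  qed (use ab t in \<open>auto simp: c_def\<close>)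
qed

lemma outer_sub: "outer \<subseteq> A"
  using outer mem_face by blast

text \<open>Exactness on the dual map gives each face a rotation angle \<open>\<theta>\<close>;
  exactness on the map itself then gives the positions. Nothing is claimed about the orientation of
  the outer triangle, which is deduced later from that of all the others.\<close>

theorem development:
  assumes angles: "\<And>v. v \<in> V \<Longrightarrow> v \<notin> face_verts outer \<Longrightarrow> angle_sum G rot outer l v = 2 * pi"
  obtains p :: "'a \<Rightarrow> complex" where "\<And>u v. (u, v) \<in> A \<Longrightarrow> dist (p u) (p v) = l {u, v}"
    "\<And>x v. (x, v) \<in> A - outer \<Longrightarrow> 0 < orient (p x) (p v) (p (rot v x))"
proof -
  obtain a b c where abc: "outer = {(a, b), (b, c), (c, a)}" "(a, b) \<in> A" "(b, c) \<in> A" "(c, a) \<in> A"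
    "a \<noteq> b" "b \<noteq> c" "c \<noteq> a" "face_verts outer = {a, b, c}"
    using outer_triangle by metis
  define S where "S v = (\<Sum>d\<in>{d \<in> A. fst d = v}. turn d)" for v
  (* The angle condition says nothing at the outer vertices.  The turns across the outer edges are free, and
     correcting them makes the sums at b and c vanish; none is needed at the root a. *)
  define \<epsilon> :: "'a \<times> 'a \<Rightarrow> real" where
    "\<epsilon> = (\<lambda>_. 0)((b, c) := - S b, (c, b) := S b, (c, a) := - S b - S c, (a, c) := S b + S c)"
  have \<epsilon>v: "\<epsilon> (b, c) = - S b" "\<epsilon> (c, b) = S b" "\<epsilon> (c, a) = - S b - S c" "\<epsilon> (a, c) = S b + S c"
    using abc(5-7) by (simp_all add: \<epsilon>_def)
  have \<epsilon>n: "\<epsilon> d = 0" if "d \<notin> {(b, c), (c, b), (c, a), (a, c)}" for d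
    using that by (simp add: \<epsilon>_def)
  have \<epsilon>0: "\<epsilon> d = 0" if "d \<notin> outer" "prod.swap d \<notin> outer" for d
  proof (rule \<epsilon>n)
    show "d \<notin> {(b, c), (c, b), (c, a), (a, c)}" using that unfolding abc(1) by (cases d) auto
  qed
  have \<epsilon>anti: "\<epsilon> (prod.swap d) = - \<epsilon> d" for d
  proof -
    consider "d = (b, c)" | "d = (c, b)" | "d = (c, a)" | "d = (a, c)" | "d \<notin> {(b, c), (c, b), (c, a), (a, c)}"
      by blast
    then show ?thesis
    proof cases
      case 5
      then have "prod.swap d \<notin> {(b, c), (c, b), (c, a), (a, c)}" by (cases d) auto
      then show ?thesis using \<epsilon>n[OF 5] \<epsilon>n[of "prod.swap d"] by simp
    qed (simp_all add: \<epsilon>v)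
  qed
  \<comment> \<open>The multiples of 2 pi: the turns around a vertex are known only through their
    \<open>cis\<close>.\<close>
  define H where "H = {x. cis x = 1}"
  have sumS: "(\<Sum>d\<in>{d \<in> A. fst d = v}. turn d + \<epsilon> d) \<in> H" if v: "v \<in> V - {a}" for v
  proof -
    have fin: "finite {d \<in> A. fst d = v}" using finite_A by simp
    have split: "(\<Sum>d\<in>{d \<in> A. fst d = v}. turn d + \<epsilon> d) = S v + (\<Sum>d\<in>{d \<in> A. fst d = v}. \<epsilon> d)"
      by (simp add: S_def sum.distrib)
    consider "v = b" | "v = c" | "v \<notin> {a, b, c}" using v by blast
    then show ?thesis
    proof cases
      case 1
      have "(\<Sum>d\<in>{d \<in> A. fst d = v}. \<epsilon> d) = (\<Sum>d\<in>{(b, c)}. \<epsilon> d)"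
      proof (intro sum.mono_neutral_right[OF fin] ballI)
        show "{(b, c)} \<subseteq> {d \<in> A. fst d = v}" using 1 abc(3) by simp
        fix d assume "d \<in> {d \<in> A. fst d = v} - {(b, c)}"
        then show "\<epsilon> d = 0" using 1 abc(5-7) by (intro \<epsilon>n) (cases d; auto)
      qed
      then show ?thesis unfolding split by (simp add: 1 \<epsilon>v H_def)
    next
      case 2
      have "(\<Sum>d\<in>{d \<in> A. fst d = v}. \<epsilon> d) = (\<Sum>d\<in>{(c, a), (c, b)}. \<epsilon> d)"
      proof (intro sum.mono_neutral_right[OF fin] ballI)
        show "{(c, a), (c, b)} \<subseteq> {d \<in> A. fst d = v}" using 2 abc(4) arc_sym[OF abc(3)] by simp
        fix d assume "d \<in> {d \<in> A. fst d = v} - {(c, a), (c, b)}"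
        then show "\<epsilon> d = 0" using 2 abc(5-7) by (intro \<epsilon>n) (cases d; auto)
      qed
      then show ?thesis unfolding split using abc(5) by (simp add: 2 \<epsilon>v H_def)
    next
      case 3
      have "(\<Sum>d\<in>{d \<in> A. fst d = v}. \<epsilon> d) = 0"
      proof (rule sum.neutral, rule ballI)
        fix d assume "d \<in> {d \<in> A. fst d = v}"
        then show "\<epsilon> d = 0" using 3 by (intro \<epsilon>n) (cases d; auto)
      qed
      then show ?thesis
        using turn_sum[of v] angles[of v] v 3 unfolding split abc(8) by (simp add: S_def H_def)
    qed
  qed
  obtain \<theta> where \<theta>: "\<And>d. d \<in> A \<Longrightarrow> turn d + \<epsilon> d - (\<theta> (face (prod.swap d)) - \<theta> (face d)) \<in> H"
  proof (rule dart_map.closed_imp_exact[OF dart_map_dual, of H "\<lambda>d. turn d + \<epsilon> d" a])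
    show "card A + 4 \<le> 2 * (card (map_faces G rot) + card V)" using euler(2) by simp
    show "0 \<in> H" "\<And>x y. x \<in> H \<Longrightarrow> y \<in> H \<Longrightarrow> x + y \<in> H" "\<And>x. x \<in> H \<Longrightarrow> - x \<in> H"
      by (auto simp: H_def simp flip: cis_mult cis_inverse)
    show "turn (prod.swap d) + \<epsilon> (prod.swap d) + (turn d + \<epsilon> d) \<in> H" if "d \<in> A" for d
      using that turn_antisym \<epsilon>anti[of d] by (cases d) (simp add: H_def)
    show "a \<in> V" using arc_verts abc(2) by blast
    show "\<And>v. v \<in> V - {a} \<Longrightarrow> (\<Sum>d\<in>{d \<in> A. fst d = v}. turn d + \<epsilon> d) \<in> H" by (rule sumS)
  qed (use that in blast)
  \<comment> \<open>The copy of the outer face is counterclockwise, unlike its place in the drawing.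
    Along outer arcs the vector is therefore taken from the inner triangle across, which makes
    \<open>D\<close> antisymmetric there by definition. The outer face is the root in the second
    application, so its sum is not checked.\<close>
  define D where "D d = (if d \<in> outer then - cis (\<theta> (face (prod.swap d))) * side (prod.swap d)
    else cis (\<theta> (face d)) * side d)" for d
  have inner: "cis (\<theta> (face (v, u))) * side (v, u) = - (cis (\<theta> (face (u, v))) * side (u, v))"
    if "(u, v) \<in> A" "(u, v) \<notin> outer" "(v, u) \<notin> outer" for u v
  proof -
    have "cis (turn (u, v) - (\<theta> (face (v, u)) - \<theta> (face (u, v)))) = 1"
      using \<theta>[OF that(1)] \<epsilon>0[of "(u, v)"] that by (simp add: H_def)
    then have "cis (turn (u, v)) * cis (\<theta> (face (u, v))) = cis (\<theta> (face (v, u)))"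
      by (simp add: cis_mult diff_diff_eq2 flip: cis_divide)
    then have "cis (\<theta> (face (v, u))) * side (v, u) = cis (\<theta> (face (u, v))) * (cis (turn (u, v)) * side (v, u))"
      by (metis mult.assoc mult.commute)
    then show ?thesis using cis_turn[OF that(1)] by simp
  qed
  obtain p where p: "\<And>d. d \<in> A \<Longrightarrow> D d - (p (fst (prod.swap d)) - p (fst d)) \<in> {0}"
  proof (rule dart_map.closed_imp_exact[OF dart_map_primal, of "{0}" D outer])
    show "card A + 4 \<le> 2 * (card V + card (map_faces G rot))" using euler(2) by simp
    show "D (prod.swap d) + D d \<in> {0}" if "d \<in> A" for d
    proof -
      obtain u v where d: "d = (u, v)" by (cases d)
      show ?thesis
        using inner[of u v] that swap_notin_face[OF outer, of u v] unfolding d D_def by auto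
    qed
    show "outer \<in> map_faces G rot" by (rule outer)
    show "(\<Sum>d\<in>{d \<in> A. face d = f}. D d) \<in> {0}" if f: "f \<in> map_faces G rot - {outer}" for f
    proof -
      obtain x v where xv: "(x, v) \<in> A" "f = face (x, v)" using f by (auto simp: map_faces_def)
      define w where "w = rot v x"
      note t = face_triangle[OF xv(1), folded w_def]
      have eq: "{d \<in> A. face d = f} = f"
        using f mem_face face_self by blast
      have "D d = cis (\<theta> f) * side d" if "d \<in> f" for d
      proof -
        have "face d = f" "d \<notin> outer" using that f mem_face outer by blast+
        then show ?thesis by (simp add: D_def)
      qed
      then have "(\<Sum>d\<in>{d \<in> A. face d = f}. D d) = cis (\<theta> f) * (\<Sum>d\<in>f. side d)"
        by (simp add: eq sum_distrib_left)
      moreover have "(\<Sum>d\<in>f. side d) = side (x, v) + side (v, w) + side (w, x)"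
        unfolding xv(2) t(1) using arc_neq xv(1) t(4,5,6) by (subst sum.insert; force)+
      ultimately show ?thesis using side_sum[OF xv(1)] by (simp add: w_def)
    qed
  qed (use that in auto)
  have pD: "p v - p u = D (u, v)" if "(u, v) \<in> A" for u v using p[OF that] by simp
  show ?thesis
  proof (rule that[of p])
    fix u v assume uv: "(u, v) \<in> A"
    have "norm (D (u, v)) = l {u, v}"
      using norm_side[OF uv] norm_side[OF arc_sym[OF uv]] by (simp add: D_def norm_mult insert_commute)
    then show "dist (p u) (p v) = l {u, v}" using pD[OF uv] by (metis dist_norm norm_minus_commute)
  next
    fix x v assume xv: "(x, v) \<in> A - outer"
    then have xA: "(x, v) \<in> A" by simp
    have nin: "(v, rot v x) \<notin> outer"
    proof
      assume "(v, rot v x) \<in> outer"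
      then have "face (x, v) = outer" using mem_face[OF outer] face_rot(1)[OF xA] by simp
      then show False using face_self[OF xA] xv by simp
    qed
    define m where "m = model (face (x, v))"
    have "p v - p x = cis (\<theta> (face (x, v))) * (m v - m x)"
      using pD[OF xA] xv by (simp add: D_def side_def m_def)
    moreover have "p (rot v x) - p v = cis (\<theta> (face (x, v))) * (m (rot v x) - m v)"
      using pD[OF face_triangle(4)[OF xA]] nin face_rot(1)[OF xA] by (simp add: D_def side_def m_def)
    ultimately have "orient (p x) (p v) (p (rot v x)) = orient (m x) (m v) (m (rot v x))"
      by (rule orient_congruence) simp
    then show "0 < orient (p x) (p v) (p (rot v x))" using model(2)[OF xA] by (simp add: m_def)
  qed
qed

end

section \<open>The development is injective\<close>

text \<open>Clockwise angles are additive up to full turns; the assumed order of \<open>b\<close>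
  and \<open>c\<close> as seen from \<open>a\<close> excludes a wrap.\<close>

lemma cw_angle_diff:
  assumes "a \<noteq> 0" "b \<noteq> 0" "c \<noteq> 0" and le: "cw_angle a b \<le> cw_angle a c"
  shows "cw_angle b c = cw_angle a c - cw_angle a b"
proof -
  have "cis (cw_angle b c - (cw_angle a c - cw_angle a b)) = 1"
    using assms by (simp add: cis_cw_angle sgn_zero_iff flip: cis_divide)
  then have "cw_angle b c - (cw_angle a c - cw_angle a b) = 0"
    using le cw_angle_range[of b c] cw_angle_range[of a c] cw_angle_range[of a b]
    by (intro cis_eq_1_imp) linarith+
  then show ?thesis by simp
qed

lemma cw_angle_scale:
  assumes "0 < r" "0 < s"
  shows "cw_angle (of_real r * a) (of_real s * b) = cw_angle a b"
proof -
  have "of_real r * a / (of_real s * b) = of_real (r / s) * (a / b)" by simp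
  then show ?thesis using assms Arg2pi_times_of_real[of "r / s" "a / b"] by (simp only: cw_angle_def) simp
qed

lemma cw_angle_eq_0:
  assumes "a \<noteq> 0" "b \<noteq> 0" "cw_angle a b = 0"
  obtains r where "0 < r" "b = of_real r * a"
proof -
  have "sgn a / sgn b = 1" using cis_cw_angle[OF assms(1,2)] assms(3) by simp
  then have "sgn b = sgn a" using assms by (simp add: sgn_zero_iff)
  then have "b / of_real (norm b) = a / of_real (norm a)" by (simp add: sgn_eq)
  then have "b = of_real (norm b / norm a) * a" using assms by (simp add: field_simps)
  then show ?thesis using that[of "norm b / norm a"] assms by simp
qed

lemma first_hit_linepath:
  assumes "0 < r" "r < norm (b - a)"
  shows "first_hit (linepath a b) r = a + of_real (r / norm (b - a)) * (b - a)"
proof -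
  define n where "n = norm (b - a)"
  have n: "0 < n" using assms unfolding n_def by linarith
  have lp: "linepath a b t = a + of_real t * (b - a)" for t
    by (simp add: linepath_def scaleR_conv_of_real algebra_simps)
  have d: "dist (linepath a b t) (pathstart (linepath a b)) = \<bar>t\<bar> * n" for t
    unfolding pathstart_linepath lp n_def by (simp add: dist_norm norm_mult)
  have "{t \<in> {0..1}. dist (linepath a b t) (pathstart (linepath a b)) = r} = {r / n}"
    unfolding d using assms n by (auto simp: n_def[symmetric] field_simps)
  then show ?thesis by (simp add: first_hit_def lp n_def)
qed

lemma open_segment_orient:
  assumes "z \<in> open_segment a b"
  shows "orient a b z = 0" "\<exists>t. 0 < t \<and> t < 1 \<and> (\<forall>c. orient b c z = (1 - t) * orient a b c \<and> orient c a z = t * orient a b c)"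
proof -
  obtain t where t: "0 < t" "t < 1" "z = (1 - t) *\<^sub>R a + t *\<^sub>R b"
    using assms by (auto simp: in_segment)
  show "orient a b z = 0" unfolding t(3) by (simp add: orient_def algebra_simps)
  have "orient b c z = (1 - t) * orient a b c \<and> orient c a z = t * orient a b c" for c
    unfolding t(3) by (simp add: orient_def algebra_simps)
  then show "\<exists>t. 0 < t \<and> t < 1 \<and> (\<forall>c. orient b c z = (1 - t) * orient a b c \<and> orient c a z = t * orient a b c)"
    using t by blast
qed

lemma collinear_cases:
  fixes a b c :: complex
  assumes "0 < r" "c - a = of_real r * (b - a)" "b \<noteq> a"
  shows "b = c \<or> b \<in> open_segment a c \<or> c \<in> open_segment a b"
proof -
  have c: "c = a + r *\<^sub>R (b - a)" using assms(2) by (simp add: scaleR_conv_of_real algebra_simps)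
  consider "r < 1" | "r = 1" | "r > 1" by linarith
  then show ?thesis
  proof cases
    case 1
    then have "c \<in> open_segment a b"
      using assms by (auto simp: in_segment c scaleR_conv_of_real algebra_simps intro!: exI[of _ r])
    then show ?thesis by blast
  next
    case 2
    then show ?thesis by (simp add: c)
  next
    case 3
    have "b = (1 - 1 / r) *\<^sub>R a + (1 / r) *\<^sub>R c" using 3 by (simp add: c scaleR_right_diff_distrib scaleR_left_diff_distrib algebra_simps)
    moreover have "a \<noteq> c" using assms(1,3) by (auto simp: c)
    ultimately have "b \<in> open_segment a c"
      using 3 unfolding in_segment by (intro conjI exI[of _ "1 / r"]) auto
    then show ?thesis by blast
  qed
qed

text \<open>Lengths are forgotten here and only orientations remain. The sign of the outer triangle
  is left open; \<open>outer_neg\<close> derives it.\<close>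

locale developed = triangulation G rot
  for G :: "'a pair_pre_digraph" and rot :: "'a \<Rightarrow> 'a \<Rightarrow> 'a" +
  fixes outer :: "('a \<times> 'a) set" and p :: "'a \<Rightarrow> complex"
  assumes outer: "outer \<in> map_faces G rot"
    and inner_pos: "(x, v) \<in> A - outer \<Longrightarrow> 0 < orient (p x) (p v) (p (rot v x))"
    and outer_nondeg: "(x, v) \<in> outer \<Longrightarrow> orient (p x) (p v) (p (rot v x)) \<noteq> 0"
begin

definition inner :: "('a \<times> 'a) set set" where
  "inner = map_faces G rot - {outer}"

definition closed_face :: "('a \<times> 'a) set \<Rightarrow> complex set" where
  "closed_face f = {z. \<forall>(u, v) \<in> f. 0 \<le> orient (p u) (p v) z}"

definition open_face :: "('a \<times> 'a) set \<Rightarrow> complex set" where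
  "open_face f = {z. \<forall>(u, v) \<in> f. 0 < orient (p u) (p v) z}"

text \<open>Points off all edge lines: every edge is seen from them under an angle away from the
  branch of \<open>Arg\<close>, and closed and open faces agree there.\<close>

definition generic :: "complex \<Rightarrow> bool" where
  "generic z \<longleftrightarrow> (\<forall>(u, v) \<in> A. orient (p u) (p v) z \<noteq> 0)"

lemma nondeg: "(x, v) \<in> A \<Longrightarrow> orient (p x) (p v) (p (rot v x)) \<noteq> 0"
  using inner_pos outer_nondeg by force

lemma arc_distinct: "(u, v) \<in> A \<Longrightarrow> p u \<noteq> p v"
  using nondeg[of u v] by auto

lemma closed_face_triangle: "(x, v) \<in> A \<Longrightarrow> closed_face (face (x, v)) = triangle (p x) (p v) (p (rot v x))"
  and open_face_triangle: "(x, v) \<in> A \<Longrightarrow> open_face (face (x, v)) = open_triangle (p x) (p v) (p (rot v x))"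
  unfolding closed_face_def open_face_def triangle_def open_triangle_def by (simp_all add: face_triangle(1))

lemma inner_arc: "f \<in> inner \<Longrightarrow> a \<in> f \<Longrightarrow> a \<in> A - outer \<and> face a = f"
  using mem_face outer unfolding inner_def by blast

lemma face_inner: "a \<in> A - outer \<Longrightarrow> face a \<in> inner"
  using face_in_faces face_self unfolding inner_def by blast

lemma inner_obtain:
  assumes "f \<in> inner"
  obtains x v where "(x, v) \<in> A - outer" "f = face (x, v)"
proof -
  obtain x v where "(x, v) \<in> A" "f = face (x, v)" using assms by (auto simp: inner_def map_faces_def)
  then show ?thesis using that inner_arc[OF assms] face_self by blast
qed

lemma open_face_subset: "open_face f \<subseteq> closed_face f"
  unfolding open_face_def closed_face_def by force

lemma open_face_open: "f \<in> inner \<Longrightarrow> open (open_face f)"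
  by (erule inner_obtain) (simp add: open_face_triangle open_open_triangle)

lemma open_face_dense:
  assumes "f \<in> inner" "z \<in> closed_face f" "z \<in> U" "open U"
  obtains w where "w \<in> U" "w \<in> open_face f"
proof -
  obtain x v where xv: "(x, v) \<in> A - outer" "f = face (x, v)" using inner_obtain[OF assms(1)] .
  show ?thesis
    using open_triangle_dense[OF inner_pos[OF xv(1)], of z U] assms xv that by (auto simp: closed_face_triangle open_face_triangle)
qed

lemma vertex_in_closed_face:
  assumes "f \<in> inner" "(u, v) \<in> f"
  shows "p u \<in> closed_face f" "p v \<in> closed_face f"
proof -
  have a: "(u, v) \<in> A - outer" "face (u, v) = f" using inner_arc assms by auto
  then show "p u \<in> closed_face f" "p v \<in> closed_face f"
    using closed_face_triangle[of u v] vertices_in_triangle[of "p u" "p v" "p (rot v u)"] inner_pos[OF a(1)] by auto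
qed

lemma generic_closed_face: "generic z \<Longrightarrow> f \<in> map_faces G rot \<Longrightarrow> z \<in> closed_face f \<Longrightarrow> z \<in> open_face f"
  using mem_face unfolding generic_def closed_face_def open_face_def by (fastforce simp: less_le)

lemma generic_exists:
  assumes "open U" "U \<noteq> {}"
  obtains z where "z \<in> U" "generic z"
proof -
  have "finite ((\<lambda>(u, v). (p u, p v)) ` A)" using finite_A by simp
  moreover have "a \<noteq> b" if "(a, b) \<in> (\<lambda>(u, v). (p u, p v)) ` A" for a b
    using that arc_distinct by auto
  ultimately obtain z where "z \<in> U" "\<And>a b. (a, b) \<in> (\<lambda>(u, v). (p u, p v)) ` A \<Longrightarrow> orient a b z \<noteq> 0"
    using generic_point assms by metis
  then show ?thesis using that by (force simp: generic_def)
qed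

section \<open>Winding numbers and the multiplicity of the covering\<close>

definition face_view :: "complex \<Rightarrow> ('a \<times> 'a) set \<Rightarrow> real" where
  "face_view z f = (\<Sum>(u, v)\<in>f. view z (p u) (p v))"

lemma face_view_triangle:
  assumes "(x, v) \<in> A"
  shows "face_view z (face (x, v)) =
    view z (p x) (p v) + view z (p v) (p (rot v x)) + view z (p (rot v x)) (p x)"
proof -
  note t = face_triangle[OF assms]
  have "x \<noteq> v" "v \<noteq> rot v x" "rot v x \<noteq> x" using arc_neq assms t(4,5) by blast+
  then show ?thesis unfolding face_view_def t(1) by simp
qed

text \<open>The two directions of each edge are seen under opposite angles.\<close>

lemma total_view:
  assumes z: "generic z"
  shows "(\<Sum>f\<in>map_faces G rot. face_view z f) = 0"
proof -
  let ?w = "\<lambda>(u, v). view z (p u) (p v)"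
  have "(\<Sum>a\<in>A. ?w a) = (\<Sum>f\<in>map_faces G rot. sum ?w f)" by (rule sum_over_faces)
  moreover have "(\<Sum>a\<in>A. ?w a) = 0"
  proof -
    have "bij_betw prod.swap A A"
      using arc_sym by (intro bij_betw_byWitness[where f' = prod.swap]) auto
    then have "(\<Sum>a\<in>A. ?w a) = (\<Sum>a\<in>A. ?w (prod.swap a))" by (rule sum.reindex_bij_betw[symmetric])
    also have "\<dots> = (\<Sum>a\<in>A. - ?w a)"
      using z by (intro sum.cong) (auto simp: generic_def intro!: view_antisym)
    finally show ?thesis by (simp add: sum_negf)
  qed
  ultimately show ?thesis by (simp add: face_view_def)
qed

lemma inner_view:
  assumes "generic z" "f \<in> inner"
  shows "face_view z f = (if z \<in> open_face f then 2 * pi else 0)"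
proof -
  obtain x v where xv: "(x, v) \<in> A - outer" "f = face (x, v)" using inner_obtain[OF assms(2)] .
  have a: "(x, v) \<in> A" using xv by simp
  note t = face_triangle[OF a]
  have "orient (p x) (p v) z \<noteq> 0" "orient (p v) (p (rot v x)) z \<noteq> 0" "orient (p (rot v x)) (p x) z \<noteq> 0"
    using assms(1) a t(4,5) unfolding generic_def by blast+
  from view_triangle[OF inner_pos[OF xv(1)] this] show ?thesis
    unfolding xv(2) face_view_triangle[OF a] open_face_triangle[OF a] .
qed

text \<open>Since all winding numbers add up to zero, that of the outer boundary counts the inner
  triangles over \<open>z\<close>, with a negative sign.\<close>

lemma inner_count:
  assumes "generic z"
  shows "2 * pi * card {f \<in> inner. z \<in> open_face f} = - face_view z outer"
proof -
  have fin: "finite inner" using finite_faces by (simp add: inner_def)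
  have "face_view z outer + (\<Sum>f\<in>inner. face_view z f) = 0"
    using total_view[OF assms] sum.remove[OF finite_faces outer, of "face_view z"] by (simp add: inner_def)
  moreover have "(\<Sum>f\<in>inner. face_view z f) = (\<Sum>f\<in>inner. if z \<in> open_face f then 2 * pi else 0)"
    using inner_view[OF assms] by (intro sum.cong) auto
  moreover have "\<dots> = 2 * pi * card {f \<in> inner. z \<in> open_face f}"
    using fin by (simp add: sum.If_cases Int_def)
  ultimately show ?thesis by linarith
qed

lemma open_face_nonempty: "f \<in> inner \<Longrightarrow> open_face f \<noteq> {}"
proof -
  assume f: "f \<in> inner"
  obtain x v where xv: "(x, v) \<in> A - outer" "f = face (x, v)" using inner_obtain[OF f] .
  then have "(x, v) \<in> f" using face_self by blast
  then show ?thesis using open_face_dense[OF f vertex_in_closed_face(1)[OF f] UNIV_I] by (metis empty_iff open_UNIV)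
qed

lemma outer_view:
  assumes z: "generic z" and ab: "(x, v) \<in> outer"
  shows "face_view z outer =
    (if 0 < orient (p x) (p v) (p (rot v x)) then if z \<in> open_face outer then 2 * pi else 0
     else if z \<in> open_triangle (p v) (p x) (p (rot v x)) then - 2 * pi else 0)"
proof -
  have a: "(x, v) \<in> A" "face (x, v) = outer" using mem_face[OF outer ab] by auto
  note t = face_triangle[OF a(1)]
  have g: "orient (p x) (p v) z \<noteq> 0" "orient (p v) (p (rot v x)) z \<noteq> 0" "orient (p (rot v x)) (p x) z \<noteq> 0"
    using z a t(4,5) unfolding generic_def by blast+
  have s: "face_view z outer = view z (p x) (p v) + view z (p v) (p (rot v x)) + view z (p (rot v x)) (p x)"
    using face_view_triangle[OF a(1), of z] a(2) by simp
  show ?thesis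
  proof (cases "0 < orient (p x) (p v) (p (rot v x))")
    case True
    then show ?thesis using view_triangle[OF True g] s open_face_triangle[OF a(1)] a(2) by simp
  next
    case False
    then have D: "0 < orient (p v) (p x) (p (rot v x))"
      using outer_nondeg[OF ab] orient_swap[of "p x" "p v" "p (rot v x)"] by linarith
    have g': "orient (p v) (p x) z \<noteq> 0" "orient (p x) (p (rot v x)) z \<noteq> 0" "orient (p (rot v x)) (p v) z \<noteq> 0"
      using g orient_swap by (metis neg_0_equal_iff_equal)+
    have "face_view z outer = - (view z (p v) (p x) + view z (p x) (p (rot v x)) + view z (p (rot v x)) (p v))"
      unfolding s view_antisym[OF g(1)] view_antisym[OF g(2)] view_antisym[OF g(3)] by simp
    then show ?thesis using view_triangle[OF D g'] False by simp
  qed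
qed

text \<open>A positively oriented outer triangle would make the number of inner triangles over a
  point at most zero everywhere, yet a generic point of an inner triangle is covered.\<close>

lemma outer_neg:
  assumes ab: "(x, v) \<in> outer"
  shows "orient (p x) (p v) (p (rot v x)) < 0"
proof (rule ccontr)
  assume "\<not> ?thesis"
  then have pos: "0 < orient (p x) (p v) (p (rot v x))" using outer_nondeg[OF ab] by simp
  have "(v, x) \<in> A - outer" using swap_notin_face[OF outer ab] arc_sym mem_face[OF outer ab] by blast
  then have f: "face (v, x) \<in> inner" by (rule face_inner)
  obtain z where z: "z \<in> open_face (face (v, x))" "generic z"
    using generic_exists[OF open_face_open[OF f] open_face_nonempty[OF f]] .
  have "{f \<in> inner. z \<in> open_face f} \<noteq> {}" using z f by blast
  then have "card {f \<in> inner. z \<in> open_face f} > 0" using finite_faces by (simp add: card_gt_0_iff inner_def)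
  then have "2 * pi * card {f \<in> inner. z \<in> open_face f} > 0" by simp
  then show False using inner_count[OF z(2)] outer_view[OF z(2) ab] pos by (simp split: if_splits)
qed

text \<open>The region enclosed by the outer face. By \<open>outer_neg\<close> its arcs run
  clockwise, hence the reversed inequalities.\<close>

definition hull_outer :: "complex set" where
  "hull_outer = {z. \<forall>(u, v) \<in> outer. orient (p u) (p v) z \<le> 0}"

lemma hull_outer_triangle:
  assumes "(x, v) \<in> outer"
  shows "hull_outer = triangle (p v) (p x) (p (rot v x))"
proof -
  have a: "(x, v) \<in> A" "face (x, v) = outer" using mem_face[OF outer assms] by auto
  have "outer = {(x, v), (v, rot v x), (rot v x, x)}" using face_triangle(1)[OF a(1)] a(2) by simp
  then have "hull_outer = {z. orient (p x) (p v) z \<le> 0 \<and> orient (p v) (p (rot v x)) z \<le> 0 \<and> orient (p (rot v x)) (p x) z \<le> 0}"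
    unfolding hull_outer_def by simp
  then show ?thesis
    using orient_swap[of "p x" "p v"] orient_swap[of "p v" "p (rot v x)"] orient_swap[of "p (rot v x)" "p x"]
    by (auto simp: triangle_def)
qed

lemma outer_arc: obtains a b where "(a, b) \<in> outer"
  using outer face_self by (fastforce simp: map_faces_def)

lemma inner_count_le:
  assumes "generic z"
  shows "card {f \<in> inner. z \<in> open_face f} \<le> 1" "z \<notin> hull_outer \<Longrightarrow> {f \<in> inner. z \<in> open_face f} = {}"
proof -
  obtain a b where ab: "(a, b) \<in> outer" using outer_arc .
  have c: "2 * pi * card {f \<in> inner. z \<in> open_face f} =
    (if z \<in> open_triangle (p b) (p a) (p (rot b a)) then 2 * pi else 0)"
    using inner_count[OF assms] outer_view[OF assms ab] outer_neg[OF ab] by simp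
  then show "card {f \<in> inner. z \<in> open_face f} \<le> 1" by (simp split: if_splits)
  assume "z \<notin> hull_outer"
  then have "z \<notin> open_triangle (p b) (p a) (p (rot b a))"
    using hull_outer_triangle[OF ab] open_triangle_subset by blast
  then have "card {f \<in> inner. z \<in> open_face f} = 0" using c by simp
  then show "{f \<in> inner. z \<in> open_face f} = {}" using finite_faces by (simp add: inner_def)
qed

lemma open_face_disjoint:
  assumes "f \<in> inner" "g \<in> inner" "open_face f \<inter> open_face g \<noteq> {}"
  shows "f = g"
proof -
  obtain z where z: "z \<in> open_face f \<inter> open_face g" "generic z"
    using generic_exists[of "open_face f \<inter> open_face g"] assms open_face_open by (metis open_Int)
  have fin: "finite {f \<in> inner. z \<in> open_face f}" using finite_faces by (simp add: inner_def)
  have "f \<in> {f \<in> inner. z \<in> open_face f}" "g \<in> {f \<in> inner. z \<in> open_face f}" using z assms by auto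
  moreover have "\<forall>a\<in>{f \<in> inner. z \<in> open_face f}. \<forall>b\<in>{f \<in> inner. z \<in> open_face f}. a = b"
    using inner_count_le(1)[OF z(2)] card_le_Suc0_iff_eq[OF fin] by simp
  ultimately show ?thesis by blast
qed

lemma closed_face_hull:
  assumes f: "f \<in> inner"
  shows "closed_face f \<subseteq> hull_outer"
proof
  obtain a b where ab: "(a, b) \<in> outer" using outer_arc .
  have cl: "closed hull_outer" unfolding hull_outer_triangle[OF ab] by (rule closed_triangle)
  fix z assume z: "z \<in> closed_face f"
  show "z \<in> hull_outer"
  proof (rule ccontr)
    assume n: "z \<notin> hull_outer"
    obtain w where w: "w \<in> - hull_outer" "w \<in> open_face f"
      using open_face_dense[OF f z, of "- hull_outer"] n cl by (auto simp: open_Compl)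
    obtain y where y: "y \<in> - hull_outer \<inter> open_face f" "generic y"
      using generic_exists[of "- hull_outer \<inter> open_face f"] w cl open_face_open[OF f] by (metis IntI empty_iff open_Compl open_Int)
    then show False using inner_count_le(2)[OF y(2)] f by blast
  qed
qed

text \<open>The tool for excluding crossings: a face through \<open>z\<close> has generic interior
  points in \<open>U\<close>, each of which lies in a single inner triangle, and that one belongs to
  \<open>S\<close>.\<close>

lemma face_in_star:
  assumes S: "S \<subseteq> inner" and U: "open U" "z \<in> U" "U \<subseteq> (\<Union>f\<in>S. closed_face f)"
    and f: "f \<in> inner" "z \<in> closed_face f"
  shows "f \<in> S"
proof -
  obtain w where w: "w \<in> U" "w \<in> open_face f" using open_face_dense[OF f U(2,1)] .
  obtain y where y: "y \<in> U \<inter> open_face f" "generic y"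
    using generic_exists[of "U \<inter> open_face f"] w U open_face_open[OF f(1)] by (metis IntI empty_iff open_Int)
  obtain g where g: "g \<in> S" "y \<in> closed_face g" using y U by blast
  then have "y \<in> open_face g" using generic_closed_face[OF y(2)] S by (auto simp: inner_def)
  then have "f = g" using open_face_disjoint[of f g] f g S y by blast
  then show ?thesis using g by simp
qed

lemma edge_full:
  assumes uv: "(u, v) \<in> A - outer" "(v, u) \<in> A - outer" and z: "z \<in> open_segment (p u) (p v)"
  obtains U where "open U" "z \<in> U" "U \<subseteq> (\<Union>f\<in>{face (u, v), face (v, u)}. closed_face f)"
proof -
  define w where "w = rot v u"
  define w' where "w' = rot u v"
  \<comment> \<open>Bounded by the four sides of the two triangles other than the common edge; on
    either side of the line of that edge, one of the triangles contains the point.\<close>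
  define U where "U = {y. 0 < orient (p v) (p w) y \<and> 0 < orient (p w) (p u) y \<and> 0 < orient (p u) (p w') y \<and> 0 < orient (p w') (p v) y}"
  have "open U" unfolding U_def by (intro open_Collect_conj open_Collect_less continuous_intros)
  moreover have "z \<in> U"
  proof -
    have z': "z \<in> open_segment (p v) (p u)" using z by (simp add: open_segment_commute)
    show ?thesis
      using open_segment_orient(2)[OF z] open_segment_orient(2)[OF z'] inner_pos[OF uv(1)] inner_pos[OF uv(2)]
      unfolding U_def w_def w'_def by auto
  qed
  moreover have "U \<subseteq> (\<Union>f\<in>{face (u, v), face (v, u)}. closed_face f)"
  proof
    fix y assume y: "y \<in> U"
    have "y \<in> closed_face (face (u, v)) \<or> y \<in> closed_face (face (v, u))"
      using y uv closed_face_triangle[of u v] closed_face_triangle[of v u] orient_swap[of "p u" "p v" y]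
      by (cases "0 \<le> orient (p u) (p v) y") (auto simp: U_def w_def w'_def triangle_def)
    then show "y \<in> (\<Union>f\<in>{face (u, v), face (v, u)}. closed_face f)" by blast
  qed
  ultimately show ?thesis using that by blast
qed

lemma corner_angle_inner:
  assumes "(x, v) \<in> A - outer"
  shows "cw_angle (p x - p v) (p (rot v x) - p v) \<in> {0<..<pi}"
proof -
  have "(x, v) \<in> A" using assms by simp
  then have "p x - p v \<noteq> 0" "p (rot v x) - p v \<noteq> 0"
    using arc_distinct[of x v] arc_distinct[OF face_triangle(4)[of x v]] by (metis right_minus_eq)+
  from cw_angle_pos_iff(1)[OF this] show ?thesis using inner_pos[OF assms] by (simp only: orient_corner)
qed

lemma inner_vertex_arc:
  assumes "v \<notin> face_verts outer" "(x, v) \<in> A"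
  shows "(x, v) \<in> A - outer"
  using assms face_triangle(1)[OF assms(2)] mem_face[OF outer] by (auto simp: face_verts_def)

text \<open>The last edge at \<open>v\<close> met before the direction of \<open>y\<close>, turning clockwise, bounds the
  sector containing \<open>y\<close>.\<close>

lemma sector:
  assumes v: "v \<in> V" "v \<notin> face_verts outer" and y: "y \<noteq> p v"
  obtains x where "(x, v) \<in> A - outer" "0 \<le> orient (p x) (p v) y" "0 \<le> orient (p v) (p (rot v x)) y"
proof -
  let ?N = "neighbours G v" and ?\<theta> = "\<lambda>x. cw_angle (p x - p v) (y - p v)"
  have ne: "?N \<noteq> {}" using vertex_has_arc[OF v(1)] by (auto simp: neighbours_def)
  obtain x where x: "x \<in> ?N" "\<And>x'. x' \<in> ?N \<Longrightarrow> ?\<theta> x \<le> ?\<theta> x'"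
  proof -
    have "Min (?\<theta> ` ?N) \<in> ?\<theta> ` ?N" by (rule Min_in) (use finite_neighbours ne in auto)
    then obtain x where "x \<in> ?N" "?\<theta> x = Min (?\<theta> ` ?N)" by (metis (no_types, lifting) imageE)
    moreover from this have "?\<theta> x \<le> ?\<theta> x'" if "x' \<in> ?N" for x'
      using that finite_neighbours by simp
    ultimately show ?thesis using that by blast
  qed
  have xv: "(x, v) \<in> A" using x(1) arc_sym by (auto simp: neighbours_def)
  have out: "(x, v) \<notin> outer" using inner_vertex_arc[OF v(2) xv] by simp
  define r where "r = rot v x"
  have r: "r \<in> ?N" using rot_arc[of v x] x(1) by (simp add: neighbours_def r_def)
  have "(v, r) \<in> A" using r by (simp add: neighbours_def)
  then have nz: "p x - p v \<noteq> 0" "p r - p v \<noteq> 0" "y - p v \<noteq> 0"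
    using arc_distinct[OF xv] arc_distinct[of v r] y by (metis right_minus_eq)+
  have \<alpha>: "cw_angle (p x - p v) (p r - p v) \<in> {0<..<pi}"
    using corner_angle_inner xv out by (simp add: r_def)
  \<comment> \<open>Otherwise the successor \<open>r\<close> would still come before the direction
    of \<open>y\<close>, and be closer to it.\<close>
  have lt: "?\<theta> x < cw_angle (p x - p v) (p r - p v)"
  proof (rule ccontr)
    assume "\<not> ?thesis"
    then have "?\<theta> r = ?\<theta> x - cw_angle (p x - p v) (p r - p v)"
      using nz by (intro cw_angle_diff) auto
    then show False using x(2)[OF r] \<alpha> by simp
  qed
  have "0 \<le> orient (p x) (p v) y"
  proof (cases "?\<theta> x = 0")
    case True
    then obtain s where "y - p v = of_real s * (p x - p v)" using cw_angle_eq_0 nz by metis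
    then have yy: "y = p v + of_real s * (p x - p v)" by (simp add: algebra_simps)
    show ?thesis unfolding yy by (simp add: orient_def algebra_simps)
  next
    case False
    then have "?\<theta> x \<in> {0<..<pi}" using lt \<alpha> cw_angle_range[of "p x - p v" "y - p v"] by auto
    then show ?thesis using cw_angle_pos_iff(1)[OF nz(1,3)] by (simp only: orient_corner less_imp_le)
  qed
  moreover have "0 \<le> orient (p v) (p r) y"
  proof -
    have "cw_angle (y - p v) (p r - p v) = cw_angle (p x - p v) (p r - p v) - ?\<theta> x"
      using lt nz by (intro cw_angle_diff) auto
    then have "cw_angle (y - p v) (p r - p v) \<in> {0<..<pi}"
      using lt \<alpha> cw_angle_range(1)[of "p x - p v" "y - p v"] by auto
    then have "0 < orient y (p v) (p r)" using cw_angle_pos_iff(1)[OF nz(3,2)] by (simp only: orient_corner)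
    then show ?thesis by (simp add: orient_rotate)
  qed
  ultimately show ?thesis using that xv out by (simp add: r_def)
qed

lemma vertex_full:
  assumes v: "v \<in> V" "v \<notin> face_verts outer"
  obtains U where "open U" "p v \<in> U" "U \<subseteq> (\<Union>f\<in>(\<lambda>x. face (x, v)) ` neighbours G v. closed_face f)"
    "(\<lambda>x. face (x, v)) ` neighbours G v \<subseteq> inner"
proof -
  let ?N = "neighbours G v"
  have arc: "(x, v) \<in> A - outer" if "x \<in> ?N" for x
    using that arc_sym by (intro inner_vertex_arc[OF v(2)]) (auto simp: neighbours_def)
  \<comment> \<open>These half-planes take care of the side opposite \<open>v\<close> in each
    triangle; \<open>sector\<close> supplies the two sides through \<open>v\<close>.\<close>
  define U where "U = (\<Inter>x\<in>?N. {y. 0 < orient (p (rot v x)) (p x) y})"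
  have "open U" unfolding U_def
    using finite_neighbours by (intro open_INT ballI open_Collect_less continuous_intros) auto
  moreover have "p v \<in> U"
    using inner_pos arc by (auto simp: U_def orient_rotate)
  moreover have "U \<subseteq> (\<Union>f\<in>(\<lambda>x. face (x, v)) ` ?N. closed_face f)"
  proof
    fix y assume y: "y \<in> U"
    show "y \<in> (\<Union>f\<in>(\<lambda>x. face (x, v)) ` ?N. closed_face f)"
    proof (cases "y = p v")
      case True
      obtain x where x: "x \<in> ?N" using vertex_has_arc[OF v(1)] by (auto simp: neighbours_def)
      have "p v \<in> closed_face (face (x, v))"
        using vertex_in_closed_face(2) face_inner[OF arc[OF x]] face_self arc[OF x] by blast
      then show ?thesis using x True by blast
    next
      case False
      obtain x where x: "(x, v) \<in> A - outer" "0 \<le> orient (p x) (p v) y" "0 \<le> orient (p v) (p (rot v x)) y"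
        using sector[OF v False] .
      then have xN: "x \<in> ?N" using arc_sym by (auto simp: neighbours_def)
      then have "0 \<le> orient (p (rot v x)) (p x) y" using y by (auto simp: U_def less_imp_le)
      then have "y \<in> closed_face (face (x, v))" using x closed_face_triangle[of x v] by (auto simp: triangle_def)
      then show ?thesis using xN by blast
    qed
  qed
  moreover have "(\<lambda>x. face (x, v)) ` ?N \<subseteq> inner" using face_inner arc by blast
  ultimately show ?thesis using that by blast
qed

end

section \<open>The straight segments form a drawing of the map\<close>

context developed
begin

lemma third_vertex_off_edge:
  assumes uv: "(u, v) \<in> A" and z: "z \<in> open_segment (p u) (p v)"
  shows "orient (p v) (p (rot v u)) z \<noteq> 0" "orient (p (rot v u)) (p u) z \<noteq> 0"
  using open_segment_orient(2)[OF z] nondeg[OF uv] by fastforce+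

lemma off_boundary:
  assumes uv: "(u, v) \<in> A" and z: "z \<in> open_segment (p u) (p v)"
    and xy: "(x, y) \<in> face (u, v)" "{x, y} \<noteq> {u, v}"
  shows "z \<notin> closed_segment (p x) (p y)"
proof -
  have "(x, y) = (v, rot v u) \<or> (x, y) = (rot v u, u)"
    using xy unfolding face_triangle(1)[OF uv] by auto
  then have "orient (p x) (p y) z \<noteq> 0" using third_vertex_off_edge[OF uv z] by auto
  moreover have "orient (p x) (p y) z = 0" if "z \<in> closed_segment (p x) (p y)"
  proof -
    obtain t where "z = (1 - t) *\<^sub>R p x + t *\<^sub>R p y" using \<open>z \<in> closed_segment (p x) (p y)\<close> by (auto simp: in_segment)
    then show ?thesis by (simp only:) (simp add: orient_def algebra_simps)
  qed
  ultimately show ?thesis by blast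
qed

lemma vertex_inner_arc:
  assumes "v \<in> V"
  obtains x where "(x, v) \<in> A - outer"
proof -
  obtain y where y: "(v, y) \<in> A" using vertex_has_arc[OF assms] .
  show ?thesis
  proof (cases "(v, y) \<in> outer")
    case True
    then show ?thesis using that swap_notin_face[OF outer] arc_sym[OF y] by blast
  next
    case False
    have "(rot y v, v) \<in> A" "face (rot y v, v) = face (v, y)"
      using face_triangle(5)[OF y] face_rot(2)[OF y] by auto
    moreover have "face (v, y) \<noteq> outer" using False face_self[OF y] by blast
    ultimately show ?thesis using that mem_face[OF outer] by blast
  qed
qed

text \<open>A face never contains both directions of an edge, so every edge, even an outer one, is a
  side of an inner triangle. This lets \<open>face_in_star\<close> apply to all edges.\<close>

lemma edge_inner_arc:
  assumes "(u, v) \<in> A"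
  obtains x y where "(x, y) \<in> A - outer" "{x, y} = {u, v}"
  using that[of u v] that[of v u] assms arc_sym swap_notin_face[OF outer] by (cases "(u, v) \<in> outer") auto

lemma outer_face_verts:
  assumes "(x, v) \<in> outer"
  shows "face_verts outer = {x, v, rot v x}"
proof -
  have "(x, v) \<in> A" "face (x, v) = outer" using mem_face[OF outer assms] by auto
  then have "outer = {(x, v), (v, rot v x), (rot v x, x)}" using face_triangle(1) by metis
  then show ?thesis by (auto simp: face_verts_def)
qed

lemma segment_in_closed_face:
  assumes "(x, y) \<in> A - outer" "z \<in> closed_segment (p x) (p y)"
  shows "z \<in> closed_face (face (x, y))"
proof -
  have a: "(x, y) \<in> A" using assms by simp
  have "p x \<in> closed_face (face (x, y))" "p y \<in> closed_face (face (x, y))"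
    using vertex_in_closed_face[OF face_inner[OF assms(1)] face_self[OF a]] by auto
  then show ?thesis
    using segment_in_triangle assms(2) unfolding closed_face_triangle[OF a] by blast
qed

text \<open>The star of the inner vertex \<open>u\<close> fills a neighbourhood of its position, so
  an inner triangle at \<open>v\<close> through that point has \<open>u\<close> as a corner too; but
  corners of a triangle are distinct.\<close>

lemma positions_distinct_aux:
  assumes u: "u \<in> V" "u \<notin> face_verts outer" and v: "v \<in> V" "u \<noteq> v"
  shows "p u \<noteq> p v"
proof
  assume eq: "p u = p v"
  obtain U where U: "open U" "p u \<in> U" "U \<subseteq> (\<Union>f\<in>(\<lambda>x. face (x, u)) ` neighbours G u. closed_face f)"
    "(\<lambda>x. face (x, u)) ` neighbours G u \<subseteq> inner" using vertex_full[OF u] .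
  obtain y where y: "(y, v) \<in> A - outer" using vertex_inner_arc[OF v(1)] .
  then have yA: "(y, v) \<in> A" by simp
  have f: "face (y, v) \<in> inner" using face_inner[OF y] .
  have "p u \<in> closed_face (face (y, v))" using vertex_in_closed_face(2)[OF f face_self[OF yA]] eq by simp
  from face_in_star[OF U(4,1,2,3) f this] obtain x where x: "x \<in> neighbours G u" "face (x, u) = face (y, v)" by force
  have xu: "(x, u) \<in> A" using x(1) arc_sym by (auto simp: neighbours_def)
  have "(y, v) \<in> face (x, u)" using x(2) face_self[OF yA] by simp
  then have "v \<in> {x, rot u x}" using v(2) unfolding face_triangle(1)[OF xu] by auto
  then show False using eq arc_distinct[OF xu] arc_distinct[OF face_triangle(4)[OF xu]] by auto
qed

lemma positions_distinct: "inj_on p V"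
proof (rule inj_onI, rule ccontr)
  fix u v assume uv: "u \<in> V" "v \<in> V" "p u = p v" "u \<noteq> v"
  consider "u \<notin> face_verts outer" | "v \<notin> face_verts outer" | "u \<in> face_verts outer" "v \<in> face_verts outer"
    by blast
  then show False
  proof cases
    case 3
    obtain a b where ab: "(a, b) \<in> outer" using outer_arc .
    have aA: "(a, b) \<in> A" using mem_face[OF outer ab] by simp
    show False
      using 3 uv(3,4) arc_distinct[OF aA] arc_distinct[OF face_triangle(4)[OF aA]]
        arc_distinct[OF face_triangle(5)[OF aA]]
      unfolding outer_face_verts[OF ab] by auto
  qed (use positions_distinct_aux uv in metis)+
qed

text \<open>An inner edge is shielded by the two triangles along it. On an outer edge, an inner
  vertex is shielded by its own star instead, and an outer vertex is a corner of the nondegenerate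
  outer triangle.\<close>

lemma vertex_off_edge:
  assumes v: "v \<in> V" and xy: "(x, y) \<in> A"
  shows "p v \<notin> open_segment (p x) (p y)"
proof
  assume z: "p v \<in> open_segment (p x) (p y)"
  have nv: "v \<noteq> x" "v \<noteq> y" using z by (auto simp: open_segment_def)
  have not_third: "v \<noteq> rot y x" "v \<noteq> rot x y"
  proof -
    show "v \<noteq> rot y x" using third_vertex_off_edge(1)[OF xy z] by auto
    have "p v \<in> open_segment (p y) (p x)" using z by (simp add: open_segment_commute)
    from third_vertex_off_edge(1)[OF arc_sym[OF xy] this] show "v \<noteq> rot x y" by auto
  qed
  have not_in: "(w, v) \<notin> face (x, y)" "(w, v) \<notin> face (y, x)" for w
    using nv not_third unfolding face_triangle(1)[OF xy] face_triangle(1)[OF arc_sym[OF xy]] by auto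
  obtain w where w: "(w, v) \<in> A - outer" using vertex_inner_arc[OF v] .
  then have wA: "(w, v) \<in> A" by simp
  show False
  proof (cases "(x, y) \<in> outer \<or> (y, x) \<in> outer")
    case False
    then have i: "(x, y) \<in> A - outer" "(y, x) \<in> A - outer" using xy arc_sym by auto
    obtain U where U: "open U" "p v \<in> U" "U \<subseteq> (\<Union>f\<in>{face (x, y), face (y, x)}. closed_face f)"
      using edge_full[OF i z] .
    have "face (w, v) \<in> {face (x, y), face (y, x)}"
      using face_in_star[OF _ U] face_inner[OF i(1)] face_inner[OF i(2)] face_inner[OF w]
        vertex_in_closed_face(2)[OF face_inner[OF w] face_self[OF wA]] by blast
    then show False using not_in face_self[OF wA] by auto
  next
    case out: True
    show False
    proof (cases "v \<in> face_verts outer")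
      case True
      have "face_verts outer = {x, y, rot y x} \<or> face_verts outer = {y, x, rot x y}"
        using out outer_face_verts by blast
      then show False using True nv not_third by auto
    next
      case False
      obtain U where U: "open U" "p v \<in> U" "U \<subseteq> (\<Union>f\<in>(\<lambda>x. face (x, v)) ` neighbours G v. closed_face f)"
        "(\<lambda>x. face (x, v)) ` neighbours G v \<subseteq> inner" using vertex_full[OF v False] .
      obtain x' y' where e: "(x', y') \<in> A - outer" "{x', y'} = {x, y}" using edge_inner_arc[OF xy] .
      have seg: "p v \<in> closed_segment (p x') (p y')"
        using z e(2) open_closed_segment by (auto simp: doubleton_eq_iff open_segment_commute closed_segment_commute)
      have "face (x', y') \<in> (\<lambda>x. face (x, v)) ` neighbours G v"
        using face_in_star[OF U(4,1,2,3) face_inner[OF e(1)] segment_in_closed_face[OF e(1) seg]] .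
      then obtain k where k: "k \<in> neighbours G v" "face (x', y') = face (k, v)" by blast
      have "(k, v) \<in> face (x', y')" using k face_self arc_sym by (auto simp: neighbours_def)
      then show False using not_in e(2) by (auto simp: doubleton_eq_iff)
    qed
  qed
qed

lemma edges_cross_aux:
  assumes uv: "(u, v) \<in> A - outer" "(v, u) \<in> A - outer" and xy: "(x, y) \<in> A" and ne: "{u, v} \<noteq> {x, y}"
    and z: "z \<in> open_segment (p u) (p v)"
  shows "z \<notin> open_segment (p x) (p y)"
proof
  assume z2: "z \<in> open_segment (p x) (p y)"
  obtain U where U: "open U" "z \<in> U" "U \<subseteq> (\<Union>f\<in>{face (u, v), face (v, u)}. closed_face f)"
    using edge_full[OF uv z] .
  obtain x' y' where e: "(x', y') \<in> A - outer" "{x', y'} = {x, y}" using edge_inner_arc[OF xy] .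
  have seg: "z \<in> closed_segment (p x') (p y')"
    using z2 e(2) open_closed_segment by (auto simp: doubleton_eq_iff open_segment_commute closed_segment_commute)
  have "face (x', y') \<in> {face (u, v), face (v, u)}"
    using face_in_star[OF _ U face_inner[OF e(1)] segment_in_closed_face[OF e(1) seg]] face_inner[OF uv(1)] face_inner[OF uv(2)]
    by blast
  then have "(x', y') \<in> face (u, v) \<or> (x', y') \<in> face (v, u)" using face_self[of "(x', y')"] e(1) by auto
  then show False
    using off_boundary[of u v z x' y'] off_boundary[of v u z x' y'] uv z seg ne e(2)
    by (auto simp: open_segment_commute insert_commute)
qed

text \<open>The two triangles at an inner edge keep every other edge away, so both edges would have
  to be outer; these are sides of one nondegenerate triangle.\<close>

lemma edges_cross:
  assumes uv: "(u, v) \<in> A" and xy: "(x, y) \<in> A" and ne: "{u, v} \<noteq> {x, y}"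
    and z: "z \<in> open_segment (p u) (p v)"
  shows "z \<notin> open_segment (p x) (p y)"
proof
  assume z2: "z \<in> open_segment (p x) (p y)"
  have 1: "(u, v) \<in> outer \<or> (v, u) \<in> outer"
    using edges_cross_aux[of u v x y z] uv xy ne z z2 arc_sym by blast
  have 2: "(x, y) \<in> outer \<or> (y, x) \<in> outer"
    using edges_cross_aux[of x y u v z] uv xy ne z z2 arc_sym by blast
  obtain u' v' where u: "(u', v') \<in> outer" "{u', v'} = {u, v}" using 1 by auto
  obtain x' y' where x: "(x', y') \<in> outer" "{x', y'} = {x, y}" using 2 by auto
  have a: "(u', v') \<in> A" "face (u', v') = outer" using mem_face[OF outer u(1)] by auto
  have "z \<in> open_segment (p u') (p v')" using z u(2) by (auto simp: doubleton_eq_iff open_segment_commute)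
  moreover have "z \<in> closed_segment (p x') (p y')"
    using z2 x(2) open_closed_segment by (auto simp: doubleton_eq_iff open_segment_commute closed_segment_commute)
  ultimately show False using off_boundary[OF a(1), of z x' y'] a(2) x ne u(2) by simp
qed

lemma proper: "proper_drawing G p (\<lambda>u v. linepath (p u) (p v))"
  unfolding proper_drawing_iff
proof (intro conjI allI impI positions_distinct)
  fix u v assume uv: "(u, v) \<in> A"
  show "arc (linepath (p u) (p v))" using arc_distinct[OF uv] by simp
  show "pathstart (linepath (p u) (p v)) = p u" "pathfinish (linepath (p u) (p v)) = p v"
    "linepath (p v) (p u) = reversepath (linepath (p u) (p v))" by simp_all
  show "path_image (linepath (p u) (p v)) \<inter> p ` V = {p u, p v}"
    using vertex_off_edge[OF _ uv] arc_verts[OF uv] by (auto simp: open_segment_def)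
next
  fix u v x y assume uv: "(u, v) \<in> A" and xy: "(x, y) \<in> A" and ne: "{u, v} \<noteq> {x, y}"
  have V: "u \<in> V" "v \<in> V" "x \<in> V" "y \<in> V" using arc_verts[OF uv] arc_verts[OF xy] by auto
  note inj = inj_onD[OF positions_distinct]
  show "path_image (linepath (p u) (p v)) \<inter> path_image (linepath (p x) (p y)) \<subseteq> p ` ({u, v} \<inter> {x, y})"
  proof
    fix z assume "z \<in> path_image (linepath (p u) (p v)) \<inter> path_image (linepath (p x) (p y))"
    then have z: "z \<in> closed_segment (p u) (p v)" "z \<in> closed_segment (p x) (p y)" by auto
    have "z \<notin> open_segment (p u) (p v) \<or> z \<notin> open_segment (p x) (p y)"
      using edges_cross[OF uv xy ne] by blast
    then have "z = p u \<or> z = p v \<or> z = p x \<or> z = p y" using z by (auto simp: open_segment_def)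
    moreover have "w \<in> {u, v}" if "z = p w" "w \<in> V" for w
      using that z(1) vertex_off_edge[OF that(2) uv] inj V by (auto simp: open_segment_def)
    moreover have "w \<in> {x, y}" if "z = p w" "w \<in> V" for w
      using that z(2) vertex_off_edge[OF that(2) xy] inj V by (auto simp: open_segment_def)
    ultimately show "z \<in> p ` ({u, v} \<inter> {x, y})" using V by blast
  qed
qed

lemma directions_distinct:
  assumes "(v, x) \<in> A" "(v, y) \<in> A" "x \<noteq> y"
  shows "cw_angle (p x - p v) (p y - p v) \<noteq> 0"
proof
  assume z: "cw_angle (p x - p v) (p y - p v) = 0"
  have nz: "p x - p v \<noteq> 0" "p y - p v \<noteq> 0" using arc_distinct assms by (metis right_minus_eq)+
  obtain r where r: "0 < r" "p y - p v = of_real r * (p x - p v)" using cw_angle_eq_0[OF nz z] .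
  have V: "x \<in> V" "y \<in> V" using assms arc_verts by blast+
  show False
    using collinear_cases[OF r] nz vertex_off_edge[OF V(1) assms(2)] vertex_off_edge[OF V(2) assms(1)]
      inj_onD[OF positions_distinct _ V] assms(3) by auto
qed

text \<open>An edge leaving \<open>v\<close> strictly between two consecutive ones would, at an
  inner corner, enter the open triangle there, and then be one of its sides. At the outer corner it
  would leave the hull of the outer triangle.\<close>

lemma corner_minimal:
  assumes x: "(v, x) \<in> A" and y: "(v, y) \<in> A" "y \<noteq> x"
  shows "cw_angle (p x - p v) (p (rot v x) - p v) \<le> cw_angle (p x - p v) (p y - p v)"
proof (rule ccontr)
  assume "\<not> ?thesis"
  then have lt: "cw_angle (p x - p v) (p y - p v) < cw_angle (p x - p v) (p (rot v x) - p v)" by simp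
  define r where "r = rot v x"
  define \<theta> where "\<theta> = cw_angle (p x - p v) (p y - p v)"
  define \<alpha> where "\<alpha> = cw_angle (p x - p v) (p r - p v)"
  have xv: "(x, v) \<in> A" using arc_sym[OF x] .
  note t = face_triangle[OF xv, folded r_def]
  have nz: "p x - p v \<noteq> 0" "p y - p v \<noteq> 0" "p r - p v \<noteq> 0"
    using arc_distinct x y(1) t(4) by (metis right_minus_eq)+
  have \<theta>: "0 < \<theta>" "\<theta> < \<alpha>"
    using directions_distinct[OF x y(1)] y(2) cw_angle_range(1)[of "p x - p v" "p y - p v"] lt
    by (auto simp: \<theta>_def \<alpha>_def r_def less_le)
  have rest: "cw_angle (p y - p v) (p r - p v) = \<alpha> - \<theta>"
    using lt nz unfolding \<alpha>_def \<theta>_def r_def by (intro cw_angle_diff) auto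
  show False
  proof (cases "(x, v) \<in> outer")
    case False
    then have xi: "(x, v) \<in> A - outer" using xv by simp
    have \<alpha>: "\<alpha> \<in> {0<..<pi}" using corner_angle_inner[OF xi] by (simp add: \<alpha>_def r_def)
    have "0 < orient (p x) (p v) (p y)"
      using cw_angle_pos_iff(1)[OF nz(1,2)] \<theta> \<alpha> unfolding orient_corner \<theta>_def by auto
    have "0 < orient (p v) (p r) (p y)"
    proof -
      have "0 < orient (p y) (p v) (p r)"
        using cw_angle_pos_iff(1)[OF nz(2,3)] \<theta> \<alpha> unfolding orient_corner rest by auto
      then show ?thesis by (metis orient_rotate)
    qed
    have pv: "0 < orient (p r) (p x) (p v)"
      using inner_pos[OF xi] unfolding r_def by (metis orient_rotate)
    \<comment> \<open>Points of the edge close to \<open>v\<close> are inside the triangle: the two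
      sides through \<open>v\<close> are controlled by the angles, the third by continuity.\<close>
    define q where "q s = p v + of_real s * (p y - p v)" for s
    have "((\<lambda>s. orient (p r) (p x) (q s)) \<longlongrightarrow> orient (p r) (p x) (q 0)) (at_right 0)"
      unfolding q_def orient_affine by (intro tendsto_intros)
    then have e1: "\<forall>\<^sub>F s in at_right 0. 0 < orient (p r) (p x) (q s)"
      using pv by (intro order_tendstoD(1)) (auto simp: q_def)
    have e2: "\<forall>\<^sub>F s::real in at_right 0. s \<in> {0<..<1}" by (rule eventually_at_right_real) simp
    obtain s where s: "0 < orient (p r) (p x) (q s)" "0 < s" "s < 1"
      using eventually_happens'[OF trivial_limit_at_right_real eventually_conj[OF e1 e2]] by auto
    have "q s \<in> open_face (face (x, v))"
      using s \<open>0 < orient (p x) (p v) (p y)\<close> \<open>0 < orient (p v) (p r) (p y)\<close>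
      unfolding open_face_triangle[OF xv] by (simp add: open_triangle_def q_def orient_affine r_def[symmetric])
    moreover have "q s \<in> closed_segment (p v) (p y)"
      using s(2,3) by (auto simp: q_def in_segment scaleR_conv_of_real algebra_simps intro!: exI[of _ s])
    moreover obtain v' y' where e: "(v', y') \<in> A - outer" "{v', y'} = {v, y}" using edge_inner_arc[OF y(1)] .
    ultimately have "q s \<in> closed_segment (p v') (p y')"
      by (auto simp: doubleton_eq_iff closed_segment_commute)
    then have "face (v', y') \<in> {face (x, v)}"
      using face_in_star[OF _ open_face_open[OF face_inner[OF xi]] \<open>q s \<in> open_face (face (x, v))\<close> _ face_inner[OF e(1)] segment_in_closed_face[OF e(1)]]
        face_inner[OF xi] open_face_subset by auto
    then have "(v', y') \<in> face (x, v)" using face_self[of "(v', y')"] e(1) by auto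
    then have "y = r" using e(2) y(2) arc_neq[OF y(1)] arc_neq[OF t(4)] arc_neq[OF xv]
      unfolding t(1) by (auto simp: doubleton_eq_iff)
    then show False using lt by (simp add: r_def)
  next
    case True
    have "orient (p x) (p v) (p r) < 0" using outer_neg[OF True] by (simp add: r_def)
    then have \<alpha>: "\<alpha> \<in> {pi<..<2 * pi}"
      using cw_angle_pos_iff(2)[OF nz(1,3)] unfolding orient_corner \<alpha>_def by blast
    obtain k where k: "(k, y) \<in> A - outer" using vertex_inner_arc[OF arc_verts(2)[OF y(1)]] .
    then have kA: "(k, y) \<in> A" by simp
    have "p y \<in> hull_outer"
      using closed_face_hull[OF face_inner[OF k]] vertex_in_closed_face(2)[OF face_inner[OF k] face_self[OF kA]] by blast
    then have "p y \<in> triangle (p v) (p x) (p r)" using hull_outer_triangle[OF True] by (simp add: r_def)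
    then have h: "0 \<le> orient (p v) (p x) (p y)" "0 \<le> orient (p r) (p v) (p y)" by (simp_all add: triangle_def)
    have "\<not> \<theta> < pi"
    proof
      assume "\<theta> < pi"
      then have "0 < orient (p x) (p v) (p y)"
        using cw_angle_pos_iff(1)[OF nz(1,2)] \<theta>(1) unfolding orient_corner \<theta>_def by auto
      then show False using h(1) orient_swap[of "p x" "p v" "p y"] by simp
    qed
    then have "cw_angle (p y - p v) (p r - p v) \<in> {0<..<pi}" using rest \<theta> \<alpha> by auto
    then have "0 < orient (p y) (p v) (p r)"
      using cw_angle_pos_iff(1)[OF nz(2,3)] unfolding orient_corner by blast
    then show False using h(2) orient_rotate[of "p y" "p v" "p r"] orient_rotate[of "p v" "p r" "p y"] orient_swap[of "p v" "p r" "p y"]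
      by simp
  qed
qed

text \<open>The drawing lies in a convex hull, so every point off the hull is in the unbounded
  component. Points to the left of an outer arc are off the hull because outer arcs run
  clockwise.\<close>

lemma unbounded: "is_unbounded_face G p outer"
  unfolding is_unbounded_face_def
proof (safe)
  fix u v assume uv: "(u, v) \<in> outer"
  have a: "(u, v) \<in> A" using mem_face[OF outer uv] by simp
  let ?S = "\<Union>(x, y)\<in>A. closed_segment (p x) (p y)"
  have "closed_segment (p x) (p y) \<subseteq> hull_outer" if xy: "(x, y) \<in> A" for x y
  proof -
    obtain x' y' where e: "(x', y') \<in> A - outer" "{x', y'} = {x, y}" using edge_inner_arc[OF xy] .
    have "closed_segment (p x') (p y') \<subseteq> hull_outer"
      using segment_in_closed_face[OF e(1)] closed_face_hull[OF face_inner[OF e(1)]] by blast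
    then show ?thesis using e(2) by (auto simp: doubleton_eq_iff closed_segment_commute)
  qed
  then have sub: "?S \<subseteq> hull_outer" by auto
  have conv: "convex hull_outer" unfolding hull_outer_triangle[OF uv] by (rule convex_triangle)
  have "- hull_outer \<subseteq> outside ?S"
    using outside_mono[OF sub] outside_convex[OF conv] by simp
  moreover have "midpoint (p u) (p v) + of_real \<epsilon> * \<i> * (p v - p u) \<notin> hull_outer" if "0 < \<epsilon>" for \<epsilon> :: real
  proof -
    have "orient (p u) (p v) (midpoint (p u) (p v) + of_real \<epsilon> * \<i> * (p v - p u)) = \<epsilon> * (norm (p v - p u))\<^sup>2"
      unfolding cmod_power2 by (simp add: orient_def midpoint_def algebra_simps power2_eq_square) (simp add: field_simps)
    also have "\<dots> > 0" using that arc_distinct[OF a] by simp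
    finally show ?thesis using uv unfolding hull_outer_def by force
  qed
  ultimately have "\<forall>\<epsilon>>0. midpoint (p u) (p v) + of_real \<epsilon> * \<i> * (p v - p u) \<in> outside ?S" by blast
  then show "\<forall>\<^sub>F \<epsilon> in at_right 0. midpoint (p u) (p v) + of_real \<epsilon> * \<i> * (p v - p u) \<in> outside ?S"
    by (auto simp: eventually_at_filter)
qed

end

section \<open>The clockwise order of straight edges\<close>

context triangulation
begin

text \<open>For radii below all edge lengths at \<open>v\<close>, the points hit on the circle are
  positive multiples of the edge vectors relative to \<open>p v\<close>. Clockwise angles do not see
  the factors, so the condition no longer depends on the radius.\<close>

lemma respects_rotation_straight:
  assumes inj: "\<And>u v. (u, v) \<in> A \<Longrightarrow> p u \<noteq> p v"
  shows "respects_rotation G rot p (\<lambda>u v. linepath (p u) (p v)) \<longleftrightarrow>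
    (\<forall>v x y. (v, x) \<in> A \<longrightarrow> (v, y) \<in> A \<longrightarrow> y \<noteq> x \<longrightarrow>
      cw_angle (p x - p v) (p (rot v x) - p v) \<le> cw_angle (p x - p v) (p y - p v))"
proof -
  define Q where "Q v \<longleftrightarrow> (\<forall>x \<in> neighbours G v. \<forall>y \<in> neighbours G v - {x}.
    cw_angle (p x - p v) (p (rot v x) - p v) \<le> cw_angle (p x - p v) (p y - p v))" for v
  have "(\<forall>\<^sub>F r in at_right 0. let d = (\<lambda>w. first_hit (linepath (p v) (p w)) r - p v) in
        \<forall>x \<in> neighbours G v. \<forall>y \<in> neighbours G v - {x}.
          cw_angle (d x) (d (rot v x)) \<le> cw_angle (d x) (d y)) \<longleftrightarrow> Q v" for v
  proof -
    have "\<forall>\<^sub>F r in at_right 0. \<forall>w\<in>neighbours G v. r < norm (p w - p v)"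
    proof (rule eventually_ball_finite[OF finite_neighbours], rule ballI)
      fix w assume "w \<in> neighbours G v"
      then have "0 < norm (p w - p v)" using inj[of v w] by (auto simp: neighbours_def)
      then show "\<forall>\<^sub>F r in at_right 0. r < norm (p w - p v)"
        by (rule eventually_mono[OF eventually_at_right_real]) auto
    qed
    moreover have "\<forall>\<^sub>F r::real in at_right 0. 0 < r" by (simp add: eventually_at_filter)
    ultimately have ev: "\<forall>\<^sub>F r in at_right 0. 0 < r \<and> (\<forall>w\<in>neighbours G v. r < norm (p w - p v))"
      by (rule eventually_conj[rotated])
    have eq: "(let d = (\<lambda>w. first_hit (linepath (p v) (p w)) r - p v) in
        \<forall>x \<in> neighbours G v. \<forall>y \<in> neighbours G v - {x}.
          cw_angle (d x) (d (rot v x)) \<le> cw_angle (d x) (d y)) \<longleftrightarrow> Q v"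
      if r: "0 < r \<and> (\<forall>w\<in>neighbours G v. r < norm (p w - p v))" for r
    proof -
      have d: "first_hit (linepath (p v) (p w)) r - p v = of_real (r / norm (p w - p v)) * (p w - p v)"
        if "w \<in> neighbours G v" for w
        using r that by (simp add: first_hit_linepath)
      have pos: "0 < r / norm (p w - p v)" if "w \<in> neighbours G v" for w
        using r that inj[of v w] by (auto simp: neighbours_def)
      have rot: "rot v x \<in> neighbours G v" if "x \<in> neighbours G v" for x
        using that rot_arc by (auto simp: neighbours_def)
      have sc: "cw_angle (first_hit (linepath (p v) (p x)) r - p v) (first_hit (linepath (p v) (p y)) r - p v)
        = cw_angle (p x - p v) (p y - p v)" if "x \<in> neighbours G v" "y \<in> neighbours G v" for x y
        unfolding d[OF that(1)] d[OF that(2)] using cw_angle_scale[OF pos[OF that(1)] pos[OF that(2)]] .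
      show ?thesis unfolding Let_def Q_def using sc rot by auto
    qed
    show ?thesis
    proof
      assume "\<forall>\<^sub>F r in at_right 0. let d = (\<lambda>w. first_hit (linepath (p v) (p w)) r - p v) in
        \<forall>x \<in> neighbours G v. \<forall>y \<in> neighbours G v - {x}.
          cw_angle (d x) (d (rot v x)) \<le> cw_angle (d x) (d y)"
      then have "\<forall>\<^sub>F r::real in at_right 0. Q v" using ev by eventually_elim (use eq in blast)
      then show "Q v" using eventually_happens'[OF trivial_limit_at_right_real] by blast
    next
      assume "Q v"
      then show "\<forall>\<^sub>F r in at_right 0. let d = (\<lambda>w. first_hit (linepath (p v) (p w)) r - p v) in
        \<forall>x \<in> neighbours G v. \<forall>y \<in> neighbours G v - {x}.
          cw_angle (d x) (d (rot v x)) \<le> cw_angle (d x) (d y)"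
        using ev by (rule_tac eventually_mono) (use eq in blast)+
    qed
  qed
  then have "respects_rotation G rot p (\<lambda>u v. linepath (p u) (p v)) \<longleftrightarrow> (\<forall>v\<in>V. Q v)"
    unfolding respects_rotation_def by simp
  also have "\<dots> \<longleftrightarrow> (\<forall>v x y. (v, x) \<in> A \<longrightarrow> (v, y) \<in> A \<longrightarrow> y \<noteq> x \<longrightarrow>
      cw_angle (p x - p v) (p (rot v x) - p v) \<le> cw_angle (p x - p v) (p y - p v))"
    unfolding Q_def neighbours_def using arc_verts by blast
  finally show ?thesis .
qed

end

theorem (in developed) embedding:
  "map_drawing G rot p (\<lambda>u v. linepath (p u) (p v))" "is_unbounded_face G p outer"
  using proper unbounded corner_minimal respects_rotation_straight[of p] arc_distinct
  unfolding map_drawing_def by blast+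

section \<open>Straight drawings are rigid\<close>

lemma frontier_open_triangle:
  assumes D: "0 < orient a b c"
  shows "frontier (open_triangle a b c) \<subseteq> closed_segment a b \<union> closed_segment b c \<union> closed_segment c a"
proof
  have seg: "z \<in> closed_segment x y"
    if "0 < orient x y w" "orient x y z = 0" "0 \<le> orient y w z" "0 \<le> orient w x z" for x y w z
  proof -
    define t where "t = orient w x z / orient x y w"
    have s: "orient y w z + orient w x z = orient x y w" using orient_sum[of x y z w] that(2) by simp
    then have t: "0 \<le> t" "t \<le> 1" "orient y w z / orient x y w = 1 - t"
      using that by (simp_all add: t_def field_simps)
    have "of_real (orient x y w) * z = of_real (orient y w z) * x + of_real (orient w x z) * y"
      using barycentric[of x y w z] that(2) by simp
    then have "z = of_real (orient y w z / orient x y w) * x + of_real t * y"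
      using that(1) by (simp add: t_def field_simps)
    then show ?thesis using t unfolding in_segment by (intro exI[of _ t]) (simp add: scaleR_conv_of_real)
  qed
  fix z assume "z \<in> frontier (open_triangle a b c)"
  then have z: "z \<in> triangle a b c" "z \<notin> open_triangle a b c"
    using closure_minimal[OF open_triangle_subset closed_triangle] interior_open[OF open_open_triangle]
    unfolding frontier_def by blast+
  have "orient b c a = orient a b c" "orient c a b = orient a b c" by (simp_all add: orient_def algebra_simps)
  then show "z \<in> closed_segment a b \<union> closed_segment b c \<union> closed_segment c a"
    using z seg[of a b c z] seg[of b c a z] seg[of c a b z] D
    unfolding triangle_def open_triangle_def by (auto simp: less_le)
qed

text \<open>Detects the orientation of the outer face: to the left of a side of a counterclockwise
  triangle lies its interior, which is bounded and has its frontier in \<open>S\<close>.\<close>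

lemma inside_triangle_not_outside:
  assumes D: "0 < orient a b c"
    and S: "closed_segment a b \<union> closed_segment b c \<union> closed_segment c a \<subseteq> S"
  shows "\<not> (\<forall>\<^sub>F \<epsilon> in at_right 0. midpoint a b + of_real \<epsilon> * \<i> * (b - a) \<in> outside S)"
proof
  assume ev: "\<forall>\<^sub>F \<epsilon> in at_right 0. midpoint a b + of_real \<epsilon> * \<i> * (b - a) \<in> outside S"
  define q where "q \<epsilon> = midpoint a b + of_real \<epsilon> * \<i> * (b - a)" for \<epsilon> :: real
  have out: "outside S \<subseteq> - open_triangle a b c"
  proof -
    have "bounded (open_triangle a b c)" using bounded_subset[OF bounded_triangle[OF D] open_triangle_subset] .
    then have "outside (frontier (open_triangle a b c)) \<subseteq> - closure (open_triangle a b c)"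
      by (rule outside_frontier_misses_closure)
    moreover have "outside S \<subseteq> outside (frontier (open_triangle a b c))"
      using frontier_open_triangle[OF D] S by (intro outside_mono) blast
    ultimately show ?thesis using closure_subset by blast
  qed
  have ab: "a \<noteq> b" using D by auto
  have m: "orient b c (q 0) = orient a b c / 2" "orient c a (q 0) = orient a b c / 2"
    by (simp_all add: q_def midpoint_def orient_def field_simps)
  have "((\<lambda>\<epsilon>. orient x y (q \<epsilon>)) \<longlongrightarrow> orient x y (q 0)) (at_right 0)" for x y
    unfolding q_def orient_def by (intro tendsto_intros)
  then have "\<forall>\<^sub>F \<epsilon> in at_right 0. 0 < orient b c (q \<epsilon>)" "\<forall>\<^sub>F \<epsilon> in at_right 0. 0 < orient c a (q \<epsilon>)"
    using m D by (metis half_gt_zero order_tendstoD(1))+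
  moreover have "\<forall>\<^sub>F \<epsilon>::real in at_right 0. 0 < \<epsilon>" by (simp add: eventually_at_filter)
  ultimately have "\<forall>\<^sub>F \<epsilon>::real in at_right 0. False"
    using ev
  proof eventually_elim
    fix \<epsilon> :: real
    assume h: "0 < orient b c (q \<epsilon>)" "0 < orient c a (q \<epsilon>)" "0 < \<epsilon>"
      "midpoint a b + of_real \<epsilon> * \<i> * (b - a) \<in> outside S"
    have "orient a b (q \<epsilon>) = \<epsilon> * (norm (b - a))\<^sup>2"
      unfolding cmod_power2 q_def
      by (simp add: orient_def midpoint_def algebra_simps power2_eq_square) (simp add: field_simps)
    then have "q \<epsilon> \<in> open_triangle a b c" using h ab by (simp add: open_triangle_def)
    then show False using out h(4) by (auto simp: q_def)
  qed
  then show False using eventually_happens'[OF trivial_limit_at_right_real] by blast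
qed

section \<open>Corner angles of a straight drawing\<close>

context triangulation
begin

text \<open>Measured from a fixed neighbour \<open>o'\<close>, each corner angle is an increment of
  \<open>g\<close>, except that the one corner returning to \<open>o'\<close> picks up an extra 2
  pi. The increments cancel because the rotation permutes the neighbours.\<close>

lemma rotation_angle_sum:
  assumes dist: "\<And>u v. (u, v) \<in> A \<Longrightarrow> p u \<noteq> p v"
    and dir: "\<And>v x y. (v, x) \<in> A \<Longrightarrow> (v, y) \<in> A \<Longrightarrow> x \<noteq> y \<Longrightarrow> cw_angle (p x - p v) (p y - p v) \<noteq> 0"
    and rot: "\<And>v x y. (v, x) \<in> A \<Longrightarrow> (v, y) \<in> A \<Longrightarrow> y \<noteq> x \<Longrightarrow>
      cw_angle (p x - p v) (p (rot v x) - p v) \<le> cw_angle (p x - p v) (p y - p v)"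
    and v: "v \<in> V"
  shows "(\<Sum>x\<in>neighbours G v. cw_angle (p x - p v) (p (rot v x) - p v)) = 2 * pi"
proof -
  let ?N = "neighbours G v"
  obtain o' where o: "(v, o') \<in> A" using vertex_has_arc[OF v] .
  define g where "g y = cw_angle (p o' - p v) (p y - p v)" for y
  have nz: "p y - p v \<noteq> 0" if "(v, y) \<in> A" for y using dist[OF that] by simp
  have g0: "g o' = 0" using nz[OF o] Arg2pi_eq_0[of 1] by (simp add: g_def cw_angle_def)
  have return: "cw_angle (p y - p v) (p o' - p v) = 2 * pi - g y" if y: "(v, y) \<in> A" "y \<noteq> o'" for y
  proof -
    have "cis (cw_angle (p y - p v) (p o' - p v) - (2 * pi - g y)) = 1"
      using nz y(1) o by (simp add: g_def cis_cw_angle sgn_zero_iff flip: cis_divide cis_mult)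
    moreover have "0 < g y" using dir[OF o y(1)] y(2) cw_angle_range[of "p o' - p v" "p y - p v"]
      by (auto simp: g_def less_le)
    ultimately have "cw_angle (p y - p v) (p o' - p v) - (2 * pi - g y) = 0"
      using cw_angle_range[of "p o' - p v" "p y - p v"] cw_angle_range[of "p y - p v" "p o' - p v"]
      by (intro cis_eq_1_imp) (auto simp: g_def)
    then show ?thesis by simp
  qed
  have step: "cw_angle (p y - p v) (p (rot v y) - p v) = g (rot v y) - g y + (if rot v y = o' then 2 * pi else 0)"
    if y: "y \<in> ?N" for y
  proof -
    have yA: "(v, y) \<in> A" using y by (simp add: neighbours_def)
    have rA: "(v, rot v y) \<in> A" using rot_arc[OF yA] .
    have ry: "rot v y \<noteq> y" using face_triangle(6)[OF arc_sym[OF yA]] .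
    show ?thesis
    proof (cases "y = o'")
      case True
      then show ?thesis using ry g0 by (simp add: g_def)
    next
      case yo: False
      show ?thesis
      proof (cases "rot v y = o'")
        case True
        then show ?thesis using return[OF yA yo] g0 by simp
      next
        case False
        have "cw_angle (p y - p v) (p (rot v y) - p v) \<le> cw_angle (p y - p v) (p o' - p v)"
          using rot[OF yA o] yo by simp
        then have "cw_angle (p (rot v y) - p v) (p o' - p v) =
            cw_angle (p y - p v) (p o' - p v) - cw_angle (p y - p v) (p (rot v y) - p v)"
          using nz yA rA o by (intro cw_angle_diff) auto
        then show ?thesis using return[OF yA yo] return[OF rA False] False by simp
      qed
    qed
  qed
  have fin: "finite ?N" by (rule finite_neighbours)
  have "o' \<in> rot v ` ?N" using o unfolding rot_image by (simp add: neighbours_def)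
  then obtain k where k: "k \<in> ?N" "rot v k = o'" by blast
  have "{y \<in> ?N. rot v y = o'} = {k}" using k inj_onD[OF rot_inj, of v] by auto
  then have "(\<Sum>y\<in>?N. if rot v y = o' then 2 * pi else 0) = 2 * pi"
    using fin by (simp add: sum.If_cases Int_def)
  moreover have "(\<Sum>y\<in>?N. g (rot v y)) = (\<Sum>y\<in>?N. g y)"
    using sum.reindex[OF rot_inj[of v], of g] rot_image by simp
  moreover have "(\<Sum>y\<in>?N. cw_angle (p y - p v) (p (rot v y) - p v)) =
    (\<Sum>y\<in>?N. g (rot v y) - g y + (if rot v y = o' then 2 * pi else 0))"
    using step by (intro sum.cong) auto
  ultimately show ?thesis by (simp add: sum.distrib sum_subtractf)
qed

text \<open>Counting the corner angles at the vertices and in the faces: each face contributes \<open>\<pi>\<close>,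
  or \<open>5\<pi>\<close> if it is negatively oriented, so by Euler's formula only one face is.\<close>

lemma one_negative_face:
  assumes dist: "\<And>u v. (u, v) \<in> A \<Longrightarrow> p u \<noteq> p v"
    and dir: "\<And>v x y. (v, x) \<in> A \<Longrightarrow> (v, y) \<in> A \<Longrightarrow> x \<noteq> y \<Longrightarrow> cw_angle (p x - p v) (p y - p v) \<noteq> 0"
    and rot: "\<And>v x y. (v, x) \<in> A \<Longrightarrow> (v, y) \<in> A \<Longrightarrow> y \<noteq> x \<Longrightarrow>
      cw_angle (p x - p v) (p (rot v x) - p v) \<le> cw_angle (p x - p v) (p y - p v)"
    and nondeg: "\<And>x v. (x, v) \<in> A \<Longrightarrow> orient (p x) (p v) (p (rot v x)) \<noteq> 0"
    and f: "(x, v) \<in> A" "orient (p x) (p v) (p (rot v x)) < 0"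
    and g: "(y, w) \<in> A" "orient (p y) (p w) (p (rot w y)) < 0"
  shows "face (x, v) = face (y, w)"
proof -
  let ?F = "map_faces G rot"
  define k where "k a = cw_angle (p (fst a) - p (snd a)) (p (rot (snd a) (fst a)) - p (snd a))" for a
  define neg where "neg f \<longleftrightarrow> (\<exists>(x, v)\<in>f. orient (p x) (p v) (p (rot v x)) < 0)" for f
  have "(\<Sum>a\<in>A. k a) = (\<Sum>v\<in>V. \<Sum>a\<in>{a \<in> A. snd a = v}. k a)"
    using finite_A finite_V arc_verts by (intro sum.group[symmetric]) auto
  also have "\<dots> = (\<Sum>v\<in>V. 2 * pi)"
  proof (rule sum.cong[OF refl])
    fix v assume v: "v \<in> V"
    have "{a \<in> A. snd a = v} = (\<lambda>x. (x, v)) ` neighbours G v"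
      using arc_sym by (auto simp: neighbours_def)
    then have "(\<Sum>a\<in>{a \<in> A. snd a = v}. k a) = (\<Sum>x\<in>neighbours G v. k (x, v))"
      by (simp add: sum.reindex inj_on_def)
    then show "(\<Sum>a\<in>{a \<in> A. snd a = v}. k a) = 2 * pi"
      using rotation_angle_sum[OF dist dir rot v] by (simp add: k_def)
  qed
  finally have 1: "(\<Sum>a\<in>A. k a) = 2 * pi * card V" by simp
  have 2: "(\<Sum>a\<in>A. k a) = (\<Sum>f\<in>?F. sum k f)" by (rule sum_over_faces)
  have "(\<Sum>f\<in>?F. sum k f) = (\<Sum>f\<in>?F. pi + (if neg f then 4 * pi else 0))"
  proof (rule sum.cong[OF refl])
    fix f assume "f \<in> ?F"
    then obtain x v where xv: "(x, v) \<in> A" "f = face (x, v)" by (auto simp: map_faces_def)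
    define w where "w = rot v x"
    note t = face_triangle[OF xv(1), folded w_def]
    have d: "x \<noteq> v" "v \<noteq> w" "w \<noteq> x" using arc_neq xv(1) t(4,5) by blast+
    have "sum k f = k (x, v) + k (v, w) + k (w, x)" unfolding xv(2) t(1) using d by simp
    also have "\<dots> = (if 0 < orient (p x) (p v) (p w) then pi else 5 * pi)"
      using corner_angle_sum[OF nondeg[OF xv(1)]] by (simp add: k_def t(2,3) w_def[symmetric])
    also have "\<dots> = pi + (if neg f then 4 * pi else 0)"
    proof -
      have r: "orient (p v) (p w) (p x) = orient (p x) (p v) (p w)" "orient (p w) (p x) (p v) = orient (p x) (p v) (p w)"
        by (simp_all add: orient_def algebra_simps)
      have "neg f \<longleftrightarrow> orient (p x) (p v) (p w) < 0"
        unfolding neg_def xv(2) t(1) using t(2,3) r by (simp add: w_def[symmetric])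
      then show ?thesis using nondeg[OF xv(1)] by (auto simp: w_def)
    qed
    finally show "sum k f = pi + (if neg f then 4 * pi else 0)" .
  qed
  also have "\<dots> = pi * card ?F + 4 * pi * card {f \<in> ?F. neg f}"
    using finite_faces by (simp add: sum.distrib sum.If_cases Int_def)
  finally have "pi * (card ?F + 4 * card {f \<in> ?F. neg f}) = pi * (2 * card V)"
    using 1 2 by (simp add: algebra_simps)
  then have "real (card ?F + 4 * card {f \<in> ?F. neg f}) = real (2 * card V)"
    using pi_neq_zero mult_cancel_left by (metis of_nat_add of_nat_mult of_nat_numeral)
  then have "card ?F + 4 * card {f \<in> ?F. neg f} = 2 * card V" using of_nat_eq_iff by blast
  \<comment> \<open>Compared with \<open>euler\<close>, the equation makes four times the number of
    negative faces equal to 4.\<close>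
  then have "card {f \<in> ?F. neg f} \<le> Suc 0" using euler(1) by presburger
  moreover have "finite {f \<in> ?F. neg f}" using finite_faces by simp
  ultimately have "\<forall>f\<in>{f \<in> ?F. neg f}. \<forall>g\<in>{f \<in> ?F. neg f}. f = g" using card_le_Suc0_iff_eq by blast
  moreover have "face (x, v) \<in> {f \<in> ?F. neg f}" "face (y, w) \<in> {f \<in> ?F. neg f}"
    using f g face_self face_in_faces unfolding neg_def by blast+
  ultimately show ?thesis by blast
qed

end

context metric_triangulation
begin

lemma nondegenerate:
  assumes len: "\<And>u v. (u, v) \<in> A \<Longrightarrow> dist (p u) (p v) = l {u, v}" and xv: "(x, v) \<in> A"
  shows "orient (p x) (p v) (p (rot v x)) \<noteq> 0"
proof -
  define w where "w = rot v x"
  note t = face_triangle[OF xv, folded w_def] and i = triangle_ineq[OF xv, folded w_def]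
  have d: "dist (p x) (p v) = l {x, v}" "dist (p v) (p w) = l {v, w}" "dist (p x) (p w) = l {w, x}"
    using len[OF xv] len[OF t(4)] len[OF t(5)] by (simp_all add: dist_commute)
  have "0 < 4 * (orient (p x) (p v) (p w))\<^sup>2"
    unfolding heron d using i length_pos[OF xv] length_pos[OF t(4)] length_pos[OF t(5)]
    by (intro mult_pos_pos) auto
  then show ?thesis by (auto simp: w_def)
qed

text \<open>The outer face is negative, since its left side is unbounded, and it thereby uses up the
  single negative face that the angle count allows.\<close>

lemma straight_drawing_orientation:
  assumes sd: "straight_drawing G rot outer l p" and xv: "(x, v) \<in> A"
  shows "sgn (orient (p x) (p v) (p (rot v x))) = (if (x, v) \<in> outer then - 1 else 1)"
proof -
  have pd: "proper_drawing G p (\<lambda>u v. linepath (p u) (p v))"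
    and rr: "respects_rotation G rot p (\<lambda>u v. linepath (p u) (p v))"
    and ub: "is_unbounded_face G p outer"
    and len: "\<And>u v. (u, v) \<in> A \<Longrightarrow> dist (p u) (p v) = l {u, v}"
    using sd unfolding straight_drawing_def map_drawing_def by auto
  have inj: "inj_on p V" using pd by (simp add: proper_drawing_iff)
  have dist: "p u \<noteq> p v" if "(u, v) \<in> A" for u v
    using len[OF that] length_pos[OF that] by auto
  have cross: "closed_segment (p u) (p v) \<inter> closed_segment (p x) (p y) \<subseteq> p ` ({u, v} \<inter> {x, y})"
    if "(u, v) \<in> A" "(x, y) \<in> A" "{u, v} \<noteq> {x, y}" for u v x y
    using pd that unfolding proper_drawing_iff by simp
  have rot: "cw_angle (p x - p v) (p (rot v x) - p v) \<le> cw_angle (p x - p v) (p y - p v)"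
    if "(v, x) \<in> A" "(v, y) \<in> A" "y \<noteq> x" for v x y
    using rr that respects_rotation_straight[of p, OF dist] by blast
  \<comment> \<open>Two edges leaving \<open>v\<close> in the same direction would overlap beyond
    \<open>p v\<close>, against properness.\<close>
  have dir: "cw_angle (p x - p v) (p y - p v) \<noteq> 0" if a: "(v, x) \<in> A" "(v, y) \<in> A" "x \<noteq> y" for v x y
  proof
    assume z: "cw_angle (p x - p v) (p y - p v) = 0"
    have nz: "p x - p v \<noteq> 0" "p y - p v \<noteq> 0" using dist[OF a(1)] dist[OF a(2)] by auto
    obtain r where r: "0 < r" "p y - p v = of_real r * (p x - p v)" using cw_angle_eq_0[OF nz z] .
    have ne: "{v, x} \<noteq> {v, y}" using a(3) by (auto simp: doubleton_eq_iff)
    have eq: "{v, x} \<inter> {v, y} = {v}" using a arc_neq by blast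
    then have c: "closed_segment (p v) (p x) \<inter> closed_segment (p v) (p y) \<subseteq> {p v}"
      using cross[OF a(1,2) ne] unfolding eq by simp
    have "p x = p y \<or> p x \<in> open_segment (p v) (p y) \<or> p y \<in> open_segment (p v) (p x)"
      using collinear_cases[OF r] nz by auto
    then have "p x \<in> closed_segment (p v) (p y) \<or> p y \<in> closed_segment (p v) (p x)"
      using open_closed_segment by auto
    then show False using c nz by auto
  qed
  have nd: "orient (p x) (p v) (p (rot v x)) \<noteq> 0" if "(x, v) \<in> A" for x v
    using nondegenerate[OF len that] .
  have outneg: "orient (p u) (p w) (p (rot w u)) < 0" if uw: "(u, w) \<in> outer" for u w
  proof (rule ccontr)
    assume nneg: "\<not> ?thesis"
    have a: "(u, w) \<in> A" using uw outer_sub by blast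
    then have pos: "0 < orient (p u) (p w) (p (rot w u))" using nd[OF a] nneg by simp
    have "closed_segment (p u) (p w) \<union> closed_segment (p w) (p (rot w u)) \<union> closed_segment (p (rot w u)) (p u)
      \<subseteq> (\<Union>(x, y)\<in>A. closed_segment (p x) (p y))"
      using a face_triangle(4,5)[OF a] by blast
    from inside_triangle_not_outside[OF pos this] show False
      using ub uw unfolding is_unbounded_face_def by blast
  qed
  show ?thesis
  proof (cases "(x, v) \<in> outer")
    case True
    then show ?thesis using outneg by simp
  next
    case False
    have "\<not> orient (p x) (p v) (p (rot v x)) < 0"
    proof
      assume neg: "orient (p x) (p v) (p (rot v x)) < 0"
      obtain a b where ab: "(a, b) \<in> outer" using outer_triangle by (metis insertI1)
      then have "(a, b) \<in> A" "face (a, b) = outer" using mem_face[OF outer] by blast+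
      then have "face (x, v) = outer"
        using one_negative_face[OF dist dir rot nd xv neg, of a b] outneg[OF ab] by simp
      then show False using False face_self[OF xv] by simp
    qed
    then show ?thesis using nd[OF xv] False by simp
  qed
qed

text \<open>The quotient \<open>c u v\<close> is the rotation taking an edge of the first drawing to
  that of the second. It is the same in both directions of the edge and on all sides of a face, and
  connectedness spreads it over the graph.\<close>

lemma straight_drawing_unique:
  assumes p: "straight_drawing G rot outer l p" and q: "straight_drawing G rot outer l q"
  obtains c b :: complex where "norm c = 1" "\<And>v. v \<in> V \<Longrightarrow> q v = c * p v + b"
proof -
  have lp: "dist (p u) (p v) = l {u, v}" and lq: "dist (q u) (q v) = l {u, v}" if "(u, v) \<in> A" for u v
    using p q that unfolding straight_drawing_def by auto
  define c where "c u v = (q v - q u) / (p v - p u)" for u v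
  have pne: "p v - p u \<noteq> 0" if "(u, v) \<in> A" for u v
    using lp[OF that] length_pos[OF that] by auto
  have csym: "c v u = c u v" for u v
    unfolding c_def by (metis minus_diff_eq minus_divide_divide)
  have step_eq: "c v (rot v x) = c x v" if xv: "(x, v) \<in> A" for x v
  proof -
    note t = face_triangle[OF xv]
    have "(q v - q x) / (p v - p x) = (q (rot v x) - q v) / (p (rot v x) - p v)"
    proof (rule congruent_triangles)
      show "orient (p x) (p v) (p (rot v x)) \<noteq> 0" using nondegenerate[OF lp xv] .
      show "sgn (orient (p x) (p v) (p (rot v x))) = sgn (orient (q x) (q v) (q (rot v x)))"
        using straight_drawing_orientation[OF p xv] straight_drawing_orientation[OF q xv] by simp
      show "dist (p x) (p v) = dist (q x) (q v)" "dist (p v) (p (rot v x)) = dist (q v) (q (rot v x))"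
        "dist (p (rot v x)) (p x) = dist (q (rot v x)) (q x)"
        using lp[OF xv] lq[OF xv] lp[OF t(4)] lq[OF t(4)] lp[OF t(5)] lq[OF t(5)] by simp_all
    qed
    then show ?thesis by (simp add: c_def)
  qed
  \<comment> \<open>Consecutive edges at \<open>v\<close> are sides of a common face, so the value
    is passed on by the rotation, which reaches every neighbour.\<close>
  have around: "c v y = c v x" if "(v, x) \<in> A" "(v, y) \<in> A" for v x y
  proof -
    have "y \<in> orbit (rot v) x" using that neighbours_orbit by (auto simp: neighbours_def)
    then have "c v y = c v x \<and> (v, y) \<in> A"
    proof induction
      case base
      show ?case using step_eq[OF arc_sym[OF that(1)]] csym rot_arc[OF that(1)] by metis
    next
      case (step y)
      then show ?case using step_eq[OF arc_sym, of v y] csym rot_arc[of v y] by metis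
    qed
    then show ?thesis ..
  qed
  obtain r s where rs: "(r, s) \<in> A" using arcs_nonempty by auto
  define k where "k = c r s"
  have const: "c v y = k" if "(r, v) \<in> A\<^sup>*" "(v, y) \<in> A" for v y
    using that
  proof (induction arbitrary: y)
    case base
    then show ?case using around[OF rs] by (simp add: k_def)
  next
    case (step u v)
    have "c v y = c v u" using around[OF arc_sym[OF step(2)] step.prems] .
    also have "\<dots> = k" using step csym by metis
    finally show ?case .
  qed
  have rV: "r \<in> V" using arc_verts[OF rs] by blast
  have edge: "q v - q u = k * (p v - p u)" if "(u, v) \<in> A" for u v
  proof -
    have "c u v = k" using const[OF _ that] connected_arcs[OF rV] arc_verts[OF that] by blast
    then show ?thesis using pne[OF that] by (auto simp: c_def)
  qed
  have "norm k = 1"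
  proof -
    have "norm (q s - q r) = norm (p s - p r)" using lp[OF rs] lq[OF rs] by (metis dist_norm norm_minus_commute)
    then show ?thesis using pne[OF rs] by (simp add: k_def c_def norm_divide)
  qed
  moreover have "q v = k * p v + (q r - k * p r)" if "v \<in> V" for v
    using connected_arcs[OF rV that]
  proof induction
    case base
    show ?case by simp
  next
    case (step u v)
    have e: "q v = q u + k * (p v - p u)" using edge[OF step(2)] by (metis add.commute diff_add_cancel)
    show ?case unfolding e step.IH by (simp add: algebra_simps)
  qed
  ultimately show ?thesis using that by blast
qed

lemma straight_drawing_exists:
  assumes "\<And>v. v \<in> V \<Longrightarrow> v \<notin> face_verts outer \<Longrightarrow> angle_sum G rot outer l v = 2 * pi"
  obtains p where "straight_drawing G rot outer l p"
proof -
  obtain p where p: "\<And>u v. (u, v) \<in> A \<Longrightarrow> dist (p u) (p v) = l {u, v}"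
    "\<And>x v. (x, v) \<in> A - outer \<Longrightarrow> 0 < orient (p x) (p v) (p (rot v x))"
    using development[OF assms] by metis
  interpret D: developed G rot outer p
  proof
    show "orient (p x) (p v) (p (rot v x)) \<noteq> 0" if "(x, v) \<in> outer" for x v
      using nondegenerate[OF p(1), of x v] that outer_sub by blast
  qed (use outer p(2) in auto)
  show ?thesis
    using that[of p] D.embedding p(1) by (auto simp: straight_drawing_def)
qed

end

theorem theorem3p14:
  fixes G :: "'a pair_pre_digraph"
    and rot :: "'a \<Rightarrow> 'a \<Rightarrow> 'a"
    and outer :: "('a \<times> 'a) set"
    and v1 v2 v3 :: 'a
    and l :: "'a set \<Rightarrow> real"
  assumes "planar_triangulation G rot"
    and "outer \<in> map_faces G rot"
    and "face_verts outer = {v1, v2, v3}"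
    and "feasible G rot l"
    and "\<forall>v \<in> pverts G - {v1, v2, v3}. angle_sum G rot outer l v = 2 * pi"
  shows "(\<exists>p. straight_drawing G rot outer l p) \<and>
    (\<forall>p q. straight_drawing G rot outer l p \<and> straight_drawing G rot outer l q \<longrightarrow>
       (\<exists>c b :: complex. norm c = 1 \<and> (\<forall>v \<in> pverts G. q v = c * p v + b)))"
proof -
  interpret metric_triangulation G rot outer l
    using assms by unfold_locales (auto simp: map_faces_def)
  show ?thesis
    using straight_drawing_exists straight_drawing_unique assms(3,5) by (metis DiffI)
qed

end
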